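(* Let $d\ge2$, $1\le k\le M$, $\mathcal H\cong\mathbb C^d$, and let $\mathcal E:\mathsf{Lin}(\mathcal H_{in})\to\mathsf{Lin}((\mathcal H^{\otimes M})_+)$ be a symmetric broadcast channel. Then there is a measure-and-prepare channel of the form $\widetilde{\mathcal E}(\rho)=\int\mathrm{Tr}[Q_\varphi\rho]\,|\varphi\rangle\langle\varphi|^{\otimes M}\,d\varphi$, with $Q_\varphi\,d\varphi$ a POVM on $\mathcal H_{in}$ and $|\varphi\rangle\in\mathcal H$ unit vectors, such that $$\big\|\widetilde{\mathcal E}^{(k)}-\mathcal E^{(k)}\big\|_\diamond\le4\left(1-\sqrt{\frac{d^{(M-k)}_+}{d^{(M)}_+}}\right)\le\frac{2kd}{M},$$ where $\widetilde{\mathcal E}^{(k)}=\mathrm{Tr}_{M-k}\circ\widetilde{\mathcal E}$ and $\mathcal E^{(k)}=\mathrm{Tr}_{M-k}\circ\mathcal E$.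
   Context: $\mathcal H_{in}$ is a finite-dimensional Hilbert space. A channel is a completely positive trace-preserving map. A channel $\mathcal E:\mathsf{Lin}(\mathcal H_{in})\to\mathsf{Lin}(\mathcal H^{\otimes M})$ is a symmetric broadcast channel if $U^{(M)}_\pi\mathcal E(\rho)U^{(M)\dagger}_\pi=\mathcal E(\rho)$ for all $\rho$ and all $\pi\in S_M$, where $U^{(M)}_\pi$ permutes the tensor factors. $(\mathcal H^{\otimes n})_+$ is the symmetric subspace, $d^{(n)}_+=\binom{d+n-1}{n}$ its dimension; $d\varphi$ is the normalized $SU(d)$-invariant measure on pure states. $\mathrm{Tr}_{M-k}$ is the partial trace over $M-k$ of the $M$ factors. The diamond norm of a Hermitian-preserving map $\Delta$ is $\|\Delta\|_\diamond=\sup_{\mathcal H_A}\sup_{\|\Psi\|=1}\|(\mathcal I_A\otimes\Delta)(|\Psi\rangle\langle\Psi|)\|_1$, with $\|A\|_1=\mathrm{Tr}|A|$. *)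

theory Defs
  imports "HOL-Analysis.Analysis" "Jordan_Normal_Form.Schur_Decomposition"
begin

(* Operators on C^n are complex n x n matrices (Jordan_Normal_Form).
   H^{\<otimes>M} with H = C^d is C^(d^M); a basis index a < d^M encodes the
   tuple of tensor-factor indices (digit d j a)_{j<M}. *)

definition digit :: "nat \<Rightarrow> nat \<Rightarrow> nat \<Rightarrow> nat" where
  "digit d j a = (a div d ^ j) mod d"

definition mtrace :: "complex mat \<Rightarrow> complex" where
  "mtrace A = (\<Sum>i<dim_row A. A $$ (i, i))"

definition perm_op :: "nat \<Rightarrow> nat \<Rightarrow> (nat \<Rightarrow> nat) \<Rightarrow> complex mat" where
  "perm_op d M \<pi> = mat (d ^ M) (d ^ M)
     (\<lambda>(a, b). if (\<forall>j<M. digit d j a = digit d (\<pi> j) b) then 1 else 0)"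

definition sym_proj :: "nat \<Rightarrow> nat \<Rightarrow> complex mat" where
  "sym_proj d M = mat (d ^ M) (d ^ M)
     (\<lambda>(a, b). (\<Sum>\<pi>\<in>{\<pi>. \<pi> permutes {..<M}}. perm_op d M \<pi> $$ (a, b)) / of_nat (fact M))"

(* dimension d_+^{(n)} of the symmetric subspace *)
definition dplus :: "nat \<Rightarrow> nat \<Rightarrow> nat" where
  "dplus d n = (d + n - 1) choose n"

definition psd :: "complex mat \<Rightarrow> bool" where
  "psd A \<longleftrightarrow> A \<in> carrier_mat (dim_row A) (dim_row A) \<and> mat_adjoint A = A \<and>
     (\<forall>v\<in>carrier_vec (dim_row A). 0 \<le> Re (Matrix.scalar_prod (conjugate v)  (A *\<^sub>v v)))"

(* (I_{C^r} \<otimes> E)(X) for X an operator on C^r \<otimes> C^n, E mapping n x n to m x m *)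
definition ampl :: "nat \<Rightarrow> nat \<Rightarrow> nat \<Rightarrow> (complex mat \<Rightarrow> complex mat) \<Rightarrow> complex mat \<Rightarrow> complex mat" where
  "ampl r n m E X = mat (r * m) (r * m)
     (\<lambda>(i, j). E (mat n n (\<lambda>(p, q). X $$ ((i div m) * n + p, (j div m) * n + q))) $$ (i mod m, j mod m))"

definition is_channel :: "nat \<Rightarrow> nat \<Rightarrow> (complex mat \<Rightarrow> complex mat) \<Rightarrow> bool" where
  "is_channel n m E \<longleftrightarrow>
     (\<forall>A\<in>carrier_mat n n. E A \<in> carrier_mat m m) \<and>
     (\<forall>A\<in>carrier_mat n n. \<forall>B\<in>carrier_mat n n. E (A + B) = E A + E B) \<and>
     (\<forall>c. \<forall>A\<in>carrier_mat n n. E (c \<cdot>\<^sub>m A) = c \<cdot>\<^sub>m E A) \<and>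
     (\<forall>A\<in>carrier_mat n n. mtrace (E A) = mtrace A) \<and>
     (\<forall>r. \<forall>X\<in>carrier_mat (r * n) (r * n). psd X \<longrightarrow> psd (ampl r n m E X))"

definition sym_broadcast :: "nat \<Rightarrow> nat \<Rightarrow> nat \<Rightarrow> (complex mat \<Rightarrow> complex mat) \<Rightarrow> bool" where
  "sym_broadcast d M n E \<longleftrightarrow>
     is_channel n (d ^ M) E \<and>
     (\<forall>\<rho>\<in>carrier_mat n n. sym_proj d M * E \<rho> * sym_proj d M = E \<rho>) \<and>
     (\<forall>\<pi>. \<pi> permutes {..<M} \<longrightarrow> (\<forall>\<rho>\<in>carrier_mat n n.
        perm_op d M \<pi> * E \<rho> * mat_adjoint (perm_op d M \<pi>) = E \<rho>))"

definition ptrace :: "nat \<Rightarrow> nat \<Rightarrow> complex mat \<Rightarrow> complex mat" where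
  "ptrace dk dr A = mat dk dk (\<lambda>(i, j). \<Sum>l<dr. A $$ (i * dr + l, j * dr + l))"

definition trace_norm :: "complex mat \<Rightarrow> real" where
  "trace_norm A = Re (mtrace (THE B. B \<in> carrier_mat (dim_col A) (dim_col A) \<and> psd B \<and>
                                    B * B = mat_adjoint A * A))"

definition proj :: "complex vec \<Rightarrow> complex mat" where
  "proj \<psi> = mat (dim_vec \<psi>) (dim_vec \<psi>) (\<lambda>(i, j). \<psi> $ i * cnj (\<psi> $ j))"

definition unit_vec :: "complex vec \<Rightarrow> bool" where
  "unit_vec \<psi> \<longleftrightarrow> (\<Sum>i<dim_vec \<psi>. (cmod (\<psi> $ i))\<^sup>2) = 1"

definition diamond_norm :: "nat \<Rightarrow> nat \<Rightarrow> (complex mat \<Rightarrow> complex mat) \<Rightarrow> real" where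
  "diamond_norm n m \<Delta> = Sup {trace_norm (ampl r n m \<Delta> (proj \<psi>)) | r \<psi>.
       \<psi> \<in> carrier_vec (r * n) \<and> unit_vec \<psi>}"

definition lebesgue_Cd :: "nat \<Rightarrow> (nat \<Rightarrow> complex) measure" where
  "lebesgue_Cd d = PiM {..<d} (\<lambda>_. lborel)"

definition cnorm :: "nat \<Rightarrow> (nat \<Rightarrow> complex) \<Rightarrow> real" where
  "cnorm d x = sqrt (\<Sum>i<d. (cmod (x i))\<^sup>2)"

definition unit_ball_Cd :: "nat \<Rightarrow> (nat \<Rightarrow> complex) set" where
  "unit_ball_Cd d = {x \<in> space (lebesgue_Cd d). cnorm d x \<le> 1}"

definition normalize_Cd :: "nat \<Rightarrow> (nat \<Rightarrow> complex) \<Rightarrow> (nat \<Rightarrow> complex)" where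
  "normalize_Cd d x = restrict (\<lambda>i. x i / complex_of_real (cnorm d x)) {..<d}"

(* d\<phi>: normalized unitarily invariant measure on unit vectors of C^d
   (radial projection of the uniform distribution on the unit ball) *)
definition phi_measure :: "nat \<Rightarrow> (nat \<Rightarrow> complex) measure" where
  "phi_measure d = distr (uniform_measure (lebesgue_Cd d) (unit_ball_Cd d))
                         (PiM {..<d} (\<lambda>_. borel)) (normalize_Cd d)"

definition tensor_pow_proj :: "nat \<Rightarrow> nat \<Rightarrow> (nat \<Rightarrow> complex) \<Rightarrow> complex mat" where
  "tensor_pow_proj d M \<phi> = mat (d ^ M) (d ^ M)
     (\<lambda>(a, b). (\<Prod>j<M. \<phi> (digit d j a)) * cnj (\<Prod>j<M. \<phi> (digit d j b)))"

definition is_povm_density :: "nat \<Rightarrow> nat \<Rightarrow> ((nat \<Rightarrow> complex) \<Rightarrow> complex mat) \<Rightarrow> bool" where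
  "is_povm_density d n Q \<longleftrightarrow>
     (\<forall>\<phi>\<in>space (phi_measure d). Q \<phi> \<in> carrier_mat n n \<and> psd (Q \<phi>)) \<and>
     (\<forall>i<n. \<forall>j<n. integrable (phi_measure d) (\<lambda>\<phi>. Q \<phi> $$ (i, j))) \<and>
     mat n n (\<lambda>(i, j). LINT \<phi>|phi_measure d. Q \<phi> $$ (i, j)) = 1\<^sub>m n"

definition meas_prep :: "nat \<Rightarrow> nat \<Rightarrow> ((nat \<Rightarrow> complex) \<Rightarrow> complex mat) \<Rightarrow> complex mat \<Rightarrow> complex mat" where
  "meas_prep d M Q \<rho> = mat (d ^ M) (d ^ M)
     (\<lambda>(a, b). LINT \<phi>|phi_measure d. mtrace (Q \<phi> * \<rho>) * tensor_pow_proj d M \<phi> $$ (a, b))"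

end

theory Submission
  imports Defs "HOL-Probability.Distributions" "HOL-Combinatorics.Permutations"
    "Jordan_Normal_Form.Spectral_Radius"
begin

text \<open>
  Write \<open>d\<^sub>n\<close> for the dimension of the symmetric subspace of \<open>n\<close> copies, \<open>m = M - k\<close> and \<open>x = d\<^sub>m / d\<^sub>M\<close>.
  The POVM is \<open>Q\<^sub>\<phi> = d\<^sub>M E\<^sup>\<dagger>(\<phi>\<^sup>\<otimes>\<^sup>M)\<close>. Let \<open>R\<close> be the output of \<open>E\<close> on a pure input with reference system,
  \<open>R\<^sub>\<phi> = \<langle>\<phi>\<^sup>\<otimes>\<^sup>m| R |\<phi>\<^sup>\<otimes>\<^sup>m\<rangle>\<close> and \<open>P = |\<phi>\<rangle>\<langle>\<phi>|\<^sup>\<otimes>\<^sup>k\<close>. Since \<open>R\<close> is supported on the symmetric subspace and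
  \<open>d\<^sub>n \<integral> |\<phi>\<rangle>\<langle>\<phi>|\<^sup>\<otimes>\<^sup>n d\<phi>\<close> is the symmetric projection, the two reduced outputs are
  \<open>\<rho> = d\<^sub>m \<integral> R\<^sub>\<phi> d\<phi>\<close> and \<open>\<sigma> = d\<^sub>M \<integral> P R\<^sub>\<phi> P d\<phi>\<close>, while \<open>d\<^sub>M \<integral> P R\<^sub>\<phi> d\<phi> = \<rho>\<close>. Hence
  \<open>\<sigma> - x \<rho> = d\<^sub>M \<integral> (P - x) R\<^sub>\<phi> (P - x) d\<phi> \<ge> 0\<close>, so that \<open>\<sigma> - \<rho>\<close> is the difference of two positive operators
  of trace \<open>1 - x\<close> and its trace norm is at most \<open>2 (1 - x) \<le> 4 (1 - \<surd>x)\<close>.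

  The moments of the measure \<open>d\<phi>\<close> are computed by comparison with Gaussian integrals.
\<close>

section \<open>Positive semidefinite matrices and the trace norm\<close>

text \<open>The number x comes from an optimization. For real y the integral d_M \<integral> (P - y)
  R_\<phi> (P - y) d\<phi> equals \<sigma> - (2 y - y^2 / x) \<rho>, because the square term carries
  the normalization d_m instead of d_M. The coefficient of \<rho> is largest at y = x, where it
  equals x. Positivity has to hold with an arbitrary reference system, whereas a single block of R
  is the value of E at an arbitrary matrix and need not be positive. The integral identities are
  therefore stated block by block as sesquilinear forms in two independent vectors, and positivity
  is read off only after the blocks are reassembled. Since the measure is the radial image of the
  uniform distribution on a ball, its moments rest on three facts: a Gaussian weight factors over
  the coordinates, ball integrals of scale-invariant functions grow like a fixed power of the
  radius, and a phase on one coordinate preserves the measure.\<close>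

lemma index_mult_mat_sum:
  assumes "A \<in> carrier_mat n m" "B \<in> carrier_mat m p" "i < n" "j < p"
  shows "(A * B) $$ (i, j) = (\<Sum>k<m. A $$ (i, k) * B $$ (k, j))"
  using assms by (auto simp: scalar_prod_def lessThan_atLeast0 intro!: sum.cong)

lemma mat_adjoint_carrier [simp]: "A \<in> carrier_mat n m \<Longrightarrow> mat_adjoint A \<in> carrier_mat m n"
  by (auto simp: mat_adjoint_def mat_of_rows_def)

lemma dim_mat_adjoint [simp]: "dim_row (mat_adjoint A) = dim_col A" "dim_col (mat_adjoint A) = dim_row A"
  by (simp_all add: mat_adjoint_def)

lemma mat_adjoint_index:
  assumes "A \<in> carrier_mat n m" "i < m" "j < n"
  shows "mat_adjoint A $$ (i, j) = cnj (A $$ (j, i))"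
  using assms by (simp add: mat_adjoint_def mat_of_rows_def)

lemma mat_adjoint_mult:
  fixes A B :: "complex mat"
  assumes "A \<in> carrier_mat n m" "B \<in> carrier_mat m p"
  shows "mat_adjoint (A * B) = mat_adjoint B * mat_adjoint A"
proof (rule eq_matI)
  have c: "A * B \<in> carrier_mat n p" using assms by simp
  have cA: "mat_adjoint A \<in> carrier_mat m n" and cB: "mat_adjoint B \<in> carrier_mat p m" using assms by auto
  fix i j assume "i < dim_row (mat_adjoint B * mat_adjoint A)" "j < dim_col (mat_adjoint B * mat_adjoint A)"
  then have ij: "i < p" "j < n" using cA cB by auto
  show "mat_adjoint (A * B) $$ (i, j) = (mat_adjoint B * mat_adjoint A) $$ (i, j)"
    unfolding mat_adjoint_index[OF c ij] index_mult_mat_sum[OF assms ij(2,1)] index_mult_mat_sum[OF cB cA ij]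
    using ij by (simp add: mat_adjoint_index[OF assms(1)] mat_adjoint_index[OF assms(2)] mult.commute)
qed simp_all

lemma hermitian_index:
  assumes "A \<in> carrier_mat n n" "mat_adjoint A = A" "i < n" "j < n"
  shows "cnj (A $$ (i, j)) = A $$ (j, i)"
  using mat_adjoint_index[OF assms(1,4,3)] assms(2) by simp

lemma hermitianI:
  assumes "A \<in> carrier_mat n n" "\<And>i j. i < n \<Longrightarrow> j < n \<Longrightarrow> cnj (A $$ (i, j)) = A $$ (j, i)"
  shows "mat_adjoint A = A"
  by (rule eq_matI) (use assms in \<open>auto simp: mat_adjoint_index[OF assms(1)]\<close>)

text \<open>The form <u, A u> with u a function on indices rather than a vector, so that sums over
  composite indices can be split and reindexed without carrier conditions on u.\<close>

definition qform :: "nat \<Rightarrow> complex mat \<Rightarrow> (nat \<Rightarrow> complex) \<Rightarrow> complex" where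
  "qform N A u = (\<Sum>i<N. \<Sum>j<N. cnj (u i) * A $$ (i, j) * u j)"

lemma qform_scalar_prod:
  assumes "A \<in> carrier_mat N N" "v \<in> carrier_vec N"
  shows "scalar_prod (conjugate v) (A *\<^sub>v v) = qform N A (vec_index v)"
  using assms
  by (auto simp: qform_def scalar_prod_def lessThan_atLeast0 sum_distrib_left mult_ac conjugate_vec_def intro!: sum.cong)

lemma qform_cnj:
  assumes "A \<in> carrier_mat N N" "mat_adjoint A = A"
  shows "cnj (qform N A u) = qform N A u"
proof -
  have "cnj (qform N A u) = (\<Sum>i<N. \<Sum>j<N. cnj (u j) * A $$ (j, i) * u i)"
    by (auto simp: qform_def hermitian_index[OF assms] mult_ac intro!: sum.cong)
  also have "\<dots> = qform N A u"
    unfolding qform_def by (rule sum.swap)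
  finally show ?thesis .
qed

lemma psd_qform_nonneg:
  assumes "A \<in> carrier_mat N N" "psd A"
  shows "0 \<le> qform N A u"
proof -
  have "qform N A u = qform N A (vec_index (vec N u))" by (simp add: qform_def)
  also have "\<dots> = scalar_prod (conjugate (vec N u)) (A *\<^sub>v vec N u)"
    by (rule qform_scalar_prod[symmetric]) (use assms in auto)
  finally have "0 \<le> Re (qform N A u)" using assms by (auto simp: psd_def)
  moreover have "Im (qform N A u) = 0"
    using qform_cnj[OF assms(1), of u] assms by (auto simp: psd_def complex_eq_iff)
  ultimately show ?thesis by (simp add: less_eq_complex_def)
qed

text \<open>Over the complex numbers a form with real values is Hermitian, by polarization, and
  \<open>0 \<le> z\<close> in the complex order contains \<open>Im z = 0\<close>. Positivity proofs
  thus reduce to exhibiting one form as a sum or an integral of nonnegative terms.\<close>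

lemma psdI_qform:
  assumes A: "A \<in> carrier_mat N N" and pos: "\<And>u. 0 \<le> qform N A u"
  shows "psd A"
proof -
  have herm: "cnj (A $$ (i, j)) = A $$ (j, i)" if ij: "i < N" "j < N" for i j
  proof -
    have delta: "qform N A (\<lambda>k. (if k = i then x else 0) + (if k = j then y else 0)) =
        cnj x * A $$ (i, i) * x + cnj x * A $$ (i, j) * y + cnj y * A $$ (j, i) * x + cnj y * A $$ (j, j) * y" for x y
    proof -
      have 1: "(\<Sum>b<N. cnj u * A $$ (a, b) * ((if b = i then x else 0) + (if b = j then y else 0))) =
         cnj u * (A $$ (a, i) * x + A $$ (a, j) * y)" for a u
        using ij by (simp add: algebra_simps sum.distrib if_distrib[of "\<lambda>z. _ * z"] sum.delta cong: if_cong)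
      have "qform N A (\<lambda>k. (if k = i then x else 0) + (if k = j then y else 0)) =
        (\<Sum>a<N. (if a = i then cnj x * (A $$ (i, i) * x + A $$ (i, j) * y) else 0)
           + (if a = j then cnj y * (A $$ (j, i) * x + A $$ (j, j) * y) else 0))"
        unfolding qform_def 1 by (intro sum.cong) (auto simp: algebra_simps)
      also have "\<dots> = cnj x * (A $$ (i, i) * x + A $$ (i, j) * y) + cnj y * (A $$ (j, i) * x + A $$ (j, j) * y)"
        using ij by (simp add: sum.distrib)
      finally show ?thesis by (simp add: algebra_simps)
    qed
    have im: "Im (cnj x * A $$ (i, i) * x + cnj x * A $$ (i, j) * y + cnj y * A $$ (j, i) * x + cnj y * A $$ (j, j) * y) = 0" for x y
      using pos[of "\<lambda>k. (if k = i then x else 0) + (if k = j then y else 0)"] unfolding delta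
      by (simp add: less_eq_complex_def)
    \<comment> \<open>The first two choices make the diagonal entries real; (1, 1) makes the
      imaginary parts of the entries ij and ji opposite, and (1, \<open>\<i>\<close>) makes their
      real parts equal.\<close>
    from im[of 1 0] im[of 0 1] im[of 1 1] im[of 1 \<i>] show ?thesis
      by (auto simp: complex_eq_iff)
  qed
  have "mat_adjoint A = A" by (rule hermitianI[OF A herm])
  moreover have "0 \<le> Re (scalar_prod (conjugate v) (A *\<^sub>v v))" if "v \<in> carrier_vec N" for v
    using pos[of "vec_index v"] unfolding qform_scalar_prod[OF A that] by (simp add: less_eq_complex_def)
  ultimately show ?thesis using A by (auto simp: psd_def)
qed

text \<open>A Householder reflection; multiplying \<^term>\<open>v\<close> by a phase makes its entry at 0 nonpositive,
  so that the reflection vector is nonzero.\<close>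

lemma householder:
  fixes v :: "nat \<Rightarrow> complex"
  assumes v: "(\<Sum>i<n. (cmod (v i))\<^sup>2) = 1" and n: "n > 0"
  shows "\<exists>H c. H \<in> carrier_mat n n \<and> mat_adjoint H = H \<and> H * H = 1\<^sub>m n \<and>
    (\<forall>i<n. H $$ (i, 0) = c * v i)"
proof -
  define c where "c = (if v 0 = 0 then 1 else - cnj (v 0) / of_real (cmod (v 0)))"
  define t where "t = - cmod (v 0)"
  have c1: "cmod c = 1" by (auto simp: c_def norm_divide)
  have c0: "c * v 0 = of_real t"
    by (auto simp: c_def t_def complex_norm_square[symmetric] power2_eq_square mult.commute[of "cnj _"])
  define s where "s = t - 1"
  have s: "s \<noteq> 0" using norm_ge_zero[of "v 0"] unfolding s_def t_def by linarith
  define u where "u i = c * v i - (if i = 0 then 1 else 0)" for i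
  have u0: "u 0 = of_real s" by (simp add: u_def c0 s_def)
  have uu: "(\<Sum>k<n. cnj (u k) * u k) = - 2 * of_real s"
  proof -
    have "(\<Sum>k<n. cnj (u k) * u k) = (\<Sum>k<n. of_real ((cmod (v k))\<^sup>2) + (if k = 0 then 1 - 2 * of_real t else 0))"
    proof (rule sum.cong[OF refl])
      fix k
      have a: "cnj (c * v k) * (c * v k) = of_real ((cmod (v k))\<^sup>2)"
        by (metis c1 complex_norm_square mult.commute mult_1 norm_mult)
      show "cnj (u k) * u k = of_real ((cmod (v k))\<^sup>2) + (if k = 0 then 1 - 2 * of_real t else 0)"
      proof (cases "k = 0")
        case True
        then have "cnj (c * v 0) * (c * v 0) = of_real ((cmod (v 0))\<^sup>2)" using a by simp
        then show ?thesis using True by (simp add: u_def c0 algebra_simps)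
      qed (use a in \<open>simp add: u_def\<close>)
    qed
    also have "\<dots> = of_real (\<Sum>i<n. (cmod (v i))\<^sup>2) + (1 - 2 * of_real t)"
      using n by (simp add: sum.distrib)
    finally show ?thesis unfolding v by (simp add: s_def)
  qed
  define H where "H = mat n n (\<lambda>(i, j). (if i = j then 1 else 0) + u i * cnj (u j) / of_real s)"
  have H: "H \<in> carrier_mat n n" by (simp add: H_def)
  have "mat_adjoint H = H" by (rule hermitianI[OF H]) (auto simp: H_def mult.commute)
  moreover have "H * H = 1\<^sub>m n"
  proof (rule eq_matI)
    fix i j assume "i < dim_row (1\<^sub>m n :: complex mat)" "j < dim_col (1\<^sub>m n :: complex mat)"
    then have ij: "i < n" "j < n" by auto
    have "(H * H) $$ (i, j) = (\<Sum>k<n. H $$ (i, k) * H $$ (k, j))"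
      by (rule index_mult_mat_sum[OF H H ij])
    also have "\<dots> = (\<Sum>k<n. (if k = i then (if i = j then 1 else 0) + u i * cnj (u j) / of_real s else 0)
        + (if k = j then u i * cnj (u j) / of_real s else 0)
        + (u i * cnj (u j) / (of_real s)\<^sup>2) * (cnj (u k) * u k))"
      using ij by (intro sum.cong) (auto simp: H_def algebra_simps power2_eq_square)
    also have "\<dots> = (if i = j then 1 else 0) + u i * cnj (u j) / of_real s + u i * cnj (u j) / of_real s
        + (u i * cnj (u j) / (of_real s)\<^sup>2) * (- 2 * of_real s)"
      using ij by (simp only: sum.distrib sum_distrib_left[symmetric] uu) simp
    also have "\<dots> = (if i = j then 1 else 0)"
      using s by (simp add: field_simps power2_eq_square)
    finally show "(H * H) $$ (i, j) = 1\<^sub>m n $$ (i, j)" using ij by simp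
  qed (use H in auto)
  moreover have "H $$ (i, 0) = c * v i" if "i < n" for i
  proof -
    have "H $$ (i, 0) = (if i = 0 then 1 else 0) + u i"
      using that n s by (simp add: H_def u0)
    then show ?thesis by (simp add: u_def)
  qed
  ultimately show ?thesis using H by blast
qed

section \<open>Unitary diagonalization of Hermitian matrices and positive square roots\<close>

lemma mult_carrier_square [simp]:
  "A \<in> carrier_mat n n \<Longrightarrow> B \<in> carrier_mat n n \<Longrightarrow> A * B \<in> carrier_mat n n"
  by (rule mult_carrier_mat)

definition diag_real :: "nat \<Rightarrow> (nat \<Rightarrow> real) \<Rightarrow> complex mat" where
  "diag_real n l = mat n n (\<lambda>(i, j). if i = j then complex_of_real (l i) else 0)"

lemma diag_real_carrier [simp]: "diag_real n l \<in> carrier_mat n n"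
  by (simp add: diag_real_def)

text \<open>Deflation by induction on the dimension. A reflection H whose first column is a
  normalized eigenvector up to a phase turns A into H A H, whose first row and column contain only
  the eigenvalue; the induction hypothesis diagonalizes the remaining block. H is Hermitian and its
  own inverse, so it serves directly as the unitary completion of the eigenvector.\<close>

lemma hermitian_diagonalization:
  fixes A :: "complex mat"
  assumes "A \<in> carrier_mat n n" "mat_adjoint A = A"
  shows "\<exists>U l. U \<in> carrier_mat n n \<and> mat_adjoint U * U = 1\<^sub>m n \<and> U * mat_adjoint U = 1\<^sub>m n \<and>
    A = U * diag_real n l * mat_adjoint U"
  using assms
proof (induction n arbitrary: A)
  case 0
  then show ?case
    by (intro exI[of _ "1\<^sub>m 0"] exI[of _ "\<lambda>_. 0"]) (auto intro!: eq_matI)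
next
  case (Suc n)
  note A = Suc.prems(1) and herm = Suc.prems(2)
  obtain e where "e \<in> spectrum A" using spectrum_non_empty[OF A] by auto
  then obtain v where ev: "eigenvector A v e" unfolding spectrum_def eigenvalue_def by auto
  then have v: "v \<in> carrier_vec (Suc n)" and v0: "v \<noteq> 0\<^sub>v (Suc n)" and Av: "A *\<^sub>v v = e \<cdot>\<^sub>v v"
    using A by (auto simp: eigenvector_def)
  define r where "r = sqrt (\<Sum>i<Suc n. (cmod (v $ i))\<^sup>2)"
  obtain i0 where "i0 < Suc n" "v $ i0 \<noteq> 0" using v v0 by (auto simp: vec_eq_iff)
  then have "(\<Sum>i<Suc n. (cmod (v $ i))\<^sup>2) > 0"
    by (intro sum_pos2[of _ i0]) auto
  then have r: "r > 0" "(\<Sum>i<Suc n. (cmod (v $ i))\<^sup>2) = r\<^sup>2" by (auto simp: r_def)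
  have "(\<Sum>i<Suc n. (cmod (v $ i / of_real r))\<^sup>2) = 1"
    using r by (simp add: norm_divide power_divide sum_divide_distrib[symmetric] del: sum.lessThan_Suc)
  from householder[OF this] obtain H c where H: "H \<in> carrier_mat (Suc n) (Suc n)" "mat_adjoint H = H"
    "H * H = 1\<^sub>m (Suc n)" and Hc: "\<And>i. i < Suc n \<Longrightarrow> H $$ (i, 0) = c * (v $ i / of_real r)" by auto
  define F where "F = H * A * H"
  have F: "F \<in> carrier_mat (Suc n) (Suc n)" using H A by (simp add: F_def)
  have Fherm: "mat_adjoint F = F"
    unfolding F_def using H A herm
    by (simp add: mat_adjoint_mult[of _ "Suc n" "Suc n" _ "Suc n"])
  have colH: "col H 0 = (c / of_real r) \<cdot>\<^sub>v v"
    using H v by (intro eq_vecI) (simp_all add: Hc)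
  have cH: "col H 0 \<in> carrier_vec (Suc n)" using H(1) by (intro carrier_vecI) simp
  have "col F 0 = (H * A) *\<^sub>v col H 0" unfolding F_def using H A by (intro col_mult2) auto
  also have "\<dots> = H *\<^sub>v (A *\<^sub>v col H 0)"
    by (rule assoc_mult_mat_vec[OF H(1) A cH])
  also have "A *\<^sub>v col H 0 = e \<cdot>\<^sub>v col H 0"
    unfolding colH mult_mat_vec[OF A v] Av by (intro eq_vecI) auto
  also have "H *\<^sub>v (e \<cdot>\<^sub>v col H 0) = e \<cdot>\<^sub>v (H *\<^sub>v col H 0)"
    by (rule mult_mat_vec[OF H(1) cH])
  also have "H *\<^sub>v col H 0 = col (H * H) 0" using H by (intro col_mult2[symmetric]) auto
  finally have "col F 0 = e \<cdot>\<^sub>v col (1\<^sub>m (Suc n)) 0" by (simp add: H(3))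
  then have F0: "F $$ (i, 0) = (if i = 0 then e else 0)" if "i < Suc n" for i
    using that F by (auto simp: vec_eq_iff index_col)
  \<comment> \<open>The eigenvalue is real because it now stands on the diagonal of the Hermitian
    matrix \<open>F\<close>.\<close>
  have e_real: "cnj e = e" using hermitian_index[OF F Fherm, of 0 0] F0[of 0] by simp
  have F0': "F $$ (0, i) = (if i = 0 then e else 0)" if "i < Suc n" for i
    using hermitian_index[OF F Fherm, of i 0] F0[OF that] that e_real by (auto split: if_splits)
  define A' where "A' = mat n n (\<lambda>(i, j). F $$ (Suc i, Suc j))"
  have A': "A' \<in> carrier_mat n n" by (simp add: A'_def)
  have "mat_adjoint A' = A'"
    by (rule hermitianI[OF A']) (auto simp: A'_def hermitian_index[OF F Fherm])
  from Suc.IH[OF A' this] obtain U' l' where U': "U' \<in> carrier_mat n n" "mat_adjoint U' * U' = 1\<^sub>m n"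
    "U' * mat_adjoint U' = 1\<^sub>m n" "A' = U' * diag_real n l' * mat_adjoint U'" by auto
  define V where "V = four_block_mat (1\<^sub>m 1) (0\<^sub>m 1 n) (0\<^sub>m n 1) U'"
  define l where "l = case_nat (Re e) l'"
  have V: "V \<in> carrier_mat (Suc n) (Suc n)" using U'(1) by (intro carrier_matI) (auto simp: V_def)
  have Vadj: "mat_adjoint V = four_block_mat (1\<^sub>m 1) (0\<^sub>m 1 n) (0\<^sub>m n 1) (mat_adjoint U')"
    (is "_ = ?R")
  proof (rule eq_matI)
    fix i j assume "i < dim_row ?R" "j < dim_col ?R"
    then have ij: "i < Suc n" "j < Suc n" using U'(1) by auto
    then have "mat_adjoint V $$ (i, j) = cnj (V $$ (j, i))" by (intro mat_adjoint_index[OF V])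
    then show "mat_adjoint V $$ (i, j) = ?R $$ (i, j)"
      using U'(1) ij by (auto simp: mat_adjoint_index[OF U'(1)] V_def)
  qed (use V U'(1) in auto)
  have e: "e = of_real (Re e)" using e_real by (simp add: complex_eq_iff)
  have D: "diag_real (Suc n) l = four_block_mat (mat 1 1 (\<lambda>_. e)) (0\<^sub>m 1 n) (0\<^sub>m n 1) (diag_real n l')"
    by (intro eq_matI) (auto simp: diag_real_def l_def e[symmetric] split: nat.splits)
  have F_block: "F = four_block_mat (mat 1 1 (\<lambda>_. e)) (0\<^sub>m 1 n) (0\<^sub>m n 1) A'"
    using F by (intro eq_matI) (auto simp: A'_def F0 F0')
  have adjU': "mat_adjoint U' \<in> carrier_mat n n" using U' by simp
  have VV: "mat_adjoint V * V = 1\<^sub>m (Suc n)"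
    unfolding Vadj unfolding V_def
    by (subst mult_four_block_mat[of _ 1 1 _ n _ n _ _ 1 _ n]) (use U' in auto)
  have VD: "V * diag_real (Suc n) l = four_block_mat (mat 1 1 (\<lambda>_. e)) (0\<^sub>m 1 n) (0\<^sub>m n 1) (U' * diag_real n l')"
    unfolding V_def D
    by (subst mult_four_block_mat[of _ 1 1 _ n _ n _ _ 1 _ n])
       (use U'(1) in \<open>auto simp: left_mult_zero_mat[of _ n n] right_mult_zero_mat[of _ n n] left_add_zero_mat[of _ n n] right_add_zero_mat[of _ n n]\<close>)
  have FV: "F = V * diag_real (Suc n) l * mat_adjoint V"
    unfolding VD Vadj F_block U'(4)
    by (subst mult_four_block_mat[of _ 1 1 _ n _ n _ _ 1 _ n])
       (use U'(1) in \<open>auto simp: left_mult_zero_mat[of _ n n] right_mult_zero_mat[of _ n n] left_add_zero_mat[of _ n n] right_add_zero_mat[of _ n n]\<close>)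
  define U where "U = H * V"
  have U: "U \<in> carrier_mat (Suc n) (Suc n)" using H V by (simp add: U_def)
  have Uadj: "mat_adjoint U = mat_adjoint V * H" unfolding U_def using mat_adjoint_mult[OF H(1) V] H by simp
  have adjV: "mat_adjoint V \<in> carrier_mat (Suc n) (Suc n)" using V by simp
  have HHX: "H * (H * X) = X" if "X \<in> carrier_mat (Suc n) (Suc n)" for X
    using assoc_mult_mat[OF H(1) H(1) that] that H(3) by simp
  have UU: "mat_adjoint U * U = 1\<^sub>m (Suc n)"
    unfolding Uadj unfolding U_def using H V adjV HHX[OF V] VV by (simp add: assoc_mult_mat[of _ "Suc n" "Suc n" _ "Suc n" _ "Suc n"])
  have "U * mat_adjoint U = 1\<^sub>m (Suc n)"
    by (rule mat_mult_left_right_inverse[OF _ U UU]) (use U in simp)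
  moreover have "A = H * F * H"
    unfolding F_def using H A HHX by (simp add: assoc_mult_mat[of _ "Suc n" "Suc n" _ "Suc n" _ "Suc n"])
  then have "A = U * diag_real (Suc n) l * mat_adjoint U"
    unfolding FV Uadj unfolding U_def using H V adjV by (simp add: assoc_mult_mat[of _ "Suc n" "Suc n" _ "Suc n" _ "Suc n"])
  ultimately show ?case using U UU by blast
qed

lemma index_mult_diag_real:
  assumes V: "V \<in> carrier_mat n n" and ij: "i < n" "j < n"
  shows "(V * diag_real n l) $$ (i, j) = V $$ (i, j) * of_real (l j)"
    "(diag_real n l * V) $$ (i, j) = of_real (l i) * V $$ (i, j)"
proof -
  have "(V * diag_real n l) $$ (i, j) = (\<Sum>k<n. V $$ (i, k) * diag_real n l $$ (k, j))"
    by (rule index_mult_mat_sum[OF V _ ij]) simp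
  also have "\<dots> = (\<Sum>k<n. if k = j then V $$ (i, j) * of_real (l j) else 0)"
    using ij by (intro sum.cong) (auto simp: diag_real_def)
  finally show "(V * diag_real n l) $$ (i, j) = V $$ (i, j) * of_real (l j)" using ij by simp
  have "(diag_real n l * V) $$ (i, j) = (\<Sum>k<n. diag_real n l $$ (i, k) * V $$ (k, j))"
    by (rule index_mult_mat_sum[OF _ V ij]) simp
  also have "\<dots> = (\<Sum>k<n. if k = i then of_real (l i) * V $$ (i, j) else 0)"
    using ij by (intro sum.cong) (auto simp: diag_real_def)
  finally show "(diag_real n l * V) $$ (i, j) = of_real (l i) * V $$ (i, j)" using ij by simp
qed

lemma index_diag_conj:
  assumes U: "U \<in> carrier_mat n n" and ij: "i < n" "j < n"
  shows "(U * diag_real n l * mat_adjoint U) $$ (i, j) =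
    (\<Sum>k<n. of_real (l k) * (U $$ (i, k) * cnj (U $$ (j, k))))"
proof -
  have "(U * diag_real n l * mat_adjoint U) $$ (i, j) = (\<Sum>k<n. (U * diag_real n l) $$ (i, k) * mat_adjoint U $$ (k, j))"
    by (rule index_mult_mat_sum[OF _ _ ij]) (use U in auto)
  also have "\<dots> = (\<Sum>k<n. of_real (l k) * (U $$ (i, k) * cnj (U $$ (j, k))))"
    using ij by (intro sum.cong) (auto simp: index_mult_diag_real[OF U] mat_adjoint_index[OF U])
  finally show ?thesis .
qed

text \<open>In an eigenbasis the form is a weighted sum of squared overlaps, so the signs of the
  eigenvalues decide positivity.\<close>

lemma qform_diag_conj:
  assumes U: "U \<in> carrier_mat n n"
  shows "qform n (U * diag_real n l * mat_adjoint U) u =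
    of_real (\<Sum>k<n. l k * (cmod (\<Sum>i<n. cnj (U $$ (i, k)) * u i))\<^sup>2)"
proof -
  have "qform n (U * diag_real n l * mat_adjoint U) u =
     (\<Sum>i<n. \<Sum>j<n. \<Sum>k<n. of_real (l k) * ((cnj (u i) * U $$ (i, k)) * (cnj (U $$ (j, k)) * u j)))"
    unfolding qform_def
    by (intro sum.cong) (auto simp: index_diag_conj[OF U] sum_distrib_left sum_distrib_right mult_ac simp del: index_mult_mat)
  also have "\<dots> = (\<Sum>k<n. \<Sum>i<n. \<Sum>j<n. of_real (l k) * ((cnj (u i) * U $$ (i, k)) * (cnj (U $$ (j, k)) * u j)))"
    by (rule trans[OF sum.cong[OF refl sum.swap] sum.swap])
  also have "\<dots> = (\<Sum>k<n. of_real (l k) * (cnj (\<Sum>i<n. cnj (U $$ (i, k)) * u i) * (\<Sum>i<n. cnj (U $$ (i, k)) * u i)))"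
    by (auto simp: sum_distrib_left sum_distrib_right mult_ac intro!: sum.cong)
  also have "\<dots> = of_real (\<Sum>k<n. l k * (cmod (\<Sum>i<n. cnj (U $$ (i, k)) * u i))\<^sup>2)"
    by (simp only: of_real_sum of_real_mult complex_norm_square mult.commute[of "cnj _"])
  finally show ?thesis .
qed

lemma unitary_columns:
  fixes U :: "complex mat"
  assumes U: "U \<in> carrier_mat n n" "mat_adjoint U * U = 1\<^sub>m n" and mk: "m < n" "k < n"
  shows "(\<Sum>i<n. cnj (U $$ (i, m)) * U $$ (i, k)) = (if m = k then 1 else 0)"
proof -
  have "(mat_adjoint U * U) $$ (m, k) = (\<Sum>i<n. mat_adjoint U $$ (m, i) * U $$ (i, k))"
    by (rule index_mult_mat_sum[OF _ U(1) mk]) (use U in simp)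
  also have "\<dots> = (\<Sum>i<n. cnj (U $$ (i, m)) * U $$ (i, k))"
    by (intro sum.cong) (auto simp: mat_adjoint_index[OF U(1) mk(1)])
  finally show ?thesis using mk by (simp add: U(2))
qed

lemma qform_eigenvector:
  assumes U: "U \<in> carrier_mat n n" "mat_adjoint U * U = 1\<^sub>m n" and k: "k < n"
  shows "qform n (U * diag_real n l * mat_adjoint U) (\<lambda>i. U $$ (i, k)) = of_real (l k)"
proof -
  have "qform n (U * diag_real n l * mat_adjoint U) (\<lambda>i. U $$ (i, k)) =
      of_real (\<Sum>m<n. l m * (cmod (if m = k then 1 else 0))\<^sup>2)"
    unfolding qform_diag_conj[OF U(1)] by (simp add: unitary_columns[OF U _ k] cong: sum.cong_simp)
  also have "(\<Sum>m<n. l m * (cmod (if m = k then 1 else 0))\<^sup>2) = (\<Sum>m<n. if m = k then l k else 0)"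
    by (intro sum.cong) auto
  finally show ?thesis using k by simp
qed

lemma psd_diagonalization:
  assumes "A \<in> carrier_mat n n" "psd A"
  obtains U l where "U \<in> carrier_mat n n" "mat_adjoint U * U = 1\<^sub>m n" "U * mat_adjoint U = 1\<^sub>m n"
    "A = U * diag_real n l * mat_adjoint U" "\<And>k. k < n \<Longrightarrow> 0 \<le> l k"
proof -
  have "mat_adjoint A = A" using assms by (simp add: psd_def)
  with hermitian_diagonalization[OF assms(1)] obtain U l where U: "U \<in> carrier_mat n n"
    "mat_adjoint U * U = 1\<^sub>m n" "U * mat_adjoint U = 1\<^sub>m n" "A = U * diag_real n l * mat_adjoint U" by blast
  have "0 \<le> l k" if k: "k < n" for k
    using psd_qform_nonneg[OF assms, of "\<lambda>i. U $$ (i, k)"] qform_eigenvector[OF U(1,2) k, of l]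
    unfolding U(4)[symmetric] by (simp add: less_eq_complex_def)
  then show ?thesis using that U by blast
qed

lemma diag_real_mult: "diag_real n l * diag_real n m = diag_real n (\<lambda>k. l k * m k)"
proof (rule eq_matI)
  fix i j assume "i < dim_row (diag_real n (\<lambda>k. l k * m k))" "j < dim_col (diag_real n (\<lambda>k. l k * m k))"
  then have ij: "i < n" "j < n" by (auto simp: diag_real_def)
  have "(diag_real n l * diag_real n m) $$ (i, j) = (\<Sum>k<n. diag_real n l $$ (i, k) * diag_real n m $$ (k, j))"
    by (rule index_mult_mat_sum[OF _ _ ij]) auto
  also have "\<dots> = (\<Sum>k<n. if k = i then diag_real n (\<lambda>k. l k * m k) $$ (i, j) else 0)"
    using ij by (intro sum.cong) (auto simp: diag_real_def)
  finally show "(diag_real n l * diag_real n m) $$ (i, j) = diag_real n (\<lambda>k. l k * m k) $$ (i, j)"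
    using ij by simp
qed (auto simp: diag_real_def)

lemma diag_conj_square:
  assumes U: "U \<in> carrier_mat n n" "mat_adjoint U * U = 1\<^sub>m n"
  shows "(U * diag_real n l * mat_adjoint U) * (U * diag_real n l * mat_adjoint U) =
    U * diag_real n (\<lambda>k. l k * l k) * mat_adjoint U"
proof -
  have U': "mat_adjoint U \<in> carrier_mat n n" using U by simp
  note assoc = assoc_mult_mat[of _ n n _ n _ n]
  have "(U * diag_real n l * mat_adjoint U) * (U * diag_real n l * mat_adjoint U)
     = U * diag_real n l * ((mat_adjoint U * U) * (diag_real n l * mat_adjoint U))"
    using U(1) U' by (simp add: assoc)
  also have "\<dots> = U * (diag_real n l * diag_real n l) * mat_adjoint U"
    using U(1) U' by (simp add: assoc U(2) left_mult_one_mat[of _ n n])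
  finally show ?thesis by (simp add: diag_real_mult)
qed

text \<open>\<open>trace_norm\<close> selects the square root by a definite description, which calls
  for uniqueness. The change of basis V between the two eigenbases intertwines the squared
  diagonals, so a nonzero entry of V at (i, j) forces equal squares of b_i and c_j, hence b_i = c_j
  by nonnegativity; then V intertwines the diagonals themselves.\<close>

lemma psd_square_root_unique:
  assumes B: "B \<in> carrier_mat n n" "psd B" and C: "C \<in> carrier_mat n n" "psd C"
    and eq: "B * B = C * C"
  shows "B = C"
proof -
  obtain U b where U: "U \<in> carrier_mat n n" "mat_adjoint U * U = 1\<^sub>m n" "U * mat_adjoint U = 1\<^sub>m n"
    "B = U * diag_real n b * mat_adjoint U" "\<And>k. k < n \<Longrightarrow> 0 \<le> b k" using psd_diagonalization[OF B] by metis
  obtain W c where W: "W \<in> carrier_mat n n" "mat_adjoint W * W = 1\<^sub>m n" "W * mat_adjoint W = 1\<^sub>m n"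
    "C = W * diag_real n c * mat_adjoint W" "\<And>k. k < n \<Longrightarrow> 0 \<le> c k" using psd_diagonalization[OF C] by metis
  have U': "mat_adjoint U \<in> carrier_mat n n" and W': "mat_adjoint W \<in> carrier_mat n n" using U W by auto
  note assoc = assoc_mult_mat[of _ n n _ n _ n]
  have Ul: "mat_adjoint U * (U * X) = X" "U * (mat_adjoint U * X) = X" if "X \<in> carrier_mat n n" for X
    using assoc_mult_mat[OF U' U(1) that] assoc_mult_mat[OF U(1) U' that] U that by auto
  have Wl: "W * (mat_adjoint W * X) = X" "mat_adjoint W * (W * X) = X" if "X \<in> carrier_mat n n" for X
    using assoc_mult_mat[OF W(1) W' that] assoc_mult_mat[OF W' W(1) that] W that by auto
  define V where "V = mat_adjoint U * W"
  have V: "V \<in> carrier_mat n n" using U' W by (simp add: V_def)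
  let ?D = "diag_real n"
  have "U * ?D (\<lambda>k. b k * b k) * mat_adjoint U = W * ?D (\<lambda>k. c k * c k) * mat_adjoint W"
    using eq unfolding U(4) W(4) diag_conj_square[OF U(1,2)] diag_conj_square[OF W(1,2)] .
  then have "mat_adjoint U * (U * ?D (\<lambda>k. b k * b k) * mat_adjoint U) * W = mat_adjoint U * (W * ?D (\<lambda>k. c k * c k) * mat_adjoint W) * W"
    by simp
  then have DV: "?D (\<lambda>k. b k * b k) * V = V * ?D (\<lambda>k. c k * c k)"
    unfolding V_def using U(1) U' W(1) W' by (simp add: assoc Ul Wl W(2) right_mult_one_mat[of _ n n])
  have "?D b * V = V * ?D c"
  proof (rule eq_matI)
    fix i j assume "i < dim_row (V * ?D c)" "j < dim_col (V * ?D c)"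
    then have ij: "i < n" "j < n" using V by (auto simp: diag_real_def)
    have "of_real (b i * b i) * V $$ (i, j) = V $$ (i, j) * of_real (c j * c j)"
      using arg_cong[OF DV, of "\<lambda>X. X $$ (i, j)"] unfolding index_mult_diag_real[OF V ij] .
    then have "V $$ (i, j) = 0 \<or> b i * b i = c j * c j"
      by (auto simp: mult.commute[of "V $$ (i, j)"] simp flip: of_real_mult)
    then have "V $$ (i, j) = 0 \<or> b i = c j"
      using U(5)[OF ij(1)] W(5)[OF ij(2)] by (auto simp: power2_eq_square[symmetric] power2_eq_iff_nonneg)
    then show "(?D b * V) $$ (i, j) = (V * ?D c) $$ (i, j)"
      unfolding index_mult_diag_real[OF V ij] by auto
  qed (use V in \<open>auto simp: diag_real_def\<close>)
  then have "U * (?D b * V) * mat_adjoint W = U * (V * ?D c) * mat_adjoint W" by simp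
  then show "B = C"
    unfolding V_def U(4) W(4) using U(1) U' W(1) W' by (simp add: assoc Ul Wl W(3) right_mult_one_mat[of _ n n])
qed

lemma mtrace_diag_conj:
  assumes U: "U \<in> carrier_mat n n" "mat_adjoint U * U = 1\<^sub>m n"
  shows "mtrace (U * diag_real n l * mat_adjoint U) = of_real (\<Sum>k<n. l k)"
proof -
  have orth: "(\<Sum>i<n. U $$ (i, k) * cnj (U $$ (i, k))) = 1" if k: "k < n" for k
    using unitary_columns[OF U k k] by (simp add: mult.commute)
  have "mtrace (U * diag_real n l * mat_adjoint U) = (\<Sum>i<n. \<Sum>k<n. of_real (l k) * (U $$ (i, k) * cnj (U $$ (i, k))))"
    unfolding mtrace_def using U(1) by (auto simp: index_diag_conj[OF U(1)] simp del: index_mult_mat(1) intro!: sum.cong)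
  also have "\<dots> = (\<Sum>k<n. of_real (l k) * (\<Sum>i<n. U $$ (i, k) * cnj (U $$ (i, k))))"
    by (subst sum.swap) (simp add: sum_distrib_left)
  finally show ?thesis by (simp add: orth)
qed

text \<open>The columns of a unitary matrix form an orthonormal basis, and the trace may be
  evaluated in any such basis.\<close>

lemma qform_sum_columns:
  assumes U: "U \<in> carrier_mat n n" "U * mat_adjoint U = 1\<^sub>m n" and P: "P \<in> carrier_mat n n"
  shows "(\<Sum>k<n. qform n P (\<lambda>i. U $$ (i, k))) = mtrace P"
proof -
  have orth: "(\<Sum>k<n. U $$ (j, k) * cnj (U $$ (i, k))) = (if j = i then 1 else 0)" if "i < n" "j < n" for i j
  proof -
    have "(U * mat_adjoint U) $$ (j, i) = (\<Sum>k<n. U $$ (j, k) * mat_adjoint U $$ (k, i))"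
      by (rule index_mult_mat_sum[OF U(1) _ that(2,1)]) (use U in simp)
    also have "\<dots> = (\<Sum>k<n. U $$ (j, k) * cnj (U $$ (i, k)))"
      using that by (intro sum.cong) (auto simp: mat_adjoint_index[OF U(1)])
    finally show ?thesis using that by (simp add: U(2))
  qed
  have "(\<Sum>k<n. qform n P (\<lambda>i. U $$ (i, k))) = (\<Sum>i<n. \<Sum>j<n. \<Sum>k<n. P $$ (i, j) * (U $$ (j, k) * cnj (U $$ (i, k))))"
    (is "_ = ?R")
  proof -
    have "(\<Sum>k<n. qform n P (\<lambda>i. U $$ (i, k))) =
        (\<Sum>k<n. \<Sum>i<n. \<Sum>j<n. P $$ (i, j) * (U $$ (j, k) * cnj (U $$ (i, k))))"
      by (simp add: qform_def mult_ac)
    also have "\<dots> = ?R" by (rule trans[OF sum.swap sum.cong[OF refl sum.swap]])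
    finally show ?thesis .
  qed
  also have "\<dots> = (\<Sum>i<n. \<Sum>j<n. P $$ (i, j) * (if j = i then 1 else 0))"
    by (intro sum.cong refl) (auto simp: orth sum_distrib_left[symmetric])
  also have "\<dots> = (\<Sum>i<n. \<Sum>j<n. if j = i then P $$ (i, i) else 0)"
    by (intro sum.cong refl) auto
  also have "\<dots> = mtrace P" using P by (simp add: mtrace_def)
  finally show ?thesis .
qed

lemma qform_add:
  assumes "A \<in> carrier_mat N N" "B \<in> carrier_mat N N"
  shows "qform N (A + B) v = qform N A v + qform N B v"
  unfolding qform_def sum.distrib[symmetric]
  by (intro sum.cong refl) (use assms in \<open>auto simp: algebra_simps\<close>)

lemma qform_smult:
  assumes "A \<in> carrier_mat N N"
  shows "qform N (c \<cdot>\<^sub>m A) v = c * qform N A v"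
  unfolding qform_def sum_distrib_left
  by (intro sum.cong refl) (use assms in auto)

lemma qform_minus:
  assumes "P \<in> carrier_mat n n" "N \<in> carrier_mat n n"
  shows "qform n (P - N) u = qform n P u - qform n N u"
  unfolding qform_def sum_subtractf[symmetric]
  by (intro sum.cong) (use assms in \<open>auto simp: algebra_simps\<close>)

text \<open>In an eigenbasis of P - N each eigenvalue is the difference of the nonnegative numbers
  <u_k, P u_k> and <u_k, N u_k>, so its absolute value is at most their sum; summing over k gives
  the two traces. The matrix \<open>B\<close> with the absolute eigenvalues is the square root that
  \<open>trace_norm\<close> selects.\<close>

lemma trace_norm_diff_psd_le:
  assumes P: "P \<in> carrier_mat n n" "psd P" and N: "N \<in> carrier_mat n n" "psd N"
  shows "trace_norm (P - N) \<le> Re (mtrace P) + Re (mtrace N)"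
proof -
  have A: "P - N \<in> carrier_mat n n" using P N by auto
  have hP: "mat_adjoint P = P" and hN: "mat_adjoint N = N" using P N by (auto simp: psd_def)
  have hA: "mat_adjoint (P - N) = P - N"
    by (rule hermitianI[OF A]) (use P N in \<open>auto simp: hermitian_index[OF P(1) hP] hermitian_index[OF N(1) hN]\<close>)
  obtain U l where U: "U \<in> carrier_mat n n" "mat_adjoint U * U = 1\<^sub>m n" "U * mat_adjoint U = 1\<^sub>m n"
    "P - N = U * diag_real n l * mat_adjoint U" using hermitian_diagonalization[OF A hA] by blast
  define B where "B = U * diag_real n (\<lambda>k. \<bar>l k\<bar>) * mat_adjoint U"
  have B: "B \<in> carrier_mat n n" using U by (simp add: B_def)
  have psdB: "psd B"
  proof (rule psdI_qform[OF B])
    fix u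
    have "0 \<le> (\<Sum>k<n. \<bar>l k\<bar> * (cmod (\<Sum>i<n. cnj (U $$ (i, k)) * u i))\<^sup>2)"
      by (intro sum_nonneg) simp
    then show "0 \<le> qform n B u"
      unfolding B_def qform_diag_conj[OF U(1)] less_eq_complex_def Re_complex_of_real Im_complex_of_real by simp
  qed
  have BB: "B * B = mat_adjoint (P - N) * (P - N)"
    unfolding hA unfolding U(4) B_def diag_conj_square[OF U(1,2)] by simp
  have "(THE B. B \<in> carrier_mat (dim_col (P - N)) (dim_col (P - N)) \<and> psd B \<and> B * B = mat_adjoint (P - N) * (P - N)) = B"
  proof (rule the_equality)
    show "B \<in> carrier_mat (dim_col (P - N)) (dim_col (P - N)) \<and> psd B \<and> B * B = mat_adjoint (P - N) * (P - N)"
      using A B psdB BB N by simp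
    fix C assume "C \<in> carrier_mat (dim_col (P - N)) (dim_col (P - N)) \<and> psd C \<and> C * C = mat_adjoint (P - N) * (P - N)"
    then show "C = B" using A B psdB BB N psd_square_root_unique[of C n B] by auto
  qed
  then have "trace_norm (P - N) = Re (mtrace B)" by (simp add: trace_norm_def)
  also have "\<dots> = (\<Sum>k<n. \<bar>l k\<bar>)" by (simp add: B_def mtrace_diag_conj[OF U(1,2)])
  also have "\<dots> \<le> (\<Sum>k<n. Re (qform n P (\<lambda>i. U $$ (i, k))) + Re (qform n N (\<lambda>i. U $$ (i, k))))"
  proof (rule sum_mono)
    fix k assume "k \<in> {..<n}"
    then have k: "k < n" by simp
    have "l k = Re (qform n P (\<lambda>i. U $$ (i, k))) - Re (qform n N (\<lambda>i. U $$ (i, k)))"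
      using qform_eigenvector[OF U(1,2) k, of l] unfolding U(4)[symmetric] qform_minus[OF P(1) N(1)]
      by (simp add: complex_eq_iff)
    then show "\<bar>l k\<bar> \<le> Re (qform n P (\<lambda>i. U $$ (i, k))) + Re (qform n N (\<lambda>i. U $$ (i, k)))"
      using psd_qform_nonneg[OF P, of "\<lambda>i. U $$ (i, k)"] psd_qform_nonneg[OF N, of "\<lambda>i. U $$ (i, k)"]
      by (auto simp: less_eq_complex_def abs_le_iff)
  qed
  also have "\<dots> = Re (mtrace P) + Re (mtrace N)"
    unfolding sum.distrib Re_sum[symmetric] qform_sum_columns[OF U(1,3) P(1)] qform_sum_columns[OF U(1,3) N(1)] ..
  finally show ?thesis .
qed

section \<open>Moments of the invariant measure\<close>

lemma nn_integral_lborel_translate: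
  fixes f :: "'a::euclidean_space \<Rightarrow> ennreal"
  assumes "f \<in> borel_measurable borel"
  shows "(\<integral>\<^sup>+x. f (x + c) \<partial>lborel) = (\<integral>\<^sup>+x. f x \<partial>lborel)"
proof -
  have "(\<integral>\<^sup>+x. f x \<partial>lborel) = (\<integral>\<^sup>+x. f x \<partial>distr lborel borel ((+) c))"
    by (simp add: lborel_distr_plus)
  also have "\<dots> = (\<integral>\<^sup>+x. f (c + x) \<partial>lborel)"
    using assms by (subst nn_integral_distr) auto
  finally show ?thesis by (simp add: add.commute)
qed

lemma nn_integral_lborel_scaleR:
  fixes f :: "'a::euclidean_space \<Rightarrow> ennreal"
  assumes [measurable]: "f \<in> borel_measurable borel" and "c \<noteq> 0"
  shows "(\<integral>\<^sup>+x. f x \<partial>lborel) = ennreal (\<bar>c\<bar> ^ DIM('a)) * (\<integral>\<^sup>+x. f (c *\<^sub>R x) \<partial>lborel)"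
  by (subst lborel_affine[OF assms(2), of 0], subst nn_integral_density)
     (auto simp: nn_integral_distr nn_integral_cmult)

text \<open>Uniqueness of Haar measure in the special case at hand: for a nonnegative \<^term>\<open>f\<close> and the indicator
  \<^term>\<open>g\<close> of the unit ball, evaluate the double integral of \<open>f (x + u y) g (u y)\<close> in both orders.\<close>

lemma nn_integral_lborel_rotate:
  fixes f :: "complex \<Rightarrow> ennreal" and u :: complex
  assumes [measurable]: "f \<in> borel_measurable borel" and u: "cmod u = 1"
  shows "(\<integral>\<^sup>+z. f (u * z) \<partial>lborel) = (\<integral>\<^sup>+z. f z \<partial>lborel)"
proof -
  define g :: "complex \<Rightarrow> ennreal" where "g = indicator (cball 0 1)"
  have [measurable]: "g \<in> borel_measurable borel" unfolding g_def by (intro borel_measurable_indicator) auto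
  have gu: "g (u * y) = g y" for y by (simp add: g_def indicator_def norm_mult u)
  have u0: "u \<noteq> 0" using u by auto
  have pi: "(\<integral>\<^sup>+z. g z \<partial>lborel) = ennreal pi"
    unfolding g_def by (subst nn_integral_indicator) (auto simp: emeasure_cball unit_ball_vol_2)
  have refl: "(\<integral>\<^sup>+x. g (y - x) \<partial>lborel) = ennreal pi" for y
  proof -
    have "(\<integral>\<^sup>+x. g (y - x) \<partial>lborel) = (\<integral>\<^sup>+x. g (y + x) \<partial>lborel)"
      by (subst nn_integral_lborel_scaleR[where c = "-1"]) auto
    also have "\<dots> = ennreal pi" using nn_integral_lborel_translate[of g y] by (simp add: pi add.commute)
    finally show ?thesis .
  qed
  have "ennreal pi * (\<integral>\<^sup>+x. f x \<partial>lborel) = (\<integral>\<^sup>+y. g y * (\<integral>\<^sup>+x. f x \<partial>lborel) \<partial>lborel)"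
    by (simp add: nn_integral_multc pi)
  also have "\<dots> = (\<integral>\<^sup>+y. \<integral>\<^sup>+x. f (x + u * y) * g (u * y) \<partial>lborel \<partial>lborel)"
    by (intro nn_integral_cong)
       (simp add: gu, subst nn_integral_multc, auto simp: nn_integral_lborel_translate mult.commute)
  also have "\<dots> = (\<integral>\<^sup>+x. \<integral>\<^sup>+y. f (x + u * y) * g (u * y) \<partial>lborel \<partial>lborel)"
    by (rule lborel_pair.Fubini') measurable
  also have "\<dots> = (\<integral>\<^sup>+x. \<integral>\<^sup>+y. f (u * y) * g (u * y - x) \<partial>lborel \<partial>lborel)"
  proof (rule nn_integral_cong)
    fix x
    have "(\<integral>\<^sup>+y. f (x + u * y) * g (u * y) \<partial>lborel) = (\<integral>\<^sup>+y. f (u * (y + x / u)) * g (u * (y + x / u) - x) \<partial>lborel)"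
      using u0 by (intro nn_integral_cong) (simp add: algebra_simps)
    also have "\<dots> = (\<integral>\<^sup>+y. f (u * y) * g (u * y - x) \<partial>lborel)"
      by (rule nn_integral_lborel_translate) measurable
    finally show "(\<integral>\<^sup>+y. f (x + u * y) * g (u * y) \<partial>lborel) = (\<integral>\<^sup>+y. f (u * y) * g (u * y - x) \<partial>lborel)" .
  qed
  also have "\<dots> = (\<integral>\<^sup>+y. \<integral>\<^sup>+x. f (u * y) * g (u * y - x) \<partial>lborel \<partial>lborel)"
    by (rule lborel_pair.Fubini') measurable
  also have "\<dots> = (\<integral>\<^sup>+y. f (u * y) * ennreal pi \<partial>lborel)"
    by (intro nn_integral_cong) (simp add: nn_integral_cmult refl)
  also have "\<dots> = ennreal pi * (\<integral>\<^sup>+y. f (u * y) \<partial>lborel)"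
    by (subst nn_integral_multc) (auto simp: mult.commute)
  finally show ?thesis by (simp add: ennreal_mult_cancel_left pi_gt_zero)
qed

text \<open>Half-lines are stable under intersection, generate the Borel sets and exhaust the line
  by sets of finite mass. Distribution functions therefore determine even measures of infinite total
  mass, such as images of Lebesgue measure under the squared norm.\<close>

lemma real_measure_eqI_atMost:
  fixes M N :: "real measure"
  assumes sets: "sets M = sets borel" "sets N = sets borel"
    and eq: "\<And>x. emeasure M {..x} = emeasure N {..x}" and fin: "\<And>x. emeasure M {..x} < \<infinity>"
  shows "M = N"
proof (rule measure_eqI_generator_eq)
  show "Int_stable (range (\<lambda>a::real. {..a}))" by (auto simp: Int_stable_def)
  show "sets M = sigma_sets UNIV (range (\<lambda>a::real. {..a}))" "sets N = sigma_sets UNIV (range (\<lambda>a::real. {..a}))"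
    unfolding sets borel_eq_atMost by auto
  show "range (\<lambda>n::nat. {..real n}) \<subseteq> range (\<lambda>a::real. {..a})" by auto
  show "(\<Union>n::nat. {..real n}) = UNIV" by (auto intro: real_arch_simple)
qed (use eq fin in \<open>auto simp: less_top[symmetric]\<close>)

text \<open>A disc of squared radius s has area pi s, so the image of Lebesgue measure under the
  squared modulus is pi times Lebesgue measure on the half-line. Gaussian moments on the plane
  become Gamma integrals.\<close>

lemma nn_integral_cmod_square:
  assumes [measurable]: "G \<in> borel_measurable borel"
  shows "(\<integral>\<^sup>+z. G ((cmod z)\<^sup>2) \<partial>lborel) = ennreal pi * (\<integral>\<^sup>+s. G s * indicator {0..} s \<partial>lborel)"
proof -
  have "distr lborel borel (\<lambda>z. (cmod z)\<^sup>2) = density lborel (\<lambda>s. ennreal pi * indicator {0..} s)"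
    (is "?A = ?B")
  proof (rule real_measure_eqI_atMost)
    fix s :: real
    have a: "emeasure ?A {..s} = ennreal (pi * max 0 s)"
    proof (cases "0 \<le> s")
      case True
      have "emeasure ?A {..s} = emeasure lborel (cball (0::complex) (sqrt s))"
        using True by (subst emeasure_distr) (auto intro!: arg_cong[of _ _ "emeasure lborel"] simp: real_le_rsqrt sqrt_ge_absD real_sqrt_ge_abs1 abs_le_square_iff dest: sqrt_ge_absD)
      then show ?thesis using True by (simp add: emeasure_cball unit_ball_vol_2)
    next
      case False
      then have "(\<lambda>z::complex. (cmod z)\<^sup>2) -` {..s} = {}" by (auto simp: not_le) (meson not_less order_less_le_trans zero_le_power2)
      then show ?thesis using False by (subst emeasure_distr) auto
    qed
    have "emeasure ?B {..s} = (\<integral>\<^sup>+x. ennreal pi * indicator {0..s} x \<partial>lborel)"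
      by (subst emeasure_density) (auto intro!: nn_integral_cong simp: indicator_def)
    also have "\<dots> = ennreal (pi * max 0 s)"
      by (cases "0 \<le> s") (auto simp: nn_integral_cmult ennreal_mult)
    finally show "emeasure ?A {..s} = emeasure ?B {..s}" using a by simp
    show "emeasure ?A {..s} < \<infinity>" unfolding a by simp
  qed auto
  then have "(\<integral>\<^sup>+s. G s \<partial>?A) = (\<integral>\<^sup>+s. G s \<partial>?B)" by simp
  then show ?thesis
    by (simp add: nn_integral_distr nn_integral_density nn_integral_cmult[symmetric] mult_ac)
qed

lemma gaussian_moment_complex:
  "(\<integral>\<^sup>+z. ennreal (exp (- (cmod z)\<^sup>2) * ((cmod z)\<^sup>2) ^ a) \<partial>lborel) = ennreal (pi * fact a)"
proof -
  have "(\<integral>\<^sup>+z. ennreal (exp (- (cmod z)\<^sup>2) * ((cmod z)\<^sup>2) ^ a) \<partial>lborel) =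
      ennreal pi * (\<integral>\<^sup>+s. ennreal (exp (- s) * s ^ a) * indicator {0..} s \<partial>lborel)"
    by (rule nn_integral_cmod_square) measurable
  also have "\<dots> = ennreal (pi * fact a)"
    using nn_intergal_power_times_exp_Ici[of a] by (simp add: mult.commute ennreal_mult)
  finally show ?thesis .
qed

section \<open>Lebesgue measure on C^d: dilations, phases and the unit ball\<close>

lemma sets_lebesgue_Cd [measurable_cong]: "sets (lebesgue_Cd d) = sets (PiM {..<d} (\<lambda>_. borel))"
  unfolding lebesgue_Cd_def by (intro sets_PiM_cong) auto

lemma space_lebesgue_Cd: "space (lebesgue_Cd d) = PiE {..<d} (\<lambda>_. UNIV)"
  by (simp add: lebesgue_Cd_def space_PiM)

interpretation lborel_product: product_sigma_finite "\<lambda>_::nat. lborel :: complex measure" ..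

lemma borel_measurable_cnorm [measurable]: "cnorm d \<in> borel_measurable (PiM {..<d} (\<lambda>_. borel))"
  unfolding cnorm_def by measurable

lemma measurable_normalize_Cd [measurable]:
  "normalize_Cd d \<in> measurable (PiM {..<d} (\<lambda>_. borel)) (PiM {..<d} (\<lambda>_. borel))"
  unfolding normalize_Cd_def by measurable

lemma unit_ball_Cd_sets [measurable]: "unit_ball_Cd d \<in> sets (PiM {..<d} (\<lambda>_. borel))"
  unfolding unit_ball_Cd_def sets_lebesgue_Cd[symmetric] by measurable

lemma measurable_componentwise:
  assumes "\<And>i. i < d \<Longrightarrow> T i \<in> borel_measurable borel"
  shows "(\<lambda>x. \<lambda>i\<in>{..<d}. T i (x i)) \<in> measurable (PiM {..<d} (\<lambda>_. borel)) (PiM {..<d} (\<lambda>_. borel))"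
proof (rule measurable_restrict)
  fix i assume i: "i \<in> {..<d}"
  show "(\<lambda>x. T i (x i)) \<in> measurable (PiM {..<d} (\<lambda>_. borel)) borel"
    by (rule measurable_compose[of "\<lambda>x. x i" _ borel]) (use i assms in auto)
qed

text \<open>\<open>\<kappa> i\<close> plays the role of the Jacobian of \<open>T i\<close>, and
  rectangles determine the product measure. The same statement covers phases (factor 1) and
  dilations (factor c^2 for each complex coordinate).\<close>

lemma lebesgue_Cd_transform:
  assumes T [measurable]: "\<And>i. i < d \<Longrightarrow> T i \<in> borel_measurable borel"
    and \<kappa>: "\<And>i A. i < d \<Longrightarrow> A \<in> sets borel \<Longrightarrow> emeasure lborel A = \<kappa> i * emeasure lborel (T i -` A)"
  shows "lebesgue_Cd d = scale_measure (\<Prod>i<d. \<kappa> i)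
    (distr (lebesgue_Cd d) (lebesgue_Cd d) (\<lambda>x. \<lambda>i\<in>{..<d}. T i (x i)))" (is "_ = ?P")
proof -
  note [measurable] = measurable_componentwise[OF T]
  have "?P = PiM {..<d} (\<lambda>_. lborel)"
  proof (rule lborel_product.PiM_eqI)
    fix A :: "nat \<Rightarrow> complex set" assume A: "\<And>i. i \<in> {..<d} \<Longrightarrow> A i \<in> sets lborel"
    have TA: "T i -` A i \<in> sets borel" if "i < d" for i
      using measurable_sets[OF T[OF that], of "A i"] A that by auto
    have "emeasure ?P (PiE {..<d} A) = (\<Prod>i<d. \<kappa> i) *
       emeasure (lebesgue_Cd d) ((\<lambda>x. \<lambda>i\<in>{..<d}. T i (x i)) -` PiE {..<d} A \<inter> space (lebesgue_Cd d))"
      unfolding emeasure_scale_measure using A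
      by (subst emeasure_distr) (auto simp: sets_lebesgue_Cd intro!: sets_PiM_I_finite)
    also have "(\<lambda>x. \<lambda>i\<in>{..<d}. T i (x i)) -` PiE {..<d} A \<inter> space (lebesgue_Cd d) = PiE {..<d} (\<lambda>i. T i -` A i)"
      unfolding space_lebesgue_Cd by (auto simp: PiE_iff extensional_def)
    also have "emeasure (lebesgue_Cd d) \<dots> = (\<Prod>i<d. emeasure lborel (T i -` A i))"
      unfolding lebesgue_Cd_def using TA by (subst lborel_product.emeasure_PiM) auto
    also have "(\<Prod>i<d. \<kappa> i) * \<dots> = (\<Prod>i<d. emeasure lborel (A i))"
      using A \<kappa> unfolding prod.distrib[symmetric] by (intro prod.cong) auto
    finally show "emeasure ?P (PiE {..<d} A) = (\<Prod>i<d. emeasure lborel (A i))" .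
  qed (simp_all add: lebesgue_Cd_def)
  then show ?thesis by (simp add: lebesgue_Cd_def)
qed

lemma nn_integral_lebesgue_Cd_transform:
  assumes T [measurable]: "\<And>i. i < d \<Longrightarrow> T i \<in> borel_measurable borel"
    and \<kappa>: "\<And>i A. i < d \<Longrightarrow> A \<in> sets borel \<Longrightarrow> emeasure lborel A = \<kappa> i * emeasure lborel (T i -` A)"
    and f [measurable]: "f \<in> borel_measurable (PiM {..<d} (\<lambda>_. borel))"
  shows "(\<integral>\<^sup>+x. f x \<partial>lebesgue_Cd d) = (\<Prod>i<d. \<kappa> i) * (\<integral>\<^sup>+x. f (\<lambda>i\<in>{..<d}. T i (x i)) \<partial>lebesgue_Cd d)"
proof -
  note [measurable] = measurable_componentwise[OF T]
  let ?T = "\<lambda>x. \<lambda>i\<in>{..<d}. T i (x i)" and ?L = "lebesgue_Cd d"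
  have "(\<integral>\<^sup>+x. f x \<partial>?L) = (\<integral>\<^sup>+x. f x \<partial>scale_measure (\<Prod>i<d. \<kappa> i) (distr ?L ?L ?T))"
    by (rule arg_cong[where f = "\<lambda>M. nn_integral M f", OF lebesgue_Cd_transform[OF T \<kappa>]])
  also have "\<dots> = (\<Prod>i<d. \<kappa> i) * (\<integral>\<^sup>+x. f x \<partial>distr ?L ?L ?T)"
    by (rule nn_integral_scale_measure) measurable
  also have "(\<integral>\<^sup>+x. f x \<partial>distr ?L ?L ?T) = (\<integral>\<^sup>+x. f (?T x) \<partial>?L)"
    by (rule nn_integral_distr) measurable
  finally show ?thesis .
qed

lemma emeasure_lborel_rotate:
  assumes [measurable]: "A \<in> sets borel" and "cmod u = 1"
  shows "emeasure lborel A = emeasure lborel ((\<lambda>z. u * z) -` A)"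
proof -
  have [measurable]: "(\<lambda>z. u * z) -` A \<in> sets borel"
    using measurable_sets[of "\<lambda>z. u * z" borel borel A] assms by simp
  have "emeasure lborel ((\<lambda>z. u * z) -` A) = (\<integral>\<^sup>+z. indicator ((\<lambda>z. u * z) -` A) z \<partial>lborel)"
    by (rule nn_integral_indicator[symmetric]) measurable
  also have "\<dots> = (\<integral>\<^sup>+z. indicator A (u * z) \<partial>lborel)"
    by (intro nn_integral_cong) (simp add: indicator_def)
  also have "\<dots> = (\<integral>\<^sup>+z. indicator A z \<partial>lborel)" by (rule nn_integral_lborel_rotate) (use assms in auto)
  finally show ?thesis by simp
qed

lemma emeasure_lborel_scale:
  fixes A :: "complex set"
  assumes [measurable]: "A \<in> sets borel" and c: "c > 0"
  shows "emeasure lborel A = ennreal (c\<^sup>2) * emeasure lborel ((\<lambda>z. c *\<^sub>R z) -` A)"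
proof -
  have [measurable]: "(\<lambda>z. c *\<^sub>R z) -` A \<in> sets borel"
    using measurable_sets[of "\<lambda>z. c *\<^sub>R z" borel borel A] assms by simp
  have "emeasure lborel ((\<lambda>z. c *\<^sub>R z) -` A) = (\<integral>\<^sup>+z. indicator ((\<lambda>z. c *\<^sub>R z) -` A) z \<partial>lborel)"
    by (rule nn_integral_indicator[symmetric]) measurable
  also have "\<dots> = (\<integral>\<^sup>+z. indicator A (c *\<^sub>R z) \<partial>lborel)"
    by (intro nn_integral_cong) (simp add: indicator_def)
  finally have "emeasure lborel ((\<lambda>z. c *\<^sub>R z) -` A) = (\<integral>\<^sup>+z. indicator A (c *\<^sub>R z) \<partial>lborel)" .
  moreover have "emeasure lborel A = (\<integral>\<^sup>+z. indicator A z \<partial>lborel)" by simp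
  moreover have "\<dots> = ennreal (c\<^sup>2) * (\<integral>\<^sup>+z. indicator A (c *\<^sub>R z) \<partial>lborel)"
    using nn_integral_lborel_scaleR[of "indicator A" c] c by (simp add: borel_measurable_indicator)
  ultimately show ?thesis by simp
qed

lemma cnorm_nonneg: "0 \<le> cnorm d x"
  by (simp add: cnorm_def sum_nonneg)

lemma cnorm_square: "(cnorm d x)\<^sup>2 = (\<Sum>i<d. (cmod (x i))\<^sup>2)"
  by (simp add: cnorm_def sum_nonneg)

lemma cnorm_scale: "c \<ge> 0 \<Longrightarrow> cnorm d (\<lambda>i\<in>{..<d}. c *\<^sub>R x i) = c * cnorm d x"
  by (simp add: cnorm_def power_mult_distrib sum_distrib_left[symmetric] real_sqrt_mult)

text \<open>Dilation by the square root of s maps the unit ball to the ball of squared radius s and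
  leaves the scale-invariant h alone; the Jacobian is s for each of the d complex
  coordinates.\<close>

lemma nn_integral_ball_scaling:
  assumes h [measurable]: "h \<in> borel_measurable (PiM {..<d} (\<lambda>_. borel))"
    and hom: "\<And>c x. c > 0 \<Longrightarrow> h (\<lambda>i\<in>{..<d}. c *\<^sub>R x i) = h x" and s: "s > 0"
  shows "(\<integral>\<^sup>+x. h x * indicator {..s} ((cnorm d x)\<^sup>2) \<partial>lebesgue_Cd d) =
    ennreal (s ^ d) * (\<integral>\<^sup>+x. h x * indicator {..1} ((cnorm d x)\<^sup>2) \<partial>lebesgue_Cd d)"
proof -
  have ind: "indicator {..s} ((cnorm d (\<lambda>i\<in>{..<d}. sqrt s *\<^sub>R x i))\<^sup>2) = (indicator {..1} ((cnorm d x)\<^sup>2) :: ennreal)" for x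
    using s by (simp add: cnorm_scale power_mult_distrib indicator_def)
  have "(\<integral>\<^sup>+x. h x * indicator {..s} ((cnorm d x)\<^sup>2) \<partial>lebesgue_Cd d) =
     (\<Prod>i<d. ennreal ((sqrt s)\<^sup>2)) *
     (\<integral>\<^sup>+x. h (\<lambda>i\<in>{..<d}. sqrt s *\<^sub>R x i) * indicator {..s} ((cnorm d (\<lambda>i\<in>{..<d}. sqrt s *\<^sub>R x i))\<^sup>2) \<partial>lebesgue_Cd d)"
    by (rule nn_integral_lebesgue_Cd_transform) (use s emeasure_lborel_scale[where c = "sqrt s"] in auto)
  also have "(\<Prod>i<d. ennreal ((sqrt s)\<^sup>2)) = ennreal (s ^ d)"
    using s by (simp add: ennreal_power)
  finally show ?thesis using s by (simp only: ind hom real_sqrt_gt_0_iff)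
qed

lemma emeasure_lebesgue_Cd_PiE:
  assumes "\<And>i. i < d \<Longrightarrow> A i \<in> sets borel"
  shows "emeasure (lebesgue_Cd d) (PiE {..<d} A) = (\<Prod>i<d. emeasure lborel (A i))"
  unfolding lebesgue_Cd_def using assms by (intro lborel_product.emeasure_PiM) auto

text \<open>The origin is the only point at which \<open>normalize_Cd\<close> divides by zero; it is
  a product of null sets.\<close>

lemma AE_cnorm_pos:
  assumes "d > 0"
  shows "AE x in lebesgue_Cd d. cnorm d x > 0"
proof -
  have "emeasure (lebesgue_Cd d) (PiE {..<d} (\<lambda>_. {0})) = 0"
    using assms by (subst emeasure_lebesgue_Cd_PiE) (auto simp: prod_zero_iff)
  moreover have "PiE {..<d} (\<lambda>_. {0::complex}) \<in> sets (lebesgue_Cd d)"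
    unfolding sets_lebesgue_Cd by (intro sets_PiM_I_finite) auto
  ultimately have null: "PiE {..<d} (\<lambda>_. {0}) \<in> null_sets (lebesgue_Cd d)" by auto
  show ?thesis
  proof (rule AE_I'[OF null], rule subsetI)
    fix x assume x: "x \<in> {x \<in> space (lebesgue_Cd d). \<not> 0 < cnorm d x}"
    then have "cnorm d x = 0" using cnorm_nonneg[of d x] by simp
    then have "(\<Sum>i<d. (cmod (x i))\<^sup>2) = 0" by (metis cnorm_square zero_power2)
    then have "\<forall>i<d. x i = 0" by (simp add: sum_nonneg_eq_0_iff)
    then show "x \<in> PiE {..<d} (\<lambda>_. {0})"
      using x unfolding space_lebesgue_Cd by (intro PiE_I) (auto simp: PiE_iff extensional_def)
  qed
qed

text \<open>The ball is squeezed between two products of discs, whose volumes are finite positive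
  products. Radius 1 / d is small enough inside because the d squares add up to 1 / d \<le>
  1.\<close>

lemma unit_ball_Cd_volume:
  assumes "d > 0"
  shows "emeasure (lebesgue_Cd d) (unit_ball_Cd d) \<noteq> 0" "emeasure (lebesgue_Cd d) (unit_ball_Cd d) < \<infinity>"
proof -
  let ?B = "\<lambda>r. PiE {..<d} (\<lambda>_. cball (0::complex) r)"
  have B: "emeasure (lebesgue_Cd d) (?B r) = (\<Prod>i<d. ennreal (pi * r\<^sup>2))" if "r \<ge> 0" for r
    using that by (subst emeasure_lebesgue_Cd_PiE) (auto simp: emeasure_cball unit_ball_vol_2)
  have Bs: "?B r \<in> sets (lebesgue_Cd d)" for r
    unfolding sets_lebesgue_Cd by (intro sets_PiM_I_finite) auto
  have us: "unit_ball_Cd d \<in> sets (lebesgue_Cd d)" unfolding sets_lebesgue_Cd by measurable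
  have "?B (1 / real d) \<subseteq> unit_ball_Cd d"
  proof
    fix x assume x: "x \<in> ?B (1 / real d)"
    have "(cnorm d x)\<^sup>2 \<le> (\<Sum>i<d. (1 / real d)\<^sup>2)"
      unfolding cnorm_square using x by (intro sum_mono power_mono) (auto simp: PiE_iff)
    also have "\<dots> = 1 / real d" using assms by (simp add: power2_eq_square)
    also have "\<dots> \<le> 1" using assms by simp
    finally have "cnorm d x \<le> 1" using cnorm_nonneg[of d x] by (simp add: power_le_one_iff abs_square_le_1)
    then show "x \<in> unit_ball_Cd d" using x by (auto simp: unit_ball_Cd_def space_lebesgue_Cd PiE_iff)
  qed
  then have "emeasure (lebesgue_Cd d) (?B (1 / real d)) \<le> emeasure (lebesgue_Cd d) (unit_ball_Cd d)"
    by (rule emeasure_mono[OF _ us])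
  moreover have "emeasure (lebesgue_Cd d) (?B (1 / real d)) \<noteq> 0" using assms by (subst B) auto
  ultimately show "emeasure (lebesgue_Cd d) (unit_ball_Cd d) \<noteq> 0" by (metis le_zero_eq)
  have "unit_ball_Cd d \<subseteq> ?B 1"
  proof
    fix x assume x: "x \<in> unit_ball_Cd d"
    have "cmod (x i) \<le> 1" if "i < d" for i
    proof -
      have "(cmod (x i))\<^sup>2 \<le> (cnorm d x)\<^sup>2"
        unfolding cnorm_square using that by (intro member_le_sum) auto
      then have "cmod (x i) \<le> cnorm d x" using cnorm_nonneg power2_le_imp_le by blast
      then show ?thesis using x by (auto simp: unit_ball_Cd_def)
    qed
    then show "x \<in> ?B 1" using x by (auto simp: unit_ball_Cd_def space_lebesgue_Cd PiE_iff)
  qed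
  then have "emeasure (lebesgue_Cd d) (unit_ball_Cd d) \<le> emeasure (lebesgue_Cd d) (?B 1)"
    by (rule emeasure_mono[OF _ Bs])
  also have "\<dots> < \<infinity>" by (subst B) (auto simp: power_less_top_ennreal)
  finally show "emeasure (lebesgue_Cd d) (unit_ball_Cd d) < \<infinity>" .
qed

text \<open>A substitute for polar coordinates. By scaling, the image of h dx under the squared norm
  has a distribution function proportional to s^d, just as for h = 1, so the two image measures are
  proportional and the angular and radial parts of the integral factor.\<close>

lemma nn_integral_radial_split:
  assumes d: "d > 0"
    and h [measurable]: "h \<in> borel_measurable (PiM {..<d} (\<lambda>_. borel))"
    and hom: "\<And>c x. c > 0 \<Longrightarrow> h (\<lambda>i\<in>{..<d}. c *\<^sub>R x i) = h x"
    and fin: "(\<integral>\<^sup>+x. h x * indicator {..1} ((cnorm d x)\<^sup>2) \<partial>lebesgue_Cd d) < \<infinity>"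
    and G [measurable]: "G \<in> borel_measurable borel"
  shows "emeasure (lebesgue_Cd d) (unit_ball_Cd d) * (\<integral>\<^sup>+x. h x * G ((cnorm d x)\<^sup>2) \<partial>lebesgue_Cd d) =
    (\<integral>\<^sup>+x. h x * indicator {..1} ((cnorm d x)\<^sup>2) \<partial>lebesgue_Cd d) * (\<integral>\<^sup>+x. G ((cnorm d x)\<^sup>2) \<partial>lebesgue_Cd d)"
proof -
  let ?L = "lebesgue_Cd d" and ?N = "\<lambda>x. (cnorm d x)\<^sup>2"
  let ?m = "\<lambda>h. \<integral>\<^sup>+x. h x * indicator {..1} (?N x) \<partial>?L"
  have us: "unit_ball_Cd d \<in> sets ?L" unfolding sets_lebesgue_Cd by measurable
  have vol: "emeasure ?L (unit_ball_Cd d) = ?m (\<lambda>_. 1)"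
    unfolding nn_integral_indicator[OF us, symmetric]
    by (intro nn_integral_cong)
       (auto simp: unit_ball_Cd_def indicator_def abs_square_le_1 abs_of_nonneg[OF cnorm_nonneg])
  have em: "emeasure (distr (density ?L h) borel ?N) {..s} = ennreal ((max 0 s) ^ d) * ?m h"
    if [measurable]: "h \<in> borel_measurable (PiM {..<d} (\<lambda>_. borel))"
      and hom: "\<And>c x. c > 0 \<Longrightarrow> h (\<lambda>i\<in>{..<d}. c *\<^sub>R x i) = h x" for h s
  proof -
    have "emeasure (distr (density ?L h) borel ?N) {..s} = (\<integral>\<^sup>+t. indicator {..s} t \<partial>distr (density ?L h) borel ?N)"
      by simp
    also have "\<dots> = (\<integral>\<^sup>+x. indicator {..s} (?N x) \<partial>density ?L h)"
      by (rule nn_integral_distr) measurable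
    also have "\<dots> = (\<integral>\<^sup>+x. h x * indicator {..s} (?N x) \<partial>?L)"
      by (rule nn_integral_density) measurable
    also have "\<dots> = ennreal ((max 0 s) ^ d) * ?m h"
    proof (cases "s > 0")
      case True
      then have m: "max 0 s = s" by simp
      show ?thesis unfolding m by (rule nn_integral_ball_scaling[OF that True])
    next
      case False
      \<comment> \<open>For s \<le> 0 the ball is null, and \<open>max 0 s\<close> raised to the
        positive power d gives 0 on the other side as well.\<close>
      have "(\<integral>\<^sup>+x. h x * indicator {..s} (?N x) \<partial>?L) = (\<integral>\<^sup>+x. 0 \<partial>?L)"
      proof (rule nn_integral_cong_AE, rule eventually_mono[OF AE_cnorm_pos[OF d]])
        fix x assume "cnorm d x > 0"
        then have "?N x > 0" by simp
        then have "\<not> ?N x \<le> s" using False by linarith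
        then show "h x * indicator {..s} (?N x) = 0" by (simp add: indicator_def)
      qed
      moreover have "max 0 s = 0" using False by simp
      ultimately show ?thesis using d by simp
    qed
    finally show ?thesis .
  qed
  \<comment> \<open>Each measure is scaled by the constant of the other, which expresses
    proportionality without dividing in the extended reals.\<close>
  have "scale_measure (?m (\<lambda>_. 1)) (distr (density ?L h) borel ?N) =
        scale_measure (?m h) (distr (density ?L (\<lambda>_. 1)) borel ?N)" (is "?A = ?B")
  proof (rule real_measure_eqI_atMost)
    fix s :: real
    have em1: "emeasure (distr (density ?L (\<lambda>_. 1)) borel ?N) {..s} = ennreal ((max 0 s) ^ d) * ?m (\<lambda>_. 1)"
      by (rule em) auto
    have emh: "emeasure (distr (density ?L h) borel ?N) {..s} = ennreal ((max 0 s) ^ d) * ?m h"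
      by (rule em[OF h]) (rule hom)
    show "emeasure ?A {..s} = emeasure ?B {..s}"
      unfolding emeasure_scale_measure emh em1 by (simp only: mult_ac)
    show "emeasure ?A {..s} < \<infinity>"
      unfolding emeasure_scale_measure emh
      using fin unit_ball_Cd_volume(2)[OF d] unfolding vol by (auto simp: ennreal_mult_less_top)
  qed auto
  then have "(\<integral>\<^sup>+s. G s \<partial>?A) = (\<integral>\<^sup>+s. G s \<partial>?B)" by simp
  then show ?thesis
    unfolding vol by (simp add: nn_integral_scale_measure nn_integral_distr nn_integral_density)
qed

section \<open>The invariant measure on unit vectors\<close>

lemma sets_phi_measure [measurable_cong]: "sets (phi_measure d) = sets (PiM {..<d} (\<lambda>_. borel))"
  by (simp add: phi_measure_def)

lemma measurable_normalize_uniform: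
  "normalize_Cd d \<in> measurable (uniform_measure (lebesgue_Cd d) (unit_ball_Cd d)) (PiM {..<d} (\<lambda>_. borel))"
  by measurable

lemma nn_integral_phi_measure:
  assumes [measurable]: "f \<in> borel_measurable (PiM {..<d} (\<lambda>_. borel))"
  shows "(\<integral>\<^sup>+\<phi>. f \<phi> \<partial>phi_measure d) =
    (\<integral>\<^sup>+x. f (normalize_Cd d x) * indicator {..1} ((cnorm d x)\<^sup>2) \<partial>lebesgue_Cd d) / emeasure (lebesgue_Cd d) (unit_ball_Cd d)"
proof -
  have "(\<integral>\<^sup>+\<phi>. f \<phi> \<partial>phi_measure d) = (\<integral>\<^sup>+x. f (normalize_Cd d x) \<partial>uniform_measure (lebesgue_Cd d) (unit_ball_Cd d))"
    unfolding phi_measure_def by (rule nn_integral_distr) measurable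
  also have "\<dots> = (\<integral>\<^sup>+x. f (normalize_Cd d x) * indicator (unit_ball_Cd d) x \<partial>lebesgue_Cd d) / emeasure (lebesgue_Cd d) (unit_ball_Cd d)"
    by (rule nn_integral_uniform_measure) measurable
  also have "(\<integral>\<^sup>+x. f (normalize_Cd d x) * indicator (unit_ball_Cd d) x \<partial>lebesgue_Cd d) =
     (\<integral>\<^sup>+x. f (normalize_Cd d x) * indicator {..1} ((cnorm d x)\<^sup>2) \<partial>lebesgue_Cd d)"
    by (intro nn_integral_cong)
       (auto simp: unit_ball_Cd_def indicator_def abs_square_le_1 abs_of_nonneg[OF cnorm_nonneg])
  finally show ?thesis .
qed

lemma prob_space_phi_measure:
  assumes "d > 0"
  shows "prob_space (phi_measure d)"
proof -
  interpret prob_space "uniform_measure (lebesgue_Cd d) (unit_ball_Cd d)"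
    by (rule prob_space_uniform_measure) (use unit_ball_Cd_volume[OF assms] in auto)
  show ?thesis unfolding phi_measure_def by (rule prob_space_distr) (rule measurable_normalize_uniform)
qed

lemma cnorm_normalize: "cnorm d x > 0 \<Longrightarrow> cnorm d (normalize_Cd d x) = 1"
proof -
  assume x: "cnorm d x > 0"
  have "(cnorm d (normalize_Cd d x))\<^sup>2 = (\<Sum>i<d. (cmod (x i))\<^sup>2 / (cnorm d x)\<^sup>2)"
    unfolding cnorm_square[of d "normalize_Cd d x"] using x by (intro sum.cong) (auto simp: normalize_Cd_def norm_divide power_divide)
  also have "\<dots> = 1" using x by (simp add: sum_divide_distrib[symmetric] cnorm_square[symmetric])
  finally show ?thesis using cnorm_nonneg[of d "normalize_Cd d x"] by (simp add: power2_eq_1_iff)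
qed

text \<open>Unit length can be claimed only almost everywhere: division by zero sends the origin to
  the zero vector. Every later use of normalization is an almost-everywhere argument for this
  reason.\<close>

lemma AE_phi_unit:
  assumes "d > 0"
  shows "AE \<phi> in phi_measure d. cnorm d \<phi> = 1"
proof -
  have us: "unit_ball_Cd d \<in> sets (lebesgue_Cd d)" unfolding sets_lebesgue_Cd by measurable
  have "AE x in uniform_measure (lebesgue_Cd d) (unit_ball_Cd d). cnorm d (normalize_Cd d x) = 1"
    by (rule AE_uniform_measureI[OF us])
       (rule eventually_mono[OF AE_cnorm_pos[OF assms]], simp add: cnorm_normalize)
  then show ?thesis unfolding phi_measure_def
    by (subst AE_distr_iff) measurable
qed

text \<open>A phase on one coordinate preserves Lebesgue measure and the norm and commutes with
  normalization. This is the part of unitary invariance that makes the mixed moments vanish.\<close>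

lemma phi_measure_phase_invariant:
  fixes d m :: nat
  assumes u: "cmod u = 1"
  defines "R \<equiv> \<lambda>x. \<lambda>i\<in>{..<d}. (if i = m then u else 1) * x i"
  shows "distr (phi_measure d) (phi_measure d) R = phi_measure d"
proof (rule measure_eqI)
  have [measurable]: "R \<in> measurable (PiM {..<d} (\<lambda>_. borel)) (PiM {..<d} (\<lambda>_. borel))"
    unfolding R_def by (rule measurable_componentwise) measurable
  have cR: "cnorm d (R x) = cnorm d x" for x
    unfolding cnorm_def R_def by (intro arg_cong[of _ _ sqrt] sum.cong) (auto simp: norm_mult u)
  have nR: "normalize_Cd d (R x) = R (normalize_Cd d x)" for x
    unfolding normalize_Cd_def cR by (auto simp: R_def)
  fix A assume "A \<in> sets (distr (phi_measure d) (phi_measure d) R)"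
  then have [measurable]: "A \<in> sets (PiM {..<d} (\<lambda>_. borel))" by (simp add: sets_phi_measure)
  have "emeasure (phi_measure d) A = (\<integral>\<^sup>+\<phi>. indicator A \<phi> \<partial>phi_measure d)"
    by (simp add: sets_phi_measure)
  also have "\<dots> = (\<integral>\<^sup>+x. indicator A (normalize_Cd d x) * indicator {..1} ((cnorm d x)\<^sup>2) \<partial>lebesgue_Cd d) / emeasure (lebesgue_Cd d) (unit_ball_Cd d)"
    by (rule nn_integral_phi_measure) measurable
  also have "(\<integral>\<^sup>+x. indicator A (normalize_Cd d x) * indicator {..1} ((cnorm d x)\<^sup>2) \<partial>lebesgue_Cd d)
     = (\<Prod>i<d. 1) * (\<integral>\<^sup>+x. indicator A (normalize_Cd d (R x)) * indicator {..1} ((cnorm d (R x))\<^sup>2) \<partial>lebesgue_Cd d)"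
    unfolding R_def by (rule nn_integral_lebesgue_Cd_transform) (use u in \<open>auto intro!: emeasure_lborel_rotate\<close>)
  also have "\<dots> = (\<integral>\<^sup>+x. indicator A (R (normalize_Cd d x)) * indicator {..1} ((cnorm d x)\<^sup>2) \<partial>lebesgue_Cd d)"
    by (simp add: nR cR)
  also have "\<dots> / emeasure (lebesgue_Cd d) (unit_ball_Cd d) = (\<integral>\<^sup>+\<phi>. indicator A (R \<phi>) \<partial>phi_measure d)"
    by (rule nn_integral_phi_measure[symmetric]) measurable
  also have "\<dots> = (\<integral>\<^sup>+\<phi>. indicator A \<phi> \<partial>distr (phi_measure d) (phi_measure d) R)"
    by (rule nn_integral_distr[symmetric]) measurable
  also have "\<dots> = emeasure (distr (phi_measure d) (phi_measure d) R) A" by (simp add: sets_phi_measure)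
  finally show "emeasure (distr (phi_measure d) (phi_measure d) R) A = emeasure (phi_measure d) A" by simp
qed simp

section \<open>Occupation numbers of words and the absolute moments of the measure\<close>

definition mult_count :: "nat \<Rightarrow> (nat \<Rightarrow> nat) \<Rightarrow> nat \<Rightarrow> nat" where
  "mult_count n a i = card {j. j < n \<and> a j = i}"

lemma mult_count_0 [simp]: "mult_count 0 a i = 0"
  by (simp add: mult_count_def)

lemma mult_count_Suc: "mult_count (Suc n) a i = mult_count n a i + (if a n = i then 1 else 0)"
proof -
  have "{j. j < Suc n \<and> a j = i} = {j. j < n \<and> a j = i} \<union> (if a n = i then {n} else {})"
    by (auto simp: less_Suc_eq)
  then show ?thesis by (auto simp: mult_count_def)
qed

lemma prod_eq_prod_mult_count:
  assumes "\<And>j. j < n \<Longrightarrow> a j < d"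
  shows "(\<Prod>j<n. f (a j)) = (\<Prod>i<d. f i ^ mult_count n a i)"
  using assms
proof (induction n)
  case (Suc n)
  have "(\<Prod>i<d. f i ^ mult_count (Suc n) a i) = (\<Prod>i<d. f i ^ mult_count n a i * (if i = a n then f i else 1))"
    by (intro prod.cong) (auto simp: mult_count_Suc mult.commute)
  also have "\<dots> = (\<Prod>i<d. f i ^ mult_count n a i) * f (a n)"
    using Suc.prems[of n] by (simp add: prod.distrib prod.delta)
  finally show ?case using Suc by simp
qed simp

lemma sum_mult_count:
  assumes "\<And>j. j < n \<Longrightarrow> a j < d"
  shows "(\<Sum>i<d. mult_count n a i) = n"
  using assms
proof (induction n)
  case (Suc n)
  then have "a n < d" by simp
  with Suc show ?case by (simp add: mult_count_Suc sum.distrib)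
qed simp

lemma prod_fact_mult_count_Suc:
  assumes "a n < d"
  shows "(\<Prod>i<d. fact (mult_count (Suc n) a i)) = of_nat (mult_count n a (a n) + 1) * (\<Prod>i<d. fact (mult_count n a i) :: 'a::{comm_semiring_1,semiring_char_0})"
proof -
  have "(\<Prod>i<d. fact (mult_count (Suc n) a i) :: 'a) =
     (\<Prod>i<d. (if i = a n then of_nat (mult_count n a i + 1) else 1) * fact (mult_count n a i))"
    by (intro prod.cong) (auto simp: mult_count_Suc)
  then show ?thesis using assms by (simp add: prod.distrib prod.delta)
qed

text \<open>The Gaussian weight is radial and at the same time a product over the coordinates, so
  its moments are products of moments on the plane.\<close>

lemma gaussian_moment_Cd:
  assumes a: "\<And>j. j < n \<Longrightarrow> a j < d"
  shows "(\<integral>\<^sup>+x. ennreal (exp (- (cnorm d x)\<^sup>2) * (\<Prod>j<n. (cmod (x (a j)))\<^sup>2)) \<partial>lebesgue_Cd d) =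
    ennreal (\<Prod>i<d. pi * fact (mult_count n a i))"
proof -
  have "exp (- (cnorm d x)\<^sup>2) * (\<Prod>j<n. (cmod (x (a j)))\<^sup>2) =
     (\<Prod>i<d. exp (- (cmod (x i))\<^sup>2) * ((cmod (x i))\<^sup>2) ^ mult_count n a i)" for x
    using prod_eq_prod_mult_count[OF a, where f = "\<lambda>i. (cmod (x i))\<^sup>2"]
    by (simp add: cnorm_square sum_negf[symmetric] exp_sum prod.distrib)
  then have "(\<integral>\<^sup>+x. ennreal (exp (- (cnorm d x)\<^sup>2) * (\<Prod>j<n. (cmod (x (a j)))\<^sup>2)) \<partial>lebesgue_Cd d) =
     (\<integral>\<^sup>+x. (\<Prod>i<d. ennreal (exp (- (cmod (x i))\<^sup>2) * ((cmod (x i))\<^sup>2) ^ mult_count n a i)) \<partial>lebesgue_Cd d)"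
    by (intro nn_integral_cong) (simp add: prod_ennreal)
  also have "\<dots> = (\<Prod>i<d. \<integral>\<^sup>+z. ennreal (exp (- (cmod z)\<^sup>2) * ((cmod z)\<^sup>2) ^ mult_count n a i) \<partial>lborel)"
    unfolding lebesgue_Cd_def by (rule lborel_product.product_nn_integral_prod) auto
  also have "\<dots> = (\<Prod>i<d. ennreal (pi * fact (mult_count n a i)))"
    by (simp only: gaussian_moment_complex)
  also have "\<dots> = ennreal (\<Prod>i<d. pi * fact (mult_count n a i))"
    by (simp add: prod_ennreal)
  finally show ?thesis .
qed

lemma component_le_cnorm: "i < d \<Longrightarrow> cmod (x i) \<le> cnorm d x"
  by (rule power2_le_imp_le[OF _ cnorm_nonneg]) (auto simp: cnorm_square intro!: member_le_sum)

lemma cnorm_normalize_le: "cnorm d (normalize_Cd d x) \<le> 1"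
proof (cases "cnorm d x > 0")
  case False
  then have "cnorm d x = 0" using cnorm_nonneg[of d x] by simp
  then have "cnorm d (normalize_Cd d x) = 0" unfolding cnorm_def[of d "normalize_Cd d x"] by (simp add: normalize_Cd_def)
  then show ?thesis by simp
qed (simp add: cnorm_normalize)

lemma borel_measurable_monomial [measurable]:
  assumes "\<And>j. j < n \<Longrightarrow> a j < d"
  shows "(\<lambda>\<phi>. \<Prod>j<n. \<phi> (a j)) \<in> borel_measurable (PiM {..<d} (\<lambda>_. borel :: complex measure))"
  using assms by (intro borel_measurable_prod measurable_component_singleton) auto

lemma borel_measurable_abs_monomial [measurable]:
  assumes "\<And>j. j < n \<Longrightarrow> a j < d"
  shows "(\<lambda>\<phi>. \<Prod>j<n. (cmod (\<phi> (a j)))\<^sup>2) \<in> borel_measurable (PiM {..<d} (\<lambda>_. borel :: complex measure))"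
proof -
  have "(\<lambda>\<phi>. (cmod (\<Prod>j<n. \<phi> (a j)))\<^sup>2) \<in> borel_measurable (PiM {..<d} (\<lambda>_. borel :: complex measure))"
    using borel_measurable_monomial[OF assms] by measurable
  then show ?thesis by (simp add: prod_norm[symmetric] prod_power_distrib)
qed

definition phi_moment :: "nat \<Rightarrow> nat \<Rightarrow> (nat \<Rightarrow> nat) \<Rightarrow> ennreal" where
  "phi_moment d n a = (\<integral>\<^sup>+\<phi>. ennreal (\<Prod>j<n. (cmod (\<phi> (a j)))\<^sup>2) \<partial>phi_measure d)"

definition radial_moment :: "nat \<Rightarrow> nat \<Rightarrow> ennreal" where
  "radial_moment d n = (\<integral>\<^sup>+x. ennreal (exp (- (cnorm d x)\<^sup>2) * ((cnorm d x)\<^sup>2) ^ n) \<partial>lebesgue_Cd d)"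

text \<open>The integrand of the Gaussian moment is a scale-invariant monomial in the normalized
  vector times a function of the norm. The radial splitting separates them, and the unit ball volume
  cancels against the normalization of the measure.\<close>

lemma phi_moment_mult_radial:
  assumes d: "d > 0" and a: "\<And>j. j < n \<Longrightarrow> a j < d"
  shows "phi_moment d n a * radial_moment d n = ennreal (\<Prod>i<d. pi * fact (mult_count n a i))"
proof -
  let ?L = "lebesgue_Cd d" and ?B = "unit_ball_Cd d"
  define h where "h x = ennreal (\<Prod>j<n. (cmod (normalize_Cd d x (a j)))\<^sup>2)" for x
  define G where "G s = ennreal (exp (- s) * s ^ n)" for s :: real
  have [measurable]: "(\<lambda>\<phi>. \<Prod>j<n. (cmod (\<phi> (a j)))\<^sup>2) \<in> borel_measurable (PiM {..<d} (\<lambda>_. borel :: complex measure))"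
    by (rule borel_measurable_abs_monomial[OF a])
  have h [measurable]: "h \<in> borel_measurable (PiM {..<d} (\<lambda>_. borel))"
    unfolding h_def by measurable
  have hG: "h x * G ((cnorm d x)\<^sup>2) = ennreal (exp (- (cnorm d x)\<^sup>2) * (\<Prod>j<n. (cmod (x (a j)))\<^sup>2))" for x
  proof -
    have "(\<Prod>j<n. (cmod (normalize_Cd d x (a j)))\<^sup>2) * ((cnorm d x)\<^sup>2) ^ n = (\<Prod>j<n. (cmod (x (a j)))\<^sup>2)"
    proof (cases "cnorm d x = 0")
      case True
      then have "x i = 0" if "i < d" for i using component_le_cnorm[OF that, of x] by simp
      then have "(cmod (x (a j)))\<^sup>2 = (cnorm d x)\<^sup>2" if "j < n" for j using a[OF that] True by simp
      then have "(\<Prod>j<n. (cmod (x (a j)))\<^sup>2) = ((cnorm d x)\<^sup>2) ^ n" by simp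
      \<comment> \<open>At the origin both sides are the n-th power of 0, that is, 1 for n = 0 and 0
        otherwise.\<close>
      then show ?thesis using True by (cases n) auto
    next
      case False
      have "(cmod (normalize_Cd d x (a j)))\<^sup>2 * (cnorm d x)\<^sup>2 = (cmod (x (a j)))\<^sup>2" if "j < n" for j
        using a[OF that] False cnorm_nonneg[of d x] by (simp add: normalize_Cd_def norm_divide power_divide)
      then have "(\<Prod>j<n. (cmod (normalize_Cd d x (a j)))\<^sup>2 * (cnorm d x)\<^sup>2) = (\<Prod>j<n. (cmod (x (a j)))\<^sup>2)"
        by (intro prod.cong) auto
      then show ?thesis by (simp add: prod.distrib)
    qed
    then have "exp (- (cnorm d x)\<^sup>2) * (\<Prod>j<n. (cmod (x (a j)))\<^sup>2) =
      (\<Prod>j<n. (cmod (normalize_Cd d x (a j)))\<^sup>2) * (exp (- (cnorm d x)\<^sup>2) * ((cnorm d x)\<^sup>2) ^ n)"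
      by (simp only: mult_ac flip: \<open>_ = (\<Prod>j<n. (cmod (x (a j)))\<^sup>2)\<close>)
    then show ?thesis unfolding h_def G_def
      by (simp only:) (rule ennreal_mult[symmetric], auto intro!: prod_nonneg)
  qed
  have hom: "h (\<lambda>i\<in>{..<d}. c *\<^sub>R x i) = h x" if "c > 0" for c x
  proof -
    have "normalize_Cd d (\<lambda>i\<in>{..<d}. c *\<^sub>R x i) = normalize_Cd d x"
      using that unfolding normalize_Cd_def cnorm_scale[OF less_imp_le[OF that]]
      by (auto simp: scaleR_conv_of_real restrict_def fun_eq_iff)
    then show ?thesis by (simp add: h_def)
  qed
  have us: "?B \<in> sets ?L" unfolding sets_lebesgue_Cd by measurable
  have hle: "h x \<le> 1" for x
  proof -
    have "(\<Prod>j<n. (cmod (normalize_Cd d x (a j)))\<^sup>2) \<le> 1"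
    proof (rule prod_le_1)
      fix j assume "j \<in> {..<n}"
      then have "cmod (normalize_Cd d x (a j)) \<le> 1"
        using component_le_cnorm[OF a, of j "normalize_Cd d x"] cnorm_normalize_le[of d x] by auto
      then show "0 \<le> (cmod (normalize_Cd d x (a j)))\<^sup>2 \<and> (cmod (normalize_Cd d x (a j)))\<^sup>2 \<le> 1"
        by (simp add: power_le_one)
    qed
    then show ?thesis by (simp add: h_def)
  qed
  have "(\<integral>\<^sup>+x. h x * indicator {..1} ((cnorm d x)\<^sup>2) \<partial>?L) \<le> (\<integral>\<^sup>+x. indicator ?B x \<partial>?L)"
    using hle by (intro nn_integral_mono)
       (auto simp: unit_ball_Cd_def indicator_def abs_square_le_1 abs_of_nonneg[OF cnorm_nonneg])
  also have "\<dots> < \<infinity>" using unit_ball_Cd_volume(2)[OF d] us by simp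
  finally have fin: "(\<integral>\<^sup>+x. h x * indicator {..1} ((cnorm d x)\<^sup>2) \<partial>?L) < \<infinity>" .
  have split: "emeasure ?L ?B * (\<integral>\<^sup>+x. h x * G ((cnorm d x)\<^sup>2) \<partial>?L) =
    (\<integral>\<^sup>+x. h x * indicator {..1} ((cnorm d x)\<^sup>2) \<partial>?L) * (\<integral>\<^sup>+x. G ((cnorm d x)\<^sup>2) \<partial>?L)"
    by (rule nn_integral_radial_split[OF d h hom fin]) (auto simp: G_def)
  have rad: "(\<integral>\<^sup>+x. G ((cnorm d x)\<^sup>2) \<partial>?L) = radial_moment d n" by (simp add: G_def radial_moment_def)
  have mom: "phi_moment d n a = (\<integral>\<^sup>+x. h x * indicator {..1} ((cnorm d x)\<^sup>2) \<partial>?L) / emeasure ?L ?B"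
    unfolding phi_moment_def h_def by (rule nn_integral_phi_measure) measurable
  have "phi_moment d n a * radial_moment d n = (emeasure ?L ?B * (\<integral>\<^sup>+x. h x * G ((cnorm d x)\<^sup>2) \<partial>?L)) / emeasure ?L ?B"
    unfolding split rad mom by (simp add: ennreal_times_divide mult.commute)
  also have "\<dots> = (\<integral>\<^sup>+x. h x * G ((cnorm d x)\<^sup>2) \<partial>?L)"
    using unit_ball_Cd_volume[OF d] by (subst mult.commute) (simp add: ennreal_mult_divide_eq)
  also have "\<dots> = ennreal (\<Prod>i<d. pi * fact (mult_count n a i))"
    unfolding hG by (rule gaussian_moment_Cd[OF a])
  finally show ?thesis .
qed

text \<open>Summing over the letter in the last place inserts the factor \<Sum> |\<phi>_i|^2 = 1.
  This consistency between moments of successive orders is what determines the radial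
  moments.\<close>

lemma sum_phi_moment:
  assumes d: "d > 0" and a: "\<And>j. j < n \<Longrightarrow> a j < d"
  shows "(\<Sum>i<d. phi_moment d (Suc n) (a(n := i))) = phi_moment d n a"
proof -
  have a': "(a(n := i)) j < d" if "i < d" "j < Suc n" for i j using a that by (auto simp: less_Suc_eq)
  have "(\<Sum>i<d. phi_moment d (Suc n) (a(n := i))) =
      (\<integral>\<^sup>+\<phi>. (\<Sum>i<d. ennreal (\<Prod>j<Suc n. (cmod (\<phi> ((a(n := i)) j)))\<^sup>2)) \<partial>phi_measure d)"
    unfolding phi_moment_def
  proof (rule nn_integral_sum[symmetric])
    fix i assume "i \<in> {..<d}"
    then have [measurable]: "(\<lambda>\<phi>. \<Prod>j<Suc n. (cmod (\<phi> ((a(n := i)) j)))\<^sup>2) \<in> borel_measurable (PiM {..<d} (\<lambda>_. borel :: complex measure))"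
      by (intro borel_measurable_abs_monomial a') auto
    show "(\<lambda>\<phi>. ennreal (\<Prod>j<Suc n. (cmod (\<phi> ((a(n := i)) j)))\<^sup>2)) \<in> borel_measurable (phi_measure d)"
      by measurable
  qed
  also have "\<dots> = phi_moment d n a"
    unfolding phi_moment_def
  proof (rule nn_integral_cong_AE, rule eventually_mono[OF AE_phi_unit[OF d]])
    fix \<phi> assume 1: "cnorm d \<phi> = 1"
    have "(\<Prod>j<n. (cmod (\<phi> ((a(n := i)) j)))\<^sup>2) = (\<Prod>j<n. (cmod (\<phi> (a j)))\<^sup>2)" for i
      by (intro prod.cong) auto
    then have "(\<Sum>i<d. ennreal (\<Prod>j<Suc n. (cmod (\<phi> ((a(n := i)) j)))\<^sup>2)) =
       ennreal (\<Sum>i<d. (\<Prod>j<n. (cmod (\<phi> (a j)))\<^sup>2) * (cmod (\<phi> i))\<^sup>2)"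
      by (subst sum_ennreal) (auto intro!: mult_nonneg_nonneg prod_nonneg)
    also have "(\<Sum>i<d. (\<Prod>j<n. (cmod (\<phi> (a j)))\<^sup>2) * (cmod (\<phi> i))\<^sup>2) = (\<Prod>j<n. (cmod (\<phi> (a j)))\<^sup>2)"
      using cnorm_square[of d \<phi>] 1 by (simp add: sum_distrib_left[symmetric])
    finally show "(\<Sum>i<d. ennreal (\<Prod>j<Suc n. (cmod (\<phi> ((a(n := i)) j)))\<^sup>2)) = ennreal (\<Prod>j<n. (cmod (\<phi> (a j)))\<^sup>2)" .
  qed
  finally show ?thesis .
qed

lemma mult_count_upd: "mult_count n (a(n := i)) = mult_count n a"
  unfolding mult_count_def by (intro ext arg_cong[of _ _ card]) auto

text \<open>No radial integral is evaluated. Appending a letter i multiplies the Gaussian moment by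
  (occupation number of i) + 1; summing over i and using the consistency of the moments gives the
  recursion with factor n + d, since the occupation numbers add up to n. The induction starts from
  the Gaussian integral pi^d.\<close>

lemma radial_moment_eq:
  assumes d: "d > 0"
  shows "radial_moment d n = ennreal (pi ^ d * fact (d + n - 1) / fact (d - 1))"
proof (induction n)
  case 0
  show ?case using gaussian_moment_Cd[of 0 "\<lambda>_. 0" d] by (simp add: radial_moment_def)
next
  case (Suc n)
  \<comment> \<open>Any word of length n would serve, because its moment cancels from the
    recursion.\<close>
  define a :: "nat \<Rightarrow> nat" where "a = (\<lambda>_. 0)"
  have a: "a j < d" for j using d by (simp add: a_def)
  define J where "J = (\<Prod>i<d. pi * fact (mult_count n a i))"
  have J: "J > 0" unfolding J_def by (intro prod_pos) auto
  let ?m = "phi_moment d n a"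
  have mJ: "?m * radial_moment d n = ennreal J" unfolding J_def by (rule phi_moment_mult_radial[OF d a])
  have m0: "?m \<noteq> 0" using mJ J by auto
  \<comment> \<open>Together with finiteness below, nonvanishing makes the later cancellation in the
    extended reals legitimate.\<close>
  have r0: "radial_moment d n > 0" using mJ J by (auto simp: zero_less_iff_neq_zero)
  have mfin: "?m \<noteq> \<infinity>" using mJ r0 by (auto simp: ennreal_top_mult split: if_splits)
  have step: "phi_moment d (Suc n) (a(n := i)) * radial_moment d (Suc n) = ennreal (real (mult_count n a i + 1) * J)" if "i < d" for i
  proof -
    have "phi_moment d (Suc n) (a(n := i)) * radial_moment d (Suc n) = ennreal (\<Prod>k<d. pi * fact (mult_count (Suc n) (a(n := i)) k))"
      by (rule phi_moment_mult_radial[OF d]) (use a that in auto)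
    also have "(\<Prod>k<d. pi * fact (mult_count (Suc n) (a(n := i)) k)) = real (mult_count n a i + 1) * J"
      using prod_fact_mult_count_Suc[of "a(n := i)" n d, where 'a = real] that
      by (simp add: J_def prod.distrib mult_count_upd)
    finally show ?thesis .
  qed
  have "?m * radial_moment d (Suc n) = (\<Sum>i<d. phi_moment d (Suc n) (a(n := i)) * radial_moment d (Suc n))"
    unfolding sum_distrib_right[symmetric] by (simp add: sum_phi_moment[OF d a])
  also have "\<dots> = (\<Sum>i<d. ennreal (real (mult_count n a i + 1) * J))" by (intro sum.cong) (auto simp: step)
  also have "\<dots> = ennreal (\<Sum>i<d. real (mult_count n a i + 1) * J)" using J by (intro sum_ennreal) auto
  also have "(\<Sum>i<d. real (mult_count n a i + 1) * J) = real (\<Sum>i<d. mult_count n a i + 1) * J"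
    by (simp only: of_nat_sum sum_distrib_right)
  also have "(\<Sum>i<d. mult_count n a i + 1) = n + d" by (subst sum.distrib) (simp add: sum_mult_count[of n a d] a)
  also have "ennreal (real (n + d) * J) = ?m * (ennreal (real (n + d)) * radial_moment d n)"
    using J by (simp add: ennreal_mult mJ[symmetric] mult_ac)
  finally have "radial_moment d (Suc n) = ennreal (real (n + d)) * radial_moment d n"
    using m0 mfin by (simp add: ennreal_mult_cancel_left)
  also have "\<dots> = ennreal (real (n + d) * (pi ^ d * fact (d + n - 1) / fact (d - 1)))"
    unfolding Suc by (rule ennreal_mult[symmetric]) auto
  also have "real (n + d) * (pi ^ d * fact (d + n - 1) / fact (d - 1)) = pi ^ d * fact (d + Suc n - 1) / fact (d - 1)"
    using d fact_reduce[of "d + n", where 'a = real] by (simp add: algebra_simps)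
  finally show ?case .
qed

lemma phi_moment_eq:
  assumes d: "d > 0" and a: "\<And>j. j < n \<Longrightarrow> a j < d"
  shows "phi_moment d n a = ennreal ((\<Prod>i<d. fact (mult_count n a i)) * fact (d - 1) / fact (d + n - 1))"
proof -
  define r where "r = pi ^ d * fact (d + n - 1) / fact (d - 1 :: nat)"
  have r: "r > 0" by (simp add: r_def)
  have "phi_moment d n a * ennreal r = ennreal (\<Prod>i<d. pi * fact (mult_count n a i))"
    unfolding r_def radial_moment_eq[OF d, symmetric] by (rule phi_moment_mult_radial[OF d a])
  also have "(\<Prod>i<d. pi * fact (mult_count n a i)) = (\<Prod>i<d. fact (mult_count n a i)) * fact (d - 1) / fact (d + n - 1) * r"
    by (simp add: r_def prod.distrib)
  also have "ennreal \<dots> = ennreal ((\<Prod>i<d. fact (mult_count n a i)) * fact (d - 1) / fact (d + n - 1)) * ennreal r"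
    using r by (intro ennreal_mult) (auto intro!: prod_nonneg divide_nonneg_nonneg mult_nonneg_nonneg)
  finally have "phi_moment d n a * ennreal r / ennreal r =
      ennreal ((\<Prod>i<d. fact (mult_count n a i)) * fact (d - 1) / fact (d + n - 1)) * ennreal r / ennreal r"
    by (rule arg_cong)
  then show ?thesis using r by (subst (asm) (1 2) ennreal_mult_divide_eq) auto
qed

text \<open>For words a and b given by the digits of two basis indices, this is n! times the
  corresponding entry of the symmetric projection.\<close>

definition perm_count :: "nat \<Rightarrow> (nat \<Rightarrow> nat) \<Rightarrow> (nat \<Rightarrow> nat) \<Rightarrow> nat" where
  "perm_count n a b = card {\<pi>. \<pi> permutes {..<n} \<and> (\<forall>j<n. a j = b (\<pi> j))}"

text \<open>Every permutation of n + 1 places is uniquely a transposition of n with some q after a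
  permutation fixing n. It preserves the word exactly when place q carries the last letter and the
  inner permutation preserves the shorter word; q = n accounts for the additional 1.\<close>

lemma perm_count_Suc_refl:
  "perm_count (Suc n) a a = (mult_count n a (a n) + 1) * perm_count n a a"
proof -
  let ?S = "\<lambda>n. {\<pi>. \<pi> permutes {..<n} \<and> (\<forall>j<n. a j = a (\<pi> j))}"
  let ?Q = "{q. q < Suc n \<and> a q = a n}"
  let ?f = "\<lambda>(q, p). Transposition.transpose n q \<circ> p"
  have fix_n: "p n = n" if "p permutes {..<n}" for p using that by (auto simp: permutes_def)
  have inv: "a (Transposition.transpose n q j) = a j" if "a q = a n" for q j
    using that by (auto simp: Transposition.transpose_def)
  have "?S (Suc n) = ?f ` (?Q \<times> ?S n)"
  proof (intro equalityI subsetI)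
    fix \<pi> assume "\<pi> \<in> ?S (Suc n)"
    then have \<pi>: "\<pi> permutes insert n {..<n}" "\<forall>j<Suc n. a j = a (\<pi> j)" by (auto simp: lessThan_Suc)
    then obtain q p where qp: "\<pi> = Transposition.transpose n q \<circ> p" "q \<in> insert n {..<n}" "p permutes {..<n}"
      using permutes_insert[of n "{..<n}"] by (auto simp: set_eq_iff image_iff)
    have "a n = a (\<pi> n)" using \<pi> by simp
    then have q: "a q = a n" using fix_n[OF qp(3)] by (simp add: qp(1))
    have "a j = a (p j)" if "j < n" for j
      using \<pi>(2)[rule_format, of j] that unfolding qp(1) o_apply inv[OF q] by simp
    then show "\<pi> \<in> ?f ` (?Q \<times> ?S n)" using qp q by (intro image_eqI[of _ _ "(q, p)"]) auto
  next
    fix \<pi> assume "\<pi> \<in> ?f ` (?Q \<times> ?S n)"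
    then obtain q p where qp: "\<pi> = Transposition.transpose n q \<circ> p" "q < Suc n" "a q = a n" "p permutes {..<n}" "\<forall>j<n. a j = a (p j)"
      by auto
    have "\<pi> permutes insert n {..<n}"
      using permutes_insert[of n "{..<n}"] qp by (auto intro!: image_eqI[of _ _ "(q, p)"])
    moreover have "a j = a (\<pi> j)" if "j < Suc n" for j
      using that qp(5) fix_n[OF qp(4)] inv[OF qp(3)] by (auto simp: qp(1) less_Suc_eq)
    ultimately show "\<pi> \<in> ?S (Suc n)" by (auto simp: lessThan_Suc)
  qed
  moreover have "inj_on ?f (?Q \<times> ?S n)"
  proof (rule inj_onI, clarify)
    fix q p q' p' assume p: "p permutes {..<n}" "p' permutes {..<n}"
      and eq: "Transposition.transpose n q \<circ> p = Transposition.transpose n q' \<circ> p'"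
    have qq: "q = q'" using fun_cong[OF eq, of n] fix_n[OF p(1)] fix_n[OF p(2)] by simp
    have "Transposition.transpose n q \<circ> (Transposition.transpose n q \<circ> p) = Transposition.transpose n q \<circ> (Transposition.transpose n q \<circ> p')" using eq qq by simp
    then show "q = q' \<and> p = p'" using qq by (simp add: fun_eq_iff)
  qed
  ultimately have "card (?S (Suc n)) = card ?Q * card (?S n)"
    by (simp add: card_image card_cartesian_product)
  also have "card ?Q = mult_count n a (a n) + 1"
    using mult_count_Suc[of n a "a n"] by (simp add: mult_count_def)
  finally show ?thesis by (simp add: perm_count_def)
qed

lemma perm_count_refl:
  assumes "\<And>j. j < n \<Longrightarrow> a j < d"
  shows "perm_count n a a = (\<Prod>i<d. fact (mult_count n a i))"
  using assms
proof (induction n)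
  case 0
  then show ?case by (simp add: perm_count_def)
next
  case (Suc n)
  then show ?case
    using prod_fact_mult_count_Suc[of a n d, where 'a = nat] by (simp add: perm_count_Suc_refl)
qed

text \<open>The matching permutations form a coset of the stabilizer of b, in bijection with it by
  composition with \<sigma>.\<close>

lemma perm_count_permuted:
  assumes \<sigma>: "\<sigma> permutes {..<n}" and ab: "\<And>j. j < n \<Longrightarrow> a j = b (\<sigma> j)"
  shows "perm_count n a b = perm_count n b b"
proof -
  let ?S = "\<lambda>a. {\<pi>. \<pi> permutes {..<n} \<and> (\<forall>j<n. a j = b (\<pi> j))}"
  have lt: "\<pi> j < n" if "\<pi> permutes {..<n}" "j < n" for \<pi> j
    using permutes_in_image[OF that(1), of j] that by simp
  have "?S a = (\<lambda>\<pi>. \<pi> \<circ> \<sigma>) ` ?S b"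
  proof (intro equalityI subsetI)
    fix \<pi> assume \<pi>: "\<pi> \<in> ?S a"
    have "b k = b ((\<pi> \<circ> Hilbert_Choice.inv \<sigma>) k)" if "k < n" for k
    proof -
      have "Hilbert_Choice.inv \<sigma> k < n" using lt[OF permutes_inv[OF \<sigma>] that] .
      then have "a (Hilbert_Choice.inv \<sigma> k) = b (\<pi> (Hilbert_Choice.inv \<sigma> k))" "a (Hilbert_Choice.inv \<sigma> k) = b k"
        using \<pi> ab permutes_inverses(1)[OF \<sigma>] by auto
      then show ?thesis by simp
    qed
    then have "\<pi> \<circ> Hilbert_Choice.inv \<sigma> \<in> ?S b" using \<pi> permutes_compose[OF permutes_inv[OF \<sigma>]] by auto
    moreover have "\<pi> = (\<pi> \<circ> Hilbert_Choice.inv \<sigma>) \<circ> \<sigma>" using permutes_inverses(2)[OF \<sigma>] by (simp add: fun_eq_iff)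
    ultimately show "\<pi> \<in> (\<lambda>\<pi>. \<pi> \<circ> \<sigma>) ` ?S b" by blast
  next
    fix \<pi> assume "\<pi> \<in> (\<lambda>\<pi>. \<pi> \<circ> \<sigma>) ` ?S b"
    then show "\<pi> \<in> ?S a" using permutes_compose[OF \<sigma>] ab lt[OF \<sigma>] by auto
  qed
  moreover have "inj_on (\<lambda>\<pi>. \<pi> \<circ> \<sigma>) (?S b)"
  proof (rule inj_onI)
    fix p q assume eq: "p \<circ> \<sigma> = q \<circ> \<sigma>"
    show "p = q"
    proof
      fix x show "p x = q x" using fun_cong[OF eq, of "Hilbert_Choice.inv \<sigma> x"] permutes_inverses(1)[OF \<sigma>] by simp
    qed
  qed
  ultimately show ?thesis by (simp add: perm_count_def card_image)
qed

lemma mult_count_permuted: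
  assumes \<sigma>: "\<sigma> permutes {..<n}" and ab: "\<And>j. j < n \<Longrightarrow> a j = b (\<sigma> j)"
  shows "mult_count n a i = mult_count n b i"
proof -
  have "{j. j < n \<and> b j = i} = \<sigma> ` {j. j < n \<and> a j = i}"
  proof (intro equalityI subsetI)
    fix k assume k: "k \<in> {j. j < n \<and> b j = i}"
    then have "Hilbert_Choice.inv \<sigma> k < n" using permutes_in_image[OF permutes_inv[OF \<sigma>], of k] by simp
    moreover have "\<sigma> (Hilbert_Choice.inv \<sigma> k) = k" using permutes_inverses(1)[OF \<sigma>] .
    ultimately show "k \<in> \<sigma> ` {j. j < n \<and> a j = i}" using k ab by (intro image_eqI[of _ _ "Hilbert_Choice.inv \<sigma> k"]) auto
  qed (use permutes_in_image[OF \<sigma>] ab in auto)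
  then show ?thesis
    using card_image[OF inj_on_subset[OF permutes_inj[OF \<sigma>] subset_UNIV], of "{j. j < n \<and> a j = i}"] by (simp add: mult_count_def)
qed

lemma perm_count_eq:
  assumes a: "\<And>j. j < n \<Longrightarrow> a j < d" and b: "\<And>j. j < n \<Longrightarrow> b j < d"
  shows "perm_count n a b = (if \<forall>i<d. mult_count n a i = mult_count n b i then \<Prod>i<d. fact (mult_count n a i) else 0)"
proof (cases "\<forall>i<d. mult_count n a i = mult_count n b i")
  case True
  have "mult_count n a i = mult_count n b i" for i
  proof (cases "i < d")
    case False
    then have "{j. j < n \<and> a j = i} = {}" "{j. j < n \<and> b j = i} = {}" using a b by auto
    then show ?thesis by (simp only: mult_count_def)
  qed (use True in auto)
  moreover have "count (image_mset f (mset_set {..<n})) i = mult_count n f i" for f :: "nat \<Rightarrow> nat" and i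
    by (auto simp: count_image_mset' mult_count_def intro!: arg_cong[of _ _ card])
  \<comment> \<open>Equal occupation numbers mean equal multisets of letters, and equal multisets
    yield a permutation carrying one word to the other.\<close>
  ultimately have "image_mset a (mset_set {..<n}) = image_mset b (mset_set {..<n})" by (intro multiset_eqI) simp
  then obtain \<sigma> where "\<sigma> permutes {..<n}" "\<And>j. j < n \<Longrightarrow> a j = b (\<sigma> j)"
    using image_mset_eq_implies_permutes[OF finite_lessThan] by (metis lessThan_iff)
  then have "perm_count n a b = perm_count n b b" by (rule perm_count_permuted)
  then show ?thesis using True perm_count_refl[of n b d] b by simp
next
  case False
  then have "{\<pi>. \<pi> permutes {..<n} \<and> (\<forall>j<n. a j = b (\<pi> j))} = {}"
    using mult_count_permuted[of _ n a b] by blast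
  then show ?thesis using False by (simp only: perm_count_def if_False card.empty)
qed

lemma sym_proj_index:
  assumes "a < d ^ n" "b < d ^ n"
  shows "sym_proj d n $$ (a, b) = of_nat (perm_count n (\<lambda>j. digit d j a) (\<lambda>j. digit d j b)) / fact n"
proof -
  let ?P = "{\<pi>. \<pi> permutes {..<n}}"
  have fin: "finite ?P" by (simp add: finite_permutations)
  have "(\<Sum>\<pi>\<in>?P. perm_op d n \<pi> $$ (a, b)) = (\<Sum>\<pi>\<in>?P. if \<forall>j<n. digit d j a = digit d (\<pi> j) b then 1 else 0)"
    using assms by (intro sum.cong) (auto simp: perm_op_def)
  also have "\<dots> = of_nat (card (?P \<inter> {\<pi>. \<forall>j<n. digit d j a = digit d (\<pi> j) b}))"
    using fin by (simp add: sum.If_cases)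
  also have "?P \<inter> {\<pi>. \<forall>j<n. digit d j a = digit d (\<pi> j) b} = {\<pi>. \<pi> permutes {..<n} \<and> (\<forall>j<n. digit d j a = digit d (\<pi> j) b)}"
    by auto
  finally show ?thesis using assms by (simp add: sym_proj_def perm_count_def)
qed

lemma borel_measurable_monomial_cnj:
  assumes a: "\<And>j. j < n \<Longrightarrow> a j < d" and b: "\<And>j. j < m \<Longrightarrow> b j < d"
  shows "(\<lambda>\<phi>. (\<Prod>j<n. \<phi> (a j)) * cnj (\<Prod>j<m. \<phi> (b j))) \<in> borel_measurable (phi_measure d)"
proof -
  have 1: "(\<lambda>\<phi>. \<Prod>j<n. \<phi> (a j)) \<in> borel_measurable (phi_measure d)"
    unfolding measurable_cong_sets[OF sets_phi_measure refl] by (rule borel_measurable_monomial[OF a])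
  have 2: "(\<lambda>\<phi>. \<Prod>j<m. \<phi> (b j)) \<in> borel_measurable (phi_measure d)"
    unfolding measurable_cong_sets[OF sets_phi_measure refl] by (rule borel_measurable_monomial[OF b])
  have 3: "cnj \<in> borel_measurable borel"
    by (intro borel_measurable_continuous_onI continuous_intros)
  show ?thesis by (rule borel_measurable_times[OF 1 measurable_compose[OF 2 3]])
qed

text \<open>If the occupation numbers agree, the two monomials coincide and the integral is an
  absolute moment. Otherwise a phase on a coordinate where they differ multiplies the integrand by
  -1 while preserving the measure, so the integral equals its own negative.\<close>

lemma integral_monomial:
  assumes d: "d > 0" and a: "\<And>j. j < n \<Longrightarrow> a j < d" and b: "\<And>j. j < n \<Longrightarrow> b j < d"
  shows "(LINT \<phi>|phi_measure d. (\<Prod>j<n. \<phi> (a j)) * cnj (\<Prod>j<n. \<phi> (b j))) =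
    of_real (real (perm_count n a b) * fact (d - 1) / fact (d + n - 1))"
proof (cases "\<forall>i<d. mult_count n a i = mult_count n b i")
  case True
  have [measurable]: "(\<lambda>\<phi>. \<Prod>j<n. (cmod (\<phi> (a j)))\<^sup>2) \<in> borel_measurable (PiM {..<d} (\<lambda>_. borel :: complex measure))"
    by (rule borel_measurable_abs_monomial[OF a])
  have "(\<Prod>j<n. \<phi> (a j)) * cnj (\<Prod>j<n. \<phi> (b j)) = of_real (\<Prod>j<n. (cmod (\<phi> (a j)))\<^sup>2)" for \<phi>
  proof -
    have "(\<Prod>j<n. \<phi> (b j)) = (\<Prod>j<n. \<phi> (a j))"
      using True by (simp add: prod_eq_prod_mult_count[of n a d] prod_eq_prod_mult_count[of n b d] a b)
    then have "(\<Prod>j<n. \<phi> (a j)) * cnj (\<Prod>j<n. \<phi> (b j)) = of_real ((cmod (\<Prod>j<n. \<phi> (a j)))\<^sup>2)"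
      by (simp only: complex_norm_square)
    then show ?thesis by (simp add: prod_norm[symmetric] prod_power_distrib)
  qed
  then have "(LINT \<phi>|phi_measure d. (\<Prod>j<n. \<phi> (a j)) * cnj (\<Prod>j<n. \<phi> (b j))) =
     of_real (LINT \<phi>|phi_measure d. (\<Prod>j<n. (cmod (\<phi> (a j)))\<^sup>2))" by (simp only: integral_complex_of_real)
  also have "(LINT \<phi>|phi_measure d. (\<Prod>j<n. (cmod (\<phi> (a j)))\<^sup>2)) = enn2real (phi_moment d n a)"
    unfolding phi_moment_def by (rule integral_eq_nn_integral) (auto intro!: prod_nonneg)
  also have "\<dots> = (\<Prod>i<d. fact (mult_count n a i)) * fact (d - 1) / fact (d + n - 1)"
    by (subst phi_moment_eq[OF d])
       (auto intro!: a enn2real_ennreal prod_nonneg divide_nonneg_nonneg mult_nonneg_nonneg)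
  finally show ?thesis using True by (simp add: perm_count_eq[of n a d b] a b)
next
  case False
  then obtain m where m: "m < d" "mult_count n a m \<noteq> mult_count n b m" by auto
  let ?p = "mult_count n a m" and ?q = "mult_count n b m"
  \<comment> \<open>The angle is chosen so that the total phase picked up, (p - q) \<theta>, is pi;
    p - q may be negative but is nonzero.\<close>
  define \<theta> where "\<theta> = pi / (real ?p - real ?q)"
  define u where "u = cis \<theta>"
  have "u ^ ?p * cnj (u ^ ?q) = cis ((real ?p - real ?q) * \<theta>)"
    unfolding u_def complex_cnj_power cis_cnj Complex.DeMoivre cis_mult by (simp add: algebra_simps)
  also have "(real ?p - real ?q) * \<theta> = pi" using m by (simp add: \<theta>_def)
  finally have upq: "u ^ ?p * cnj (u ^ ?q) = -1" by simp
  let ?R = "\<lambda>x::nat \<Rightarrow> complex. \<lambda>i\<in>{..<d}. (if i = m then u else 1) * x i"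
  let ?f = "\<lambda>\<phi>. (\<Prod>j<n. \<phi> (a j)) * cnj (\<Prod>j<n. \<phi> (b j))"
  have [measurable]: "?R \<in> measurable (PiM {..<d} (\<lambda>_. borel)) (PiM {..<d} (\<lambda>_. borel))"
    by (rule measurable_componentwise) measurable
  have f: "?f \<in> borel_measurable (phi_measure d)" by (rule borel_measurable_monomial_cnj[OF a b])
  have R: "(\<Prod>j<n. ?R \<phi> (c j)) = u ^ mult_count n c m * (\<Prod>j<n. \<phi> (c j))" if c: "\<And>j. j < n \<Longrightarrow> c j < d" for c \<phi>
  proof -
    have "(\<Prod>j<n. ?R \<phi> (c j)) = (\<Prod>j<n. (if c j = m then u else 1)) * (\<Prod>j<n. \<phi> (c j))"
      unfolding prod.distrib[symmetric] using c by (intro prod.cong) auto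
    also have "(\<Prod>j<n. (if c j = m then u else 1)) = (\<Prod>i<d. (if i = m then u else 1) ^ mult_count n c i)"
      by (rule prod_eq_prod_mult_count[OF c])
    also have "\<dots> = (\<Prod>i<d. if i = m then u ^ mult_count n c m else 1)" by (intro prod.cong) auto
    also have "\<dots> = u ^ mult_count n c m" using m by simp
    finally show ?thesis .
  qed
  have fR: "?f (?R \<phi>) = (u ^ ?p * cnj (u ^ ?q)) * ?f \<phi>" for \<phi>
  proof -
    have 1: "(\<Prod>j<n. ?R \<phi> (a j)) = u ^ ?p * (\<Prod>j<n. \<phi> (a j))" by (rule R) (rule a)
    have 2: "(\<Prod>j<n. ?R \<phi> (b j)) = u ^ ?q * (\<Prod>j<n. \<phi> (b j))" by (rule R) (rule b)
    show ?thesis unfolding 1 2 complex_cnj_mult by (simp only: mult_ac)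
  qed
  have "(LINT \<phi>|phi_measure d. ?f \<phi>) = (LINT \<phi>|distr (phi_measure d) (phi_measure d) ?R. ?f \<phi>)"
    by (subst phi_measure_phase_invariant) (auto simp: u_def)
  also have "\<dots> = (LINT \<phi>|phi_measure d. ?f (?R \<phi>))"
    by (rule integral_distr[OF _ f]) measurable
  also have "\<dots> = (LINT \<phi>|phi_measure d. (u ^ ?p * cnj (u ^ ?q)) * ?f \<phi>)"
    by (simp only: fR)
  also have "\<dots> = - (LINT \<phi>|phi_measure d. ?f \<phi>)" unfolding upq by simp
  finally have "(LINT \<phi>|phi_measure d. ?f \<phi>) = 0" by simp
  then show ?thesis using False by (simp add: perm_count_eq[of n a d b] a b)
qed

lemma dplus_fact: "d > 0 \<Longrightarrow> real (dplus d n) = fact (d + n - 1) / (fact n * fact (d - 1))"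
  unfolding dplus_def by (subst binomial_fact) auto

lemma dplus_pos: "d > 0 \<Longrightarrow> dplus d n > 0"
  by (simp add: dplus_def)

text \<open>The factor (d - 1)! / (d + n - 1)! of the moments multiplied by d_n leaves 1 / n!, which
  is the averaging factor in the symmetric projection.\<close>

lemma integral_tensor_power:
  assumes d: "d > 0" and a: "a < d ^ n" and b: "b < d ^ n"
  shows "of_nat (dplus d n) * (LINT \<phi>|phi_measure d. (\<Prod>j<n. \<phi> (digit d j a)) * cnj (\<Prod>j<n. \<phi> (digit d j b))) =
    sym_proj d n $$ (a, b)"
proof -
  have dig: "digit d j c < d" for j c using d by (simp add: digit_def)
  define p where "p = real (perm_count n (\<lambda>j. digit d j a) (\<lambda>j. digit d j b))"
  have "of_nat (dplus d n) * (LINT \<phi>|phi_measure d. (\<Prod>j<n. \<phi> (digit d j a)) * cnj (\<Prod>j<n. \<phi> (digit d j b))) =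
      complex_of_real (real (dplus d n) * (p * fact (d - 1) / fact (d + n - 1)))"
    by (subst integral_monomial[OF d]) (auto simp: dig p_def)
  also have "real (dplus d n) * (p * fact (d - 1) / fact (d + n - 1)) = p / fact n"
    by (simp add: dplus_fact[OF d])
  finally show ?thesis by (simp add: sym_proj_index[OF a b] p_def)
qed

section \<open>The symmetric projection and tensor powers\<close>

lemma digit_less: "d > 0 \<Longrightarrow> digit d j a < d"
  by (simp add: digit_def)

text \<open>The index \<open>s * d ^ m + l\<close> concatenates two words: the digits below m come
  from l and the remaining ones from s. \<open>ptrace\<close> sums over l, so the factors with low
  positions are those traced out.\<close>

lemma digit_low:
  assumes "j < m"
  shows "digit d j (s * d ^ m + l) = digit d j l"
proof -
  obtain e where m: "m = Suc e + j" using assms by (metis less_iff_Suc_add add.commute add_Suc_right add_Suc)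
  have eq: "s * d ^ m + l = l + (s * d ^ e * d) * d ^ j" by (simp add: m power_add)
  show ?thesis
  proof (cases "d = 0")
    case False
    then have "d ^ j \<noteq> 0" by simp
    then have "(s * d ^ m + l) div d ^ j = s * d ^ e * d + l div d ^ j"
      unfolding eq by (rule div_mult_self1)
    then show ?thesis unfolding digit_def by simp
  qed (use assms in \<open>simp add: digit_def power_0_left\<close>)
qed

lemma digit_high:
  assumes "l < d ^ m"
  shows "digit d (m + j) (s * d ^ m + l) = digit d j s"
proof -
  have "d ^ m \<noteq> 0" using assms by linarith
  then have "(s * d ^ m + l) div d ^ m = s + l div d ^ m" by (rule div_mult_self3)
  then show ?thesis using assms by (simp add: digit_def power_add div_mult2_eq)
qed

lemma index_split_less:
  assumes "s < (p::nat)" "l < q"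
  shows "s * q + l < p * q"
proof -
  have "s * q + l < s * q + q" using assms by simp
  also have "\<dots> = Suc s * q" by simp
  also have "\<dots> \<le> p * q" using assms by (intro mult_le_mono1) simp
  finally show ?thesis .
qed

lemma index_split_div_mod:
  assumes "l < (q::nat)"
  shows "(s * q + l) div q = s" "(s * q + l) mod q = l"
  using assms by (auto simp: div_mult_self3)

lemma sum_split_index:
  fixes f :: "nat \<Rightarrow> 'a::comm_monoid_add"
  shows "(\<Sum>a<p * q. f a) = (\<Sum>s<p. \<Sum>l<q. f (s * q + l))"
proof -
  have "(\<Sum>a<p * q. f a) = (\<Sum>s<p. sum f {s * q..<s * q + q})" by (rule sum.nat_group[symmetric])
  also have "\<dots> = (\<Sum>s<p. \<Sum>l<q. f (s * q + l))"
  proof (rule sum.cong[OF refl])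
    fix s
    show "sum f {s * q..<s * q + q} = (\<Sum>l<q. f (s * q + l))"
      using sum.shift_bounds_nat_ivl[of f 0 "s * q" q] by (simp add: lessThan_atLeast0 add.commute)
  qed
  finally show ?thesis .
qed

lemma digits_inject:
  assumes "a < d ^ n" "b < d ^ n" "\<And>j. j < n \<Longrightarrow> digit d j a = digit d j b"
  shows "a = b"
  using assms
proof (induction n arbitrary: a b)
  case (Suc n)
  have d: "d > 0" using Suc.prems(1) by (cases d) auto
  let ?D = "d ^ n"
  have D: "?D > 0" using d by simp
  have dec: "c = (c div ?D) * d ^ n + c mod ?D" for c by (simp add: div_mult_mod_eq)
  have top: "c div ?D = digit d n c" if "c < d ^ Suc n" for c
    using that D by (simp add: digit_def less_mult_imp_div_less)
  have low: "digit d j (c mod ?D) = digit d j c" if "j < n" for j c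
    using digit_low[OF that, of d "c div ?D" "c mod ?D"] by (simp add: div_mult_mod_eq)
  have "a mod ?D = b mod ?D"
    by (rule Suc.IH) (use Suc.prems D low in auto)
  moreover have "a div ?D = b div ?D" using top Suc.prems by simp
  ultimately show ?case by (metis dec)
qed simp

lemma digits_exist:
  assumes "\<And>j. j < n \<Longrightarrow> f j < d"
  shows "\<exists>a<d ^ n. \<forall>j<n. digit d j a = f j"
  using assms
proof (induction n)
  case (Suc n)
  then obtain a where a: "a < d ^ n" "\<forall>j<n. digit d j a = f j" by auto
  have fn: "f n < d" using Suc.prems by simp
  have "f n * d ^ n + a < d ^ Suc n" using index_split_less[OF fn a(1)] by simp
  moreover have "digit d j (f n * d ^ n + a) = f j" if "j < Suc n" for j
  proof (cases "j = n")
    case True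
    then show ?thesis using digit_high[OF a(1), of 0 "f n"] fn by (simp add: digit_def)
  next
    case False
    then show ?thesis using that a digit_low[of j n d "f n" a] by simp
  qed
  ultimately show ?case by blast
qed auto

text \<open>For indices below \<open>d ^ n\<close> with d > 0 this says that the two words lie in
  the same orbit under permutation of the tensor factors.\<close>

definition same_type :: "nat \<Rightarrow> nat \<Rightarrow> nat \<Rightarrow> nat \<Rightarrow> bool" where
  "same_type d n a b \<longleftrightarrow> (\<forall>i<d. mult_count n (\<lambda>j. digit d j a) i = mult_count n (\<lambda>j. digit d j b) i)"

lemma sym_proj_carrier [simp]: "sym_proj d n \<in> carrier_mat (d ^ n) (d ^ n)"
  by (simp add: sym_proj_def)

lemma sym_proj_eq:
  assumes "d > 0" "a < d ^ n" "b < d ^ n"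
  shows "sym_proj d n $$ (a, b) = (if same_type d n a b then (\<Prod>i<d. fact (mult_count n (\<lambda>j. digit d j a) i)) / fact n else 0)"
  unfolding sym_proj_index[OF assms(2,3)]
  by (subst perm_count_eq[of n _ d]) (auto simp: digit_less[OF assms(1)] same_type_def)

text \<open>Each row of a permutation matrix contains a single 1, and the symmetric projection
  averages these matrices.\<close>

lemma sym_proj_row_sum:
  assumes d: "d > 0" and a: "a < d ^ n"
  shows "(\<Sum>b<d ^ n. sym_proj d n $$ (a, b)) = 1"
proof -
  let ?P = "{\<pi>. \<pi> permutes {..<n}}"
  have one: "(\<Sum>b<d ^ n. perm_op d n \<pi> $$ (a, b)) = 1" if \<pi>: "\<pi> permutes {..<n}" for \<pi>
  proof -
    have lt: "\<pi> j < n \<longleftrightarrow> j < n" for j using permutes_in_image[OF \<pi>, of j] by simp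
    have lt': "Hilbert_Choice.inv \<pi> j < n \<longleftrightarrow> j < n" for j using permutes_in_image[OF permutes_inv[OF \<pi>], of j] by simp
    obtain b where b: "b < d ^ n" "\<forall>j<n. digit d j b = digit d (Hilbert_Choice.inv \<pi> j) a"
      using digits_exist[of n "\<lambda>j. digit d (Hilbert_Choice.inv \<pi> j) a" d] digit_less[OF d] by auto
    have iff: "(\<forall>j<n. digit d j a = digit d (\<pi> j) c) \<longleftrightarrow> c = b" if "c < d ^ n" for c
    proof
      assume *: "\<forall>j<n. digit d j a = digit d (\<pi> j) c"
      show "c = b"
      proof (rule digits_inject[OF that b(1)])
        fix j assume j: "j < n"
        then show "digit d j c = digit d j b"
          using *[rule_format, of "Hilbert_Choice.inv \<pi> j"] b(2) lt' permutes_inverses(1)[OF \<pi>] by simp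
      qed
    next
      assume "c = b"
      then show "\<forall>j<n. digit d j a = digit d (\<pi> j) c"
        using b(2) lt permutes_inverses(2)[OF \<pi>] by simp
    qed
    have "(\<Sum>c<d ^ n. perm_op d n \<pi> $$ (a, c)) = (\<Sum>c<d ^ n. if c = b then 1 else 0)"
      using a iff by (intro sum.cong) (auto simp: perm_op_def)
    then show ?thesis using b by simp
  qed
  have "(\<Sum>b<d ^ n. sym_proj d n $$ (a, b)) = (\<Sum>b<d ^ n. \<Sum>\<pi>\<in>?P. perm_op d n \<pi> $$ (a, b)) / fact n"
    using a by (simp add: sym_proj_def sum_divide_distrib)
  also have "(\<Sum>b<d ^ n. \<Sum>\<pi>\<in>?P. perm_op d n \<pi> $$ (a, b)) = (\<Sum>\<pi>\<in>?P. \<Sum>b<d ^ n. perm_op d n \<pi> $$ (a, b))"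
    by (rule sum.swap)
  also have "\<dots> = fact n" using card_permutations[of "{..<n}" n] by (simp add: one)
  finally show ?thesis by simp
qed

text \<open>A row of the projection is supported on one orbit and has sum 1, so the projection fixes
  every function constant on orbits. Idempotence and the absorption of smaller symmetric projections
  are both instances of this.\<close>

lemma sym_proj_average:
  assumes d: "d > 0" and a: "a < d ^ n"
    and f: "\<And>b. b < d ^ n \<Longrightarrow> same_type d n a b \<Longrightarrow> f b = f a"
  shows "(\<Sum>b<d ^ n. sym_proj d n $$ (a, b) * f b) = f a"
proof -
  have "(\<Sum>b<d ^ n. sym_proj d n $$ (a, b) * f b) = (\<Sum>b<d ^ n. sym_proj d n $$ (a, b) * f a)"
    using f by (intro sum.cong) (auto simp: sym_proj_eq[OF d a])
  also have "\<dots> = f a" by (simp add: sum_distrib_right[symmetric] sym_proj_row_sum[OF d a])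
  finally show ?thesis .
qed

lemma sym_proj_same_type:
  assumes d: "d > 0" and "a < d ^ n" "b < d ^ n" "c < d ^ n" and "same_type d n a b"
  shows "sym_proj d n $$ (a, c) = sym_proj d n $$ (b, c)"
  using assms by (auto simp: sym_proj_eq same_type_def)

lemma sym_proj_idem:
  assumes d: "d > 0"
  shows "sym_proj d n * sym_proj d n = sym_proj d n"
proof (rule eq_matI)
  fix a c assume "a < dim_row (sym_proj d n)" "c < dim_col (sym_proj d n)"
  then have ac: "a < d ^ n" "c < d ^ n" by (auto simp: sym_proj_def)
  have "(sym_proj d n * sym_proj d n) $$ (a, c) = (\<Sum>b<d ^ n. sym_proj d n $$ (a, b) * sym_proj d n $$ (b, c))"
    by (rule index_mult_mat_sum[OF _ _ ac]) auto
  also have "\<dots> = sym_proj d n $$ (a, c)"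
    using ac by (intro sym_proj_average[OF d]) (auto intro: sym_proj_same_type[OF d, symmetric])
  finally show "(sym_proj d n * sym_proj d n) $$ (a, c) = sym_proj d n $$ (a, c)" .
qed (auto simp: sym_proj_def)

text \<open>Occupation numbers add under concatenation. Consequently a rearrangement of the m low
  letters stays within one orbit of the long word, so the symmetric projection on M factors absorbs
  the one on the m traced-out factors.\<close>

lemma same_type_append:
  assumes "l < d ^ m" "l' < d ^ m" "same_type d m l l'"
  shows "same_type d (m + k) (s * d ^ m + l) (s * d ^ m + l')"
proof -
  have "mult_count (m + k) (\<lambda>j. digit d j (s * d ^ m + l)) i =
      mult_count m (\<lambda>j. digit d j l) i + card {j. j < k \<and> digit d j s = i}" if "l < d ^ m" for l i
  proof -
    have S: "{j. j < m + k \<and> digit d j (s * d ^ m + l) = i} =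
        {j. j < m \<and> digit d j l = i} \<union> (\<lambda>j. m + j) ` {j. j < k \<and> digit d j s = i}"
    proof (intro equalityI subsetI)
      fix j assume j: "j \<in> {j. j < m + k \<and> digit d j (s * d ^ m + l) = i}"
      show "j \<in> {j. j < m \<and> digit d j l = i} \<union> (\<lambda>j. m + j) ` {j. j < k \<and> digit d j s = i}"
      proof (cases "j < m")
        case True
        then show ?thesis using j by (auto simp: digit_low)
      next
        case False
        then have "j = m + (j - m)" by simp
        moreover have "j - m < k" using False j by auto
        moreover have "digit d (j - m) s = i" using digit_high[OF that, of "j - m" s] False j by simp
        ultimately show ?thesis by blast
      qed
    qed (auto simp: digit_low digit_high[OF that])
    have c: "card ((\<lambda>j. m + j) ` {j. j < k \<and> digit d j s = i}) = card {j. j < k \<and> digit d j s = i}"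
      by (rule card_image) auto
    have "card ({j. j < m \<and> digit d j l = i} \<union> (\<lambda>j. m + j) ` {j. j < k \<and> digit d j s = i}) =
        card {j. j < m \<and> digit d j l = i} + card ((\<lambda>j. m + j) ` {j. j < k \<and> digit d j s = i})"
      by (rule card_Un_disjoint) auto
    then show ?thesis unfolding mult_count_def S c .
  qed
  then show ?thesis using assms by (simp add: same_type_def)
qed

section \<open>Tensor powers of a vector and bounded functions of it\<close>

definition tensor_power :: "nat \<Rightarrow> nat \<Rightarrow> (nat \<Rightarrow> complex) \<Rightarrow> nat \<Rightarrow> complex" where
  "tensor_power d n \<phi> a = (\<Prod>j<n. \<phi> (digit d j a))"

lemma tensor_power_split:
  assumes "l < d ^ m"
  shows "tensor_power d (m + k) \<phi> (s * d ^ m + l) = tensor_power d k \<phi> s * tensor_power d m \<phi> l"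
proof -
  have "(\<Prod>j<m + k. f j) = (\<Prod>j<m. f j) * (\<Prod>j<k. f (m + j))" for f :: "nat \<Rightarrow> complex"
    by (induction k) (auto simp: mult_ac)
  then show ?thesis
    using assms by (simp add: tensor_power_def digit_low digit_high mult.commute)
qed

lemma tensor_power_norm:
  assumes "cnorm d \<phi> = 1"
  shows "(\<Sum>a<d ^ n. tensor_power d n \<phi> a * cnj (tensor_power d n \<phi> a)) = 1"
proof (induction n)
  case 0
  then show ?case by (simp add: tensor_power_def)
next
  case (Suc n)
  have 1: "(\<Sum>i<d. \<phi> i * cnj (\<phi> i)) = 1"
    using arg_cong[OF cnorm_square[of d \<phi>], of complex_of_real] assms
    by (simp add: complex_norm_square del: of_real_power)
  have "(\<Sum>a<d ^ Suc n. tensor_power d (Suc n) \<phi> a * cnj (tensor_power d (Suc n) \<phi> a)) =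
      (\<Sum>s<d. \<Sum>l<d ^ n. tensor_power d (n + 1) \<phi> (s * d ^ n + l) * cnj (tensor_power d (n + 1) \<phi> (s * d ^ n + l)))"
    unfolding power_Suc sum_split_index by simp
  also have "\<dots> = (\<Sum>s<d. \<Sum>l<d ^ n. (\<phi> s * cnj (\<phi> s)) * (tensor_power d n \<phi> l * cnj (tensor_power d n \<phi> l)))"
  proof (intro sum.cong refl)
    fix s l assume "s \<in> {..<d}" "l \<in> {..<d ^ n}"
    then show "tensor_power d (n + 1) \<phi> (s * d ^ n + l) * cnj (tensor_power d (n + 1) \<phi> (s * d ^ n + l)) =
        (\<phi> s * cnj (\<phi> s)) * (tensor_power d n \<phi> l * cnj (tensor_power d n \<phi> l))"
      using tensor_power_split[of l d n 1 \<phi> s] by (simp add: tensor_power_def[of d "Suc 0"] digit_def mult_ac)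
  qed
  also have "\<dots> = (\<Sum>s<d. \<phi> s * cnj (\<phi> s)) * (\<Sum>l<d ^ n. tensor_power d n \<phi> l * cnj (tensor_power d n \<phi> l))"
    by (simp only: sum_product)
  finally show ?case using Suc 1 by simp
qed

text \<open>All integrands are polynomials in \<phi> and its conjugate, bounded only where \<phi>
  has norm 1. Boundedness almost everywhere is stable under the algebraic operations and gives
  integrability for a probability measure, so integrability proofs become syntactic.\<close>

definition ae_bounded :: "nat \<Rightarrow> ((nat \<Rightarrow> complex) \<Rightarrow> complex) \<Rightarrow> bool" where
  "ae_bounded d f \<longleftrightarrow> f \<in> borel_measurable (phi_measure d) \<and> (\<exists>B. AE \<phi> in phi_measure d. cmod (f \<phi>) \<le> B)"

lemma ae_bounded_const: "ae_bounded d (\<lambda>_. c)"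
  by (auto simp: ae_bounded_def)

lemma ae_bounded_add:
  assumes "ae_bounded d f" "ae_bounded d g"
  shows "ae_bounded d (\<lambda>\<phi>. f \<phi> + g \<phi>)"
proof -
  from assms obtain B C where "AE \<phi> in phi_measure d. cmod (f \<phi>) \<le> B" "AE \<phi> in phi_measure d. cmod (g \<phi>) \<le> C"
    by (auto simp: ae_bounded_def)
  then have "AE \<phi> in phi_measure d. cmod (f \<phi> + g \<phi>) \<le> B + C"
    by eventually_elim (rule norm_triangle_mono)
  then show ?thesis using assms by (auto simp: ae_bounded_def)
qed

lemma ae_bounded_mult:
  assumes "ae_bounded d f" "ae_bounded d g"
  shows "ae_bounded d (\<lambda>\<phi>. f \<phi> * g \<phi>)"
proof -
  from assms obtain B C where "AE \<phi> in phi_measure d. cmod (f \<phi>) \<le> B" "AE \<phi> in phi_measure d. cmod (g \<phi>) \<le> C"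
    by (auto simp: ae_bounded_def)
  then have "AE \<phi> in phi_measure d. cmod (f \<phi> * g \<phi>) \<le> \<bar>B\<bar> * \<bar>C\<bar>"
    by eventually_elim (auto simp: norm_mult intro!: mult_mono)
  then show ?thesis using assms by (auto simp: ae_bounded_def)
qed

lemma ae_bounded_diff:
  assumes "ae_bounded d f" "ae_bounded d g"
  shows "ae_bounded d (\<lambda>\<phi>. f \<phi> - g \<phi>)"
  using ae_bounded_add[OF assms(1) ae_bounded_mult[OF ae_bounded_const[of d "-1"] assms(2)]] by simp

lemma ae_bounded_sum:
  assumes "\<And>i. i \<in> I \<Longrightarrow> ae_bounded d (f i)"
  shows "ae_bounded d (\<lambda>\<phi>. \<Sum>i\<in>I. f i \<phi>)"
  using assms
  by (induction I rule: infinite_finite_induct) (auto intro: ae_bounded_const ae_bounded_add)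

lemma ae_bounded_cnj:
  assumes "ae_bounded d f"
  shows "ae_bounded d (\<lambda>\<phi>. cnj (f \<phi>))"
proof -
  have "cnj \<in> borel_measurable borel"
    by (intro borel_measurable_continuous_onI continuous_intros)
  then show ?thesis using assms measurable_compose[of f "phi_measure d" borel cnj borel]
    by (auto simp: ae_bounded_def)
qed

lemma ae_bounded_tensor_power:
  assumes d: "d > 0"
  shows "ae_bounded d (\<lambda>\<phi>. tensor_power d n \<phi> a)"
proof -
  have "(\<lambda>\<phi>. tensor_power d n \<phi> a) \<in> borel_measurable (phi_measure d)"
    unfolding tensor_power_def measurable_cong_sets[OF sets_phi_measure refl]
    by (rule borel_measurable_monomial) (rule digit_less[OF d])
  moreover have "AE \<phi> in phi_measure d. cmod (tensor_power d n \<phi> a) \<le> 1"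
  proof (rule eventually_mono[OF AE_phi_unit[OF d]])
    fix \<phi> assume 1: "cnorm d \<phi> = 1"
    then have le: "cmod (\<phi> i) \<le> 1" if "i < d" for i using component_le_cnorm[OF that, of \<phi>] by simp
    show "cmod (tensor_power d n \<phi> a) \<le> 1"
      unfolding tensor_power_def prod_norm[symmetric] using le digit_less[OF d] by (intro prod_le_1) auto
  qed
  ultimately show ?thesis by (auto simp: ae_bounded_def)
qed

lemma ae_bounded_integrable:
  assumes d: "d > 0" and f: "ae_bounded d f"
  shows "integrable (phi_measure d) f"
proof -
  interpret prob_space "phi_measure d" by (rule prob_space_phi_measure[OF d])
  from f obtain B where "AE \<phi> in phi_measure d. norm (f \<phi>) \<le> B" "f \<in> borel_measurable (phi_measure d)"
    by (auto simp: ae_bounded_def)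
  then show ?thesis by (rule integrable_const_bound)
qed

lemmas ae_bounded_intros = ae_bounded_const ae_bounded_add ae_bounded_mult ae_bounded_sum ae_bounded_cnj ae_bounded_tensor_power

lemma integral_complex_nonneg:
  fixes f :: "'a \<Rightarrow> complex"
  assumes "\<And>x. x \<in> space M \<Longrightarrow> 0 \<le> f x"
  shows "0 \<le> integral\<^sup>L M f"
proof -
  have "integral\<^sup>L M f = integral\<^sup>L M (\<lambda>x. complex_of_real (Re (f x)))"
    using assms by (intro Bochner_Integration.integral_cong) (auto simp: less_eq_complex_def complex_eq_iff)
  also have "\<dots> = complex_of_real (integral\<^sup>L M (\<lambda>x. Re (f x)))" by (rule integral_complex_of_real)
  finally have eq: "integral\<^sup>L M f = complex_of_real (integral\<^sup>L M (\<lambda>x. Re (f x)))" .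
  have "0 \<le> integral\<^sup>L M (\<lambda>x. Re (f x))"
    using assms by (intro Bochner_Integration.integral_nonneg) (auto simp: less_eq_complex_def)
  then show ?thesis unfolding eq by (simp add: less_eq_complex_def)
qed

section \<open>The measure-and-prepare channel\<close>

lemma psd_proj:
  assumes "v \<in> carrier_vec N"
  shows "psd (proj v)"
proof (rule psdI_qform)
  show c: "proj v \<in> carrier_mat N N" using assms by (simp add: proj_def)
  fix u
  have "qform N (proj v) u = (\<Sum>i<N. cnj (u i) * vec_index v i) * (\<Sum>j<N. cnj (vec_index v j) * u j)"
    unfolding qform_def sum_product using assms by (intro sum.cong) (auto simp: proj_def)
  also have "(\<Sum>i<N. cnj (u i) * vec_index v i) = cnj (\<Sum>j<N. cnj (vec_index v j) * u j)"
    by (simp add: mult.commute)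
  also have "\<dots> * (\<Sum>j<N. cnj (vec_index v j) * u j) = of_real ((cmod (\<Sum>j<N. cnj (vec_index v j) * u j))\<^sup>2)"
    by (simp only: complex_norm_square mult.commute)
  finally show "0 \<le> qform N (proj v) u" by (simp add: less_eq_complex_def)
qed

lemma mtrace_mult:
  assumes A: "A \<in> carrier_mat n n" and B: "B \<in> carrier_mat n n"
  shows "mtrace (A * B) = (\<Sum>i<n. \<Sum>j<n. A $$ (i, j) * B $$ (j, i))"
proof -
  have "mtrace (A * B) = (\<Sum>i<n. (A * B) $$ (i, i))" using A by (simp add: mtrace_def)
  also have "\<dots> = (\<Sum>i<n. \<Sum>j<n. A $$ (i, j) * B $$ (j, i))"
    by (intro sum.cong refl index_mult_mat_sum[OF A B]) auto
  finally show ?thesis .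
qed

lemma ampl_carrier [simp]: "ampl r n m F X \<in> carrier_mat (r * m) (r * m)"
  by (simp add: ampl_def)

lemma ampl_index:
  assumes "i < r" "j < r" "a < m" "b < m"
  shows "ampl r n m F X $$ (i * m + a, j * m + b) =
    F (mat n n (\<lambda>(p, q). X $$ (i * n + p, j * n + q))) $$ (a, b)"
  using assms index_split_less[of i r a m] index_split_less[of j r b m] by (simp add: ampl_def)

lemma qform_split:
  "qform (r * m) A u = (\<Sum>i<r. \<Sum>j<r. \<Sum>a<m. \<Sum>b<m. cnj (u (i * m + a)) * A $$ (i * m + a, j * m + b) * u (j * m + b))"
  unfolding qform_def sum_split_index by (rule sum.cong[OF refl sum.swap])

definition mat_unit :: "nat \<Rightarrow> nat \<Rightarrow> nat \<Rightarrow> complex mat" where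
  "mat_unit n p q = mat n n (\<lambda>(i, j). if i = p \<and> j = q then 1 else 0)"

lemma mat_unit_carrier [simp]: "mat_unit n p q \<in> carrier_mat n n"
  by (simp add: mat_unit_def)

text \<open>Linearity is available as additivity and homogeneity on matrices of the given size, so
  the expansion is built by adding one matrix entry at a time.\<close>

lemma linear_map_expand:
  assumes carr: "\<And>A. A \<in> carrier_mat n n \<Longrightarrow> F A \<in> carrier_mat m m"
    and add: "\<And>A B. A \<in> carrier_mat n n \<Longrightarrow> B \<in> carrier_mat n n \<Longrightarrow> F (A + B) = F A + F B"
    and smult: "\<And>c A. A \<in> carrier_mat n n \<Longrightarrow> F (c \<cdot>\<^sub>m A) = c \<cdot>\<^sub>m F A"
    and A: "A \<in> carrier_mat n n" and ab: "a < m" "b < m"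
  shows "F A $$ (a, b) = (\<Sum>p<n. \<Sum>q<n. A $$ (p, q) * F (mat_unit n p q) $$ (a, b))"
proof -
  let ?A = "\<lambda>S. mat n n (\<lambda>x. if x \<in> S then A $$ x else 0)"
  have "F (?A S) $$ (a, b) = (\<Sum>(p, q)\<in>S. A $$ (p, q) * F (mat_unit n p q) $$ (a, b))"
    if "finite S" "S \<subseteq> {..<n} \<times> {..<n}" for S
    using that
  proof (induction S rule: finite_induct)
    case empty
    \<comment> \<open>Writing the zero matrix as 0 times itself lets homogeneity deliver F 0 =
      0.\<close>
    have "?A {} = 0 \<cdot>\<^sub>m ?A {}" by (intro eq_matI) auto
    then have "F (?A {}) = 0 \<cdot>\<^sub>m F (?A {})" using smult[of "?A {}" 0] by simp
    then have "F (?A {}) $$ (a, b) = (0 \<cdot>\<^sub>m F (?A {})) $$ (a, b)" by simp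
    also have "\<dots> = 0" using carr[of "?A {}"] ab by simp
    finally show ?case by simp
  next
    case (insert x S)
    obtain p q where x: "x = (p, q)" by fastforce
    have "?A (insert x S) = A $$ (p, q) \<cdot>\<^sub>m mat_unit n p q + ?A S"
      using insert(2) by (intro eq_matI) (auto simp: x mat_unit_def)
    then have "F (?A (insert x S)) = A $$ (p, q) \<cdot>\<^sub>m F (mat_unit n p q) + F (?A S)"
      using add[of "A $$ (p, q) \<cdot>\<^sub>m mat_unit n p q" "?A S"] smult[of "mat_unit n p q"] by simp
    then show ?case
      using insert ab carr[of "mat_unit n p q"] carr[of "?A S"] by (simp add: x)
  qed
  from this[of "{..<n} \<times> {..<n}"] have "F (?A ({..<n} \<times> {..<n})) $$ (a, b) =
      (\<Sum>(p, q)\<in>{..<n} \<times> {..<n}. A $$ (p, q) * F (mat_unit n p q) $$ (a, b))" by simp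
  moreover have "?A ({..<n} \<times> {..<n}) = A" using A by (intro eq_matI) auto
  ultimately show ?thesis by (simp add: sum.cartesian_product)
qed

lemma integral_sum2:
  assumes d: "d > 0" and f: "\<And>i j. ae_bounded d (f i j)"
  shows "(LINT \<phi>|phi_measure d. (\<Sum>i\<in>I. \<Sum>j\<in>J. c i j * f i j \<phi>)) =
    (\<Sum>i\<in>I. \<Sum>j\<in>J. c i j * (LINT \<phi>|phi_measure d. f i j \<phi>))"
proof -
  have int: "integrable (phi_measure d) (\<lambda>\<phi>. c i j * f i j \<phi>)" for i j
    by (intro ae_bounded_integrable[OF d] ae_bounded_intros f)
  have "(LINT \<phi>|phi_measure d. (\<Sum>i\<in>I. \<Sum>j\<in>J. c i j * f i j \<phi>)) =
      (\<Sum>i\<in>I. LINT \<phi>|phi_measure d. (\<Sum>j\<in>J. c i j * f i j \<phi>))"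
    by (intro Bochner_Integration.integral_sum Bochner_Integration.integrable_sum int)
  also have "\<dots> = (\<Sum>i\<in>I. \<Sum>j\<in>J. LINT \<phi>|phi_measure d. c i j * f i j \<phi>)"
    by (intro sum.cong refl Bochner_Integration.integral_sum int)
  finally show ?thesis by simp
qed

lemma integral_sum4:
  assumes d: "d > 0" and f: "\<And>i j k l. ae_bounded d (f i j k l)"
  shows "(LINT \<phi>|phi_measure d. (\<Sum>i\<in>I. \<Sum>j\<in>J. \<Sum>k\<in>K. \<Sum>l\<in>L. c i j k l * f i j k l \<phi>)) =
    (\<Sum>i\<in>I. \<Sum>j\<in>J. \<Sum>k\<in>K. \<Sum>l\<in>L. c i j k l * (LINT \<phi>|phi_measure d. f i j k l \<phi>))"
proof -
  have "(LINT \<phi>|phi_measure d. (\<Sum>i\<in>I. \<Sum>j\<in>J. 1 * (\<Sum>k\<in>K. \<Sum>l\<in>L. c i j k l * f i j k l \<phi>))) =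
      (\<Sum>i\<in>I. \<Sum>j\<in>J. 1 * (LINT \<phi>|phi_measure d. (\<Sum>k\<in>K. \<Sum>l\<in>L. c i j k l * f i j k l \<phi>)))"
    by (intro integral_sum2 ae_bounded_intros d f)
  also have "\<dots> = (\<Sum>i\<in>I. \<Sum>j\<in>J. \<Sum>k\<in>K. \<Sum>l\<in>L. c i j k l * (LINT \<phi>|phi_measure d. f i j k l \<phi>))"
    unfolding mult_1 by (intro sum.cong refl integral_sum2 d f)
  finally show ?thesis by simp
qed

lemma ptrace_index:
  assumes "s < K" "t < K"
  shows "ptrace K D A $$ (s, t) = (\<Sum>l<D. A $$ (s * D + l, t * D + l))"
  using assms by (simp add: ptrace_def)

text \<open>Applied to the shifted vectors, the four summands become the reduced output of the
  measure-and-prepare channel, the two cross terms and the square term; these are integrated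
  separately.\<close>

lemma bilinear_expand:
  fixes x :: complex
  assumes "cnj x = x"
  shows "(\<Sum>a<N. \<Sum>b<N. cnj (p * f a - x * g a) * X $$ (a, b) * (q * f b - x * h b)) =
    cnj p * q * qform N X f - x * (cnj p * (\<Sum>a<N. \<Sum>b<N. cnj (f a) * X $$ (a, b) * h b))
    - x * (q * (\<Sum>a<N. \<Sum>b<N. cnj (g a) * X $$ (a, b) * f b))
    + x * x * (\<Sum>a<N. \<Sum>b<N. cnj (g a) * X $$ (a, b) * h b)"
proof -
  have "cnj (p * f a - x * g a) * X $$ (a, b) * (q * f b - x * h b) =
     cnj p * q * (cnj (f a) * X $$ (a, b) * f b) - x * (cnj p * (cnj (f a) * X $$ (a, b) * h b))
     - x * (q * (cnj (g a) * X $$ (a, b) * f b)) + x * x * (cnj (g a) * X $$ (a, b) * h b)" for a b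
    by (simp add: assms algebra_simps)
  then show ?thesis
    by (simp only: qform_def sum.distrib sum_subtractf sum_distrib_left)
qed

lemma mtrace_ptrace:
  assumes "A \<in> carrier_mat (K * D) (K * D)"
  shows "(\<Sum>s<K. ptrace K D A $$ (s, s)) = mtrace A"
proof -
  have "(\<Sum>s<K. ptrace K D A $$ (s, s)) = (\<Sum>s<K. \<Sum>l<D. A $$ (s * D + l, s * D + l))"
    by (intro sum.cong refl) (simp add: ptrace_index)
  then show ?thesis using assms by (simp add: mtrace_def sum_split_index)
qed

lemma mtrace_ampl_ptrace_proj:
  assumes \<psi>: "\<psi> \<in> carrier_vec (r * n)" "unit_vec \<psi>"
    and F: "\<And>A. A \<in> carrier_mat n n \<Longrightarrow> F A \<in> carrier_mat (K * D) (K * D)"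
    and tr: "\<And>A. A \<in> carrier_mat n n \<Longrightarrow> mtrace (F A) = mtrace A"
  shows "mtrace (ampl r n K (\<lambda>A. ptrace K D (F A)) (proj \<psi>)) = 1"
proof -
  let ?Y = "\<lambda>i. mat n n (\<lambda>(p, q). proj \<psi> $$ (i * n + p, i * n + q))"
  have "mtrace (ampl r n K (\<lambda>A. ptrace K D (F A)) (proj \<psi>)) =
      (\<Sum>i<r. \<Sum>s<K. ampl r n K (\<lambda>A. ptrace K D (F A)) (proj \<psi>) $$ (i * K + s, i * K + s))"
    unfolding mtrace_def carrier_matD(1)[OF ampl_carrier] sum_split_index ..
  also have "\<dots> = (\<Sum>i<r. \<Sum>s<K. ptrace K D (F (?Y i)) $$ (s, s))"
    by (intro sum.cong refl) (simp add: ampl_index)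
  also have "\<dots> = (\<Sum>i<r. mtrace (?Y i))"
    by (intro sum.cong refl) (simp add: mtrace_ptrace[OF F] tr)
  also have "\<dots> = (\<Sum>i<r. \<Sum>p<n. complex_of_real ((cmod (vec_index \<psi> (i * n + p)))\<^sup>2))"
  proof (intro sum.cong refl)
    fix i assume i: "i \<in> {..<r}"
    show "mtrace (?Y i) = (\<Sum>p<n. complex_of_real ((cmod (vec_index \<psi> (i * n + p)))\<^sup>2))"
      unfolding mtrace_def complex_norm_square
      using \<psi>(1) i index_split_less[of i r _ n] by (auto simp: proj_def intro!: sum.cong)
  qed
  also have "\<dots> = of_real (\<Sum>y<r * n. (cmod (vec_index \<psi> y))\<^sup>2)" by (simp add: sum_split_index)
  also have "\<dots> = 1" using \<psi> by (simp add: unit_vec_def)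
  finally show ?thesis .
qed

section \<open>Dimensions of symmetric subspaces and the elementary inequality\<close>

lemma dplus_mono: "d > 0 \<Longrightarrow> m \<le> M \<Longrightarrow> dplus d m \<le> dplus d M"
proof (erule lift_Suc_mono_le[rotated])
  fix n assume "d > 0"
  then obtain e where "d = Suc e" by (cases d) auto
  then show "dplus d n \<le> dplus d (Suc n)" by (simp add: dplus_def)
qed

lemma dplus_Suc: "d > 0 \<Longrightarrow> real (dplus (Suc d) n) = real (dplus d n) * (real (n + d) / real d)"
  using fact_reduce[of "d + n", where 'a = real] fact_reduce[of d, where 'a = real]
  by (simp add: dplus_fact field_simps)

text \<open>The ratio of dimensions is the product of (m + j) / (M + j) over j = 1, ..., d - 1, and
  each factor is at least m / M.\<close>

lemma dplus_ratio_ge: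
  assumes "d > 0" "m \<le> M" "M > 0"
  shows "(real m / real M) ^ (d - 1) \<le> real (dplus d m) / real (dplus d M)"
  using assms(1)
proof (induction d)
  case (Suc d)
  show ?case
  proof (cases "d = 0")
    case True
    then show ?thesis by (simp add: dplus_def)
  next
    case False
    then have "(real m / real M) ^ (Suc d - 1) = (real m / real M) ^ (d - 1) * (real m / real M)"
      by (cases d) (auto simp: mult.commute)
    also have "\<dots> \<le> (real (dplus d m) / real (dplus d M)) * (real (m + d) / real (M + d))"
    proof (rule mult_mono)
      show "real m / real M \<le> real (m + d) / real (M + d)"
        using assms False by (simp add: field_simps)
    qed (use Suc False in auto)
    also have "\<dots> = real (dplus (Suc d) m) / real (dplus (Suc d) M)"
      using False by (simp add: dplus_Suc)
    finally show ?thesis .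
  qed
qed simp

text \<open>As a function of s^2 the left side is linear with slope (p + 1) / 2. The tangent slope p
  / 2 of the right side at 1 would fail for p = 1, where the square root lies below its tangent.
  With p = d - 1 and 1 - s^2 = k / M the slope is d / 2, the one that produces 2 k d / M.\<close>

lemma power_ge_linear:
  fixes s :: real
  assumes "0 \<le> s" "s \<le> 1" "p \<ge> 1"
  shows "1 - (1 - s\<^sup>2) * (real p + 1) / 2 \<le> s ^ p"
  using assms(3)
proof (induction p rule: dec_induct)
  case base
  show ?case using mult_left_le_one_le[of s s] assms by (simp add: power2_eq_square diff_divide_distrib)
next
  case (step p)
  \<comment> \<open>The induction gap factors into nonnegative terms; p \<ge> 1 takes care of the
    one containing \<open>real p - 1\<close>.\<close>
  have "s * (1 - (1 - s\<^sup>2) * (real p + 1) / 2) - (1 - (1 - s\<^sup>2) * (real (Suc p) + 1) / 2) =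
      (1 - s) * (((1 - s) * (1 + 2 * s) + (1 + s) * ((real p - 1) * (1 - s))) / 2)"
    by (simp add: power2_eq_square field_simps)
  also have "\<dots> \<ge> 0"
    using assms step(1) by (intro mult_nonneg_nonneg divide_nonneg_nonneg add_nonneg_nonneg) auto
  finally have "1 - (1 - s\<^sup>2) * (real (Suc p) + 1) / 2 \<le> s * (1 - (1 - s\<^sup>2) * (real p + 1) / 2)" by simp
  also have "\<dots> \<le> s * s ^ p" using assms step by (intro mult_left_mono) auto
  finally show ?case by simp
qed

text \<open>The root of the dimension ratio is at least the (d - 1)-st power of the root of t = 1 -
  k / M, to which the linear bound applies.\<close>

lemma dplus_ratio_bound:
  assumes "d \<ge> 2" "k \<le> M" "M > 0"
  shows "4 * (1 - sqrt (real (dplus d (M - k)) / real (dplus d M))) \<le> 2 * real k * real d / real M"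
proof -
  define t where "t = real (M - k) / real M"
  have t: "0 \<le> t" "t \<le> 1" "1 - t = real k / real M" using assms by (auto simp: t_def field_simps of_nat_diff)
  have "1 - (1 - (sqrt t)\<^sup>2) * (real (d - 1) + 1) / 2 \<le> sqrt t ^ (d - 1)"
    using t assms by (intro power_ge_linear) auto
  also have "\<dots> = sqrt (t ^ (d - 1))" by (simp add: real_sqrt_power)
  also have "\<dots> \<le> sqrt (real (dplus d (M - k)) / real (dplus d M))"
    unfolding t_def using assms dplus_ratio_ge[of d "M - k" M] by simp
  finally have "1 - (1 - t) * real d / 2 \<le> sqrt (real (dplus d (M - k)) / real (dplus d M))"
    using t assms by (simp add: of_nat_diff)
  then have "4 * (1 - sqrt (real (dplus d (M - k)) / real (dplus d M))) \<le> 4 * ((1 - t) * real d / 2)"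
    by (intro mult_left_mono) auto
  also have "\<dots> = 2 * real k * real d / real M" unfolding t(3) by simp
  finally show ?thesis .
qed

section \<open>The POVM and the measure-and-prepare channel of a symmetric broadcast channel\<close>

locale symmetric_broadcast =
  fixes d M n :: nat and E :: "complex mat \<Rightarrow> complex mat"
  assumes d: "d > 0" and broadcast: "sym_broadcast d M n E"
begin

lemma channel: "is_channel n (d ^ M) E"
  using broadcast by (simp add: sym_broadcast_def)

lemma E_carrier: "A \<in> carrier_mat n n \<Longrightarrow> E A \<in> carrier_mat (d ^ M) (d ^ M)"
  using channel by (simp add: is_channel_def)

lemma E_add: "A \<in> carrier_mat n n \<Longrightarrow> B \<in> carrier_mat n n \<Longrightarrow> E (A + B) = E A + E B"
  using channel by (simp add: is_channel_def)

lemma E_smult: "A \<in> carrier_mat n n \<Longrightarrow> E (c \<cdot>\<^sub>m A) = c \<cdot>\<^sub>m E A"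
  using channel by (simp add: is_channel_def)

lemma E_trace: "A \<in> carrier_mat n n \<Longrightarrow> mtrace (E A) = mtrace A"
  using channel by (simp add: is_channel_def)

lemma E_cp: "X \<in> carrier_mat (r * n) (r * n) \<Longrightarrow> psd X \<Longrightarrow> psd (ampl r n (d ^ M) E X)"
  using channel by (simp add: is_channel_def)

text \<open>Idempotence of the projection splits the sandwich identity into one-sided ones. These
  make sense for values of E at arbitrary matrices, in particular at matrix units, where no adjoint
  symmetry is available.\<close>

lemma E_sym:
  assumes A: "A \<in> carrier_mat n n"
  shows "sym_proj d M * E A = E A" "E A * sym_proj d M = E A"
proof -
  let ?P = "sym_proj d M"
  note assoc = assoc_mult_mat[of _ "d ^ M" "d ^ M" _ "d ^ M" _ "d ^ M"]
  have "?P * E A * ?P = E A" using broadcast A unfolding sym_broadcast_def by blast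
  then have eq: "?P * (E A * ?P) = E A"
    unfolding assoc_mult_mat[OF sym_proj_carrier E_carrier[OF A] sym_proj_carrier] .
  have "?P * (?P * (E A * ?P)) = (?P * ?P) * (E A * ?P)"
    using E_carrier[OF A] by (simp add: assoc)
  then show "?P * E A = E A" by (simp add: sym_proj_idem[OF d] eq)
  have "(?P * (E A * ?P)) * ?P = ?P * (E A * (?P * ?P))"
    using E_carrier[OF A] by (simp add: assoc)
  then show "E A * ?P = E A" by (simp add: sym_proj_idem[OF d] eq)
qed

lemma E_positive:
  assumes A: "A \<in> carrier_mat n n" and "psd A"
  shows "psd (E A)"
proof -
  have "ampl 1 n (d ^ M) E A = E (mat n n (\<lambda>(p, q). A $$ (p, q)))"
    by (rule eq_matI) (use E_carrier[of "mat n n (\<lambda>(p, q). A $$ (p, q))"] in \<open>auto simp: ampl_def\<close>)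
  also have "mat n n (\<lambda>(p, q). A $$ (p, q)) = A" using A by (intro eq_matI) auto
  finally show ?thesis using E_cp[of A 1] assms by simp
qed

lemma qform_E_expand:
  assumes A: "A \<in> carrier_mat n n"
  shows "qform (d ^ M) (E A) v = (\<Sum>p<n. \<Sum>q<n. A $$ (p, q) * qform (d ^ M) (E (mat_unit n p q)) v)"
proof -
  let ?N = "d ^ M"
  have "qform ?N (E A) v = (\<Sum>a<?N. \<Sum>b<?N. \<Sum>p<n. \<Sum>q<n. A $$ (p, q) * (cnj (v a) * E (mat_unit n p q) $$ (a, b) * v b))"
    unfolding qform_def
    by (intro sum.cong refl, subst linear_map_expand[OF E_carrier E_add E_smult A])
       (auto simp: sum_distrib_left sum_distrib_right mult_ac)
  also have "\<dots> = (\<Sum>a<?N. \<Sum>p<n. \<Sum>b<?N. \<Sum>q<n. A $$ (p, q) * (cnj (v a) * E (mat_unit n p q) $$ (a, b) * v b))"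
    by (rule sum.cong[OF refl sum.swap])
  also have "\<dots> = (\<Sum>p<n. \<Sum>a<?N. \<Sum>b<?N. \<Sum>q<n. A $$ (p, q) * (cnj (v a) * E (mat_unit n p q) $$ (a, b) * v b))"
    by (rule sum.swap)
  also have "\<dots> = (\<Sum>p<n. \<Sum>a<?N. \<Sum>q<n. \<Sum>b<?N. A $$ (p, q) * (cnj (v a) * E (mat_unit n p q) $$ (a, b) * v b))"
    by (rule sum.cong[OF refl sum.cong[OF refl sum.swap]])
  also have "\<dots> = (\<Sum>p<n. \<Sum>q<n. \<Sum>a<?N. \<Sum>b<?N. A $$ (p, q) * (cnj (v a) * E (mat_unit n p q) $$ (a, b) * v b))"
    by (rule sum.cong[OF refl sum.swap])
  finally show ?thesis by (simp add: qform_def sum_distrib_left)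
qed

text \<open>The density is \<open>d\<^sub>M E\<^sup>\<dagger>(\<phi>\<^sup>\<otimes>\<^sup>M)\<close> with \<open>d\<^sub>M\<close> the dimension of the symmetric subspace; the adjoint
  \<open>E\<^sup>\<dagger>\<close> is spelled out on matrix units.\<close>

definition povm :: "(nat \<Rightarrow> complex) \<Rightarrow> complex mat" where
  "povm \<phi> = mat n n (\<lambda>(i, j). of_nat (dplus d M) * qform (d ^ M) (E (mat_unit n j i)) (tensor_power d M \<phi>))"

lemma povm_carrier [simp]: "povm \<phi> \<in> carrier_mat n n"
  by (simp add: povm_def)

text \<open>This is the defining relation of the adjoint channel under the trace pairing; the
  swapped indices of the matrix unit in \<open>povm\<close> come from it.\<close>

lemma mtrace_povm:
  assumes A: "A \<in> carrier_mat n n"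
  shows "mtrace (povm \<phi> * A) = of_nat (dplus d M) * qform (d ^ M) (E A) (tensor_power d M \<phi>)"
proof -
  have "mtrace (povm \<phi> * A) = (\<Sum>i<n. \<Sum>j<n. povm \<phi> $$ (i, j) * A $$ (j, i))"
    by (rule mtrace_mult[OF povm_carrier A])
  also have "\<dots> = (\<Sum>i<n. \<Sum>j<n. of_nat (dplus d M) * (A $$ (j, i) * qform (d ^ M) (E (mat_unit n j i)) (tensor_power d M \<phi>)))"
    by (intro sum.cong) (auto simp: povm_def)
  also have "\<dots> = of_nat (dplus d M) * (\<Sum>j<n. \<Sum>i<n. A $$ (j, i) * qform (d ^ M) (E (mat_unit n j i)) (tensor_power d M \<phi>))"
    by (subst sum.swap) (simp add: sum_distrib_left)
  finally show ?thesis by (simp add: qform_E_expand[OF A])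
qed

text \<open>The form of the density at w is its trace pairing with the rank-one matrix of w, and E
  maps that matrix to a positive one.\<close>

lemma psd_povm: "psd (povm \<phi>)"
proof (rule psdI_qform[OF povm_carrier])
  fix w
  define P where "P = proj (vec n w)"
  have P: "P \<in> carrier_mat n n" by (simp add: P_def proj_def)
  have "qform n (povm \<phi>) w = mtrace (povm \<phi> * P)"
    unfolding qform_def mtrace_mult[OF povm_carrier P]
    by (intro sum.cong) (auto simp: P_def proj_def)
  also have "\<dots> = of_nat (dplus d M) * qform (d ^ M) (E P) (tensor_power d M \<phi>)" by (rule mtrace_povm[OF P])
  finally show "0 \<le> qform n (povm \<phi>) w"
    using psd_qform_nonneg[OF E_carrier[OF P] E_positive[OF P], of "tensor_power d M \<phi>"]
    by (auto simp: P_def psd_proj[of _ n] less_eq_complex_def)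
qed

lemma ae_bounded_qform: "ae_bounded d (\<lambda>\<phi>. qform N A (tensor_power d m \<phi>))"
  unfolding qform_def by (intro ae_bounded_intros d)

lemma integral_moment:
  assumes "a < d ^ m" "b < d ^ m"
  shows "of_nat (dplus d m) * (LINT \<phi>|phi_measure d. tensor_power d m \<phi> a * cnj (tensor_power d m \<phi> b)) = sym_proj d m $$ (a, b)"
  using integral_tensor_power[OF d assms] by (simp add: tensor_power_def)

text \<open>The moments of order M assemble into the symmetric projection, which X absorbs on the
  right. With E preserving traces, this gives both the normalization of the POVM and trace
  preservation of the measure-and-prepare map.\<close>

lemma integral_qform:
  assumes X: "X \<in> carrier_mat (d ^ M) (d ^ M)" "X * sym_proj d M = X"
  shows "(LINT \<phi>|phi_measure d. of_nat (dplus d M) * qform (d ^ M) X (tensor_power d M \<phi>)) = mtrace X"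
proof -
  let ?N = "d ^ M" and ?t = "tensor_power d M"
  have "(LINT \<phi>|phi_measure d. of_nat (dplus d M) * qform ?N X (?t \<phi>)) =
      (LINT \<phi>|phi_measure d. (\<Sum>a<?N. \<Sum>b<?N. (X $$ (a, b) * of_nat (dplus d M)) * (?t \<phi> b * cnj (?t \<phi> a))))"
    unfolding qform_def by (simp add: sum_distrib_left mult_ac)
  also have "\<dots> = (\<Sum>a<?N. \<Sum>b<?N. (X $$ (a, b) * of_nat (dplus d M)) * (LINT \<phi>|phi_measure d. ?t \<phi> b * cnj (?t \<phi> a)))"
    by (intro integral_sum2 ae_bounded_intros d)
  also have "\<dots> = (\<Sum>a<?N. \<Sum>b<?N. X $$ (a, b) * sym_proj d M $$ (b, a))"
    by (intro sum.cong refl) (simp only: integral_moment lessThan_iff mult.assoc)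
  also have "\<dots> = (\<Sum>a<?N. (X * sym_proj d M) $$ (a, a))"
    by (intro sum.cong refl) (subst index_mult_mat_sum[OF X(1) sym_proj_carrier], auto)
  finally show ?thesis using X by (simp add: mtrace_def)
qed

lemma is_povm_density_povm: "is_povm_density d n povm"
proof -
  have "mat n n (\<lambda>(i, j). LINT \<phi>|phi_measure d. povm \<phi> $$ (i, j)) = 1\<^sub>m n"
  proof (rule eq_matI)
    fix i j assume "i < dim_row (1\<^sub>m n :: complex mat)" "j < dim_col (1\<^sub>m n :: complex mat)"
    then have ij: "i < n" "j < n" by auto
    have "(LINT \<phi>|phi_measure d. povm \<phi> $$ (i, j)) =
       (LINT \<phi>|phi_measure d. of_nat (dplus d M) * qform (d ^ M) (E (mat_unit n j i)) (tensor_power d M \<phi>))"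
      using ij by (simp add: povm_def)
    also have "\<dots> = mtrace (E (mat_unit n j i))"
      by (rule integral_qform) (simp_all add: E_carrier E_sym)
    also have "\<dots> = mtrace (mat_unit n j i)" by (simp add: E_trace)
    also have "\<dots> = (\<Sum>k<n. if k = i then (if i = j then 1 else 0) else 0)"
      unfolding mtrace_def by (intro sum.cong) (auto simp: mat_unit_def)
    also have "\<dots> = (if i = j then 1 else 0)" using ij by simp
    finally show "mat n n (\<lambda>(i, j). LINT \<phi>|phi_measure d. povm \<phi> $$ (i, j)) $$ (i, j) = 1\<^sub>m n $$ (i, j)"
      using ij by simp
  qed auto
  moreover have "integrable (phi_measure d) (\<lambda>\<phi>. povm \<phi> $$ (i, j))" if "i < n" "j < n" for i j
    using that unfolding povm_def
    by (auto intro!: ae_bounded_integrable[OF d] ae_bounded_intros d ae_bounded_qform)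
  ultimately show ?thesis by (simp add: is_povm_density_def psd_povm)
qed

lemma meas_prep_carrier [simp]: "meas_prep d M Q A \<in> carrier_mat (d ^ M) (d ^ M)"
  by (simp add: meas_prep_def)

lemma meas_prep_povm_index:
  assumes "A \<in> carrier_mat n n" "a < d ^ M" "b < d ^ M"
  shows "meas_prep d M povm A $$ (a, b) = (LINT \<phi>|phi_measure d.
    of_nat (dplus d M) * qform (d ^ M) (E A) (tensor_power d M \<phi>) * (tensor_power d M \<phi> a * cnj (tensor_power d M \<phi> b)))"
  using assms by (simp add: meas_prep_def mtrace_povm tensor_pow_proj_def tensor_power_def)

lemma mtrace_meas_prep:
  assumes A: "A \<in> carrier_mat n n"
  shows "mtrace (meas_prep d M povm A) = mtrace A"
proof -
  let ?N = "d ^ M" and ?t = "tensor_power d M"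
  let ?g = "\<lambda>\<phi>. of_nat (dplus d M) * qform ?N (E A) (?t \<phi>)"
  have "mtrace (meas_prep d M povm A) = (\<Sum>a<?N. LINT \<phi>|phi_measure d. ?g \<phi> * (?t \<phi> a * cnj (?t \<phi> a)))"
    unfolding mtrace_def by (intro sum.cong) (auto simp: meas_prep_povm_index[OF A], simp add: meas_prep_def)
  also have "\<dots> = (LINT \<phi>|phi_measure d. (\<Sum>a<?N. ?g \<phi> * (?t \<phi> a * cnj (?t \<phi> a))))"
    by (rule Bochner_Integration.integral_sum[symmetric])
       (intro ae_bounded_integrable[OF d] ae_bounded_intros d ae_bounded_qform)
  also have "\<dots> = (LINT \<phi>|phi_measure d. ?g \<phi>)"
  proof (rule integral_cong_AE)
    show "AE \<phi> in phi_measure d. (\<Sum>a<?N. ?g \<phi> * (?t \<phi> a * cnj (?t \<phi> a))) = ?g \<phi>"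
    proof (rule eventually_mono[OF AE_phi_unit[OF d]])
      fix \<phi> assume "cnorm d \<phi> = 1"
      from tensor_power_norm[OF this, of M]
      show "(\<Sum>a<?N. ?g \<phi> * (?t \<phi> a * cnj (?t \<phi> a))) = ?g \<phi>"
        unfolding sum_distrib_left[symmetric] by simp
    qed
  qed (intro borel_measurable_integrable ae_bounded_integrable[OF d] ae_bounded_intros d ae_bounded_qform)+
  also have "\<dots> = mtrace (E A)" by (rule integral_qform[OF E_carrier[OF A] E_sym(2)[OF A]])
  finally show ?thesis by (simp add: E_trace[OF A])
qed

lemma meas_prep_add:
  assumes A: "A \<in> carrier_mat n n" and B: "B \<in> carrier_mat n n"
  shows "meas_prep d M povm (A + B) = meas_prep d M povm A + meas_prep d M povm B"
proof (rule eq_matI)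
  let ?t = "tensor_power d M"
  fix a b assume "a < dim_row (meas_prep d M povm A + meas_prep d M povm B)" "b < dim_col (meas_prep d M povm A + meas_prep d M povm B)"
  then have ab: "a < d ^ M" "b < d ^ M" by (auto simp: meas_prep_def)
  have int: "integrable (phi_measure d) (\<lambda>\<phi>. of_nat (dplus d M) * qform (d ^ M) (E A) (?t \<phi>) * (?t \<phi> a * cnj (?t \<phi> b)))" for A
    by (intro ae_bounded_integrable[OF d] ae_bounded_intros d ae_bounded_qform)
  have AB: "A + B \<in> carrier_mat n n" using A B by simp
  have "meas_prep d M povm (A + B) $$ (a, b) = meas_prep d M povm A $$ (a, b) + meas_prep d M povm B $$ (a, b)"
    unfolding meas_prep_povm_index[OF A ab] meas_prep_povm_index[OF B ab] meas_prep_povm_index[OF AB ab]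
      E_add[OF A B] qform_add[OF E_carrier[OF A] E_carrier[OF B]]
    by (subst Bochner_Integration.integral_add[OF int int, symmetric]) (simp add: algebra_simps)
  then show "meas_prep d M povm (A + B) $$ (a, b) = (meas_prep d M povm A + meas_prep d M povm B) $$ (a, b)"
    using ab by (simp add: meas_prep_def)
qed (auto simp: meas_prep_def)

lemma meas_prep_smult:
  assumes A: "A \<in> carrier_mat n n"
  shows "meas_prep d M povm (c \<cdot>\<^sub>m A) = c \<cdot>\<^sub>m meas_prep d M povm A"
proof (rule eq_matI)
  fix a b assume "a < dim_row (c \<cdot>\<^sub>m meas_prep d M povm A)" "b < dim_col (c \<cdot>\<^sub>m meas_prep d M povm A)"
  then have ab: "a < d ^ M" "b < d ^ M" by (auto simp: meas_prep_def)
  have cA: "c \<cdot>\<^sub>m A \<in> carrier_mat n n" using A by simp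
  have "meas_prep d M povm (c \<cdot>\<^sub>m A) $$ (a, b) = c * meas_prep d M povm A $$ (a, b)"
    unfolding meas_prep_povm_index[OF A ab] meas_prep_povm_index[OF cA ab] E_smult[OF A] qform_smult[OF E_carrier[OF A]]
    by (subst Bochner_Integration.integral_mult_right_zero[symmetric]) (simp add: mult_ac)
  then show "meas_prep d M povm (c \<cdot>\<^sub>m A) $$ (a, b) = (c \<cdot>\<^sub>m meas_prep d M povm A) $$ (a, b)"
    using ab by (simp add: meas_prep_def)
qed (auto simp: meas_prep_def)

text \<open>Contracting the i-th part of u with the M-th tensor power of \<phi> gives a number e_i.
  The form of the output at u is then an average over \<phi> of the form of the amplified output of
  E at e tensored with that power, so complete positivity passes from E to the new map.\<close>

lemma meas_prep_cp:
  assumes X: "X \<in> carrier_mat (r * n) (r * n)" and psd: "psd X"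
  shows "psd (ampl r n (d ^ M) (meas_prep d M povm) X)"
proof (rule psdI_qform[OF ampl_carrier])
  fix u
  let ?N = "d ^ M" and ?t = "tensor_power d M" and ?c = "of_nat (dplus d M) :: complex"
  define Y where "Y i j = mat n n (\<lambda>(p, q). X $$ (i * n + p, j * n + q))" for i j
  have Y: "Y i j \<in> carrier_mat n n" for i j by (simp add: Y_def)
  define e where "e \<phi> i = (\<Sum>a<?N. cnj (?t \<phi> a) * u (i * ?N + a))" for \<phi> i
  define W where "W \<phi> y = e \<phi> (y div ?N) * ?t \<phi> (y mod ?N)" for \<phi> y
  have "qform (r * ?N) (ampl r n ?N (meas_prep d M povm) X) u =
     (\<Sum>i<r. \<Sum>j<r. \<Sum>a<?N. \<Sum>b<?N. (cnj (u (i * ?N + a)) * u (j * ?N + b)) *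
       (LINT \<phi>|phi_measure d. ?c * qform ?N (E (Y i j)) (?t \<phi>) * (?t \<phi> a * cnj (?t \<phi> b))))"
    unfolding qform_split
    by (intro sum.cong refl) (simp add: ampl_index Y_def[symmetric] meas_prep_povm_index[OF Y] mult_ac)
  also have "\<dots> = (LINT \<phi>|phi_measure d. (\<Sum>i<r. \<Sum>j<r. \<Sum>a<?N. \<Sum>b<?N. (cnj (u (i * ?N + a)) * u (j * ?N + b)) *
       (?c * qform ?N (E (Y i j)) (?t \<phi>) * (?t \<phi> a * cnj (?t \<phi> b)))))"
    by (rule integral_sum4[symmetric]) (intro ae_bounded_intros d ae_bounded_qform)+
  also have "\<dots> = (LINT \<phi>|phi_measure d. ?c * qform (r * ?N) (ampl r n ?N E X) (W \<phi>))"
  proof (rule Bochner_Integration.integral_cong[OF refl])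
    fix \<phi>
    have "(\<Sum>a<?N. \<Sum>b<?N. (cnj (u (i * ?N + a)) * u (j * ?N + b)) *
       (?c * qform ?N (E (Y i j)) (?t \<phi>) * (?t \<phi> a * cnj (?t \<phi> b)))) =
       ?c * (cnj (e \<phi> i) * e \<phi> j * qform ?N (E (Y i j)) (?t \<phi>))" for i j
    proof -
      have "cnj (e \<phi> i) * e \<phi> j = (\<Sum>a<?N. \<Sum>b<?N. (cnj (u (i * ?N + a)) * u (j * ?N + b)) * (?t \<phi> a * cnj (?t \<phi> b)))"
        unfolding e_def cnj_sum sum_product by (simp add: mult_ac)
      then show ?thesis by (simp add: sum_distrib_left sum_distrib_right mult_ac)
    qed
    moreover have "qform (r * ?N) (ampl r n ?N E X) (W \<phi>) = (\<Sum>i<r. \<Sum>j<r. cnj (e \<phi> i) * e \<phi> j * qform ?N (E (Y i j)) (?t \<phi>))"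
      unfolding qform_split qform_def[of ?N] sum_distrib_left
      by (intro sum.cong refl) (simp add: ampl_index Y_def[symmetric] W_def index_split_div_mod mult_ac)
    ultimately show "(\<Sum>i<r. \<Sum>j<r. \<Sum>a<?N. \<Sum>b<?N. (cnj (u (i * ?N + a)) * u (j * ?N + b)) *
       (?c * qform ?N (E (Y i j)) (?t \<phi>) * (?t \<phi> a * cnj (?t \<phi> b)))) = ?c * qform (r * ?N) (ampl r n ?N E X) (W \<phi>)"
      by (simp add: sum_distrib_left)
  qed
  finally have eq: "qform (r * ?N) (ampl r n ?N (meas_prep d M povm) X) u =
    (LINT \<phi>|phi_measure d. ?c * qform (r * ?N) (ampl r n ?N E X) (W \<phi>))" .
  show "0 \<le> qform (r * ?N) (ampl r n ?N (meas_prep d M povm) X) u"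
    unfolding eq
  proof (rule integral_complex_nonneg)
    fix \<phi>
    show "0 \<le> ?c * qform (r * ?N) (ampl r n ?N E X) (W \<phi>)"
      using psd_qform_nonneg[OF ampl_carrier E_cp[OF X psd], of "W \<phi>"] by (simp add: less_eq_complex_def)
  qed
qed

lemma is_channel_meas_prep: "is_channel n (d ^ M) (meas_prep d M povm)"
  unfolding is_channel_def
  by (auto simp: meas_prep_add meas_prep_smult mtrace_meas_prep meas_prep_cp)

section \<open>Reduced outputs on k copies, with m copies traced out\<close>

context
  fixes m k :: nat
  assumes M: "M = m + k"
begin

lemma dim_split: "d ^ M = d ^ k * d ^ m"
  by (simp add: M power_add)

lemma tensor_power_M:
  "l < d ^ m \<Longrightarrow> tensor_power d M \<phi> (s * d ^ m + l) = tensor_power d k \<phi> s * tensor_power d m \<phi> l"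
  unfolding M by (rule tensor_power_split)

lemma index_less: "s < d ^ k \<Longrightarrow> l < d ^ m \<Longrightarrow> s * d ^ m + l < d ^ M"
  unfolding dim_split by (rule index_split_less)

definition ratio :: real where
  "ratio = real (dplus d m) / real (dplus d M)"

text \<open>The m traced-out copies contribute the factor \<parallel>\<phi>\<parallel>^(2 m), which
  is 1 almost everywhere.\<close>

lemma ptrace_meas_prep:
  assumes A: "A \<in> carrier_mat n n" and st: "s < d ^ k" "t < d ^ k"
  shows "ptrace (d ^ k) (d ^ m) (meas_prep d M povm A) $$ (s, t) = (LINT \<phi>|phi_measure d.
    of_nat (dplus d M) * qform (d ^ M) (E A) (tensor_power d M \<phi>) * (tensor_power d k \<phi> s * cnj (tensor_power d k \<phi> t)))"
proof -
  let ?g = "\<lambda>\<phi>. of_nat (dplus d M) * qform (d ^ M) (E A) (tensor_power d M \<phi>)"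
  let ?h = "\<lambda>\<phi>. tensor_power d k \<phi> s * cnj (tensor_power d k \<phi> t)"
  have "ptrace (d ^ k) (d ^ m) (meas_prep d M povm A) $$ (s, t) =
     (\<Sum>l<d ^ m. LINT \<phi>|phi_measure d. ?g \<phi> * ?h \<phi> * (tensor_power d m \<phi> l * cnj (tensor_power d m \<phi> l)))"
    unfolding ptrace_index[OF st]
    by (intro sum.cong refl)
       (auto simp: meas_prep_povm_index[OF A] index_less st tensor_power_M mult_ac intro!: Bochner_Integration.integral_cong)
  also have "\<dots> = (LINT \<phi>|phi_measure d. (\<Sum>l<d ^ m. ?g \<phi> * ?h \<phi> * (tensor_power d m \<phi> l * cnj (tensor_power d m \<phi> l))))"
    by (rule Bochner_Integration.integral_sum[symmetric])
       (intro ae_bounded_integrable[OF d] ae_bounded_intros d ae_bounded_qform)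
  also have "\<dots> = (LINT \<phi>|phi_measure d. ?g \<phi> * ?h \<phi>)"
  proof (rule integral_cong_AE)
    show "AE \<phi> in phi_measure d. (\<Sum>l<d ^ m. ?g \<phi> * ?h \<phi> * (tensor_power d m \<phi> l * cnj (tensor_power d m \<phi> l))) = ?g \<phi> * ?h \<phi>"
    proof (rule eventually_mono[OF AE_phi_unit[OF d]])
      fix \<phi> assume "cnorm d \<phi> = 1"
      from tensor_power_norm[OF this, of m]
      show "(\<Sum>l<d ^ m. ?g \<phi> * ?h \<phi> * (tensor_power d m \<phi> l * cnj (tensor_power d m \<phi> l))) = ?g \<phi> * ?h \<phi>"
        unfolding sum_distrib_left[symmetric] by simp
    qed
  qed (intro borel_measurable_integrable ae_bounded_integrable[OF d] ae_bounded_intros d ae_bounded_qform)+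
  finally show ?thesis .
qed

text \<open>The vector \<open>(|\<phi>\<rangle>\<langle>\<phi>|\<^sup>\<otimes>\<^sup>k - x) u \<otimes> \<phi>\<^sup>\<otimes>\<^sup>m\<close> with \<open>x\<close> the ratio of the dimensions; this choice of
  \<open>x\<close> makes the cross terms below collapse to a single multiple of the reduced output.\<close>

definition overlap :: "(nat \<Rightarrow> complex) \<Rightarrow> (nat \<Rightarrow> complex) \<Rightarrow> complex" where
  "overlap \<phi> u = (\<Sum>s<d ^ k. cnj (tensor_power d k \<phi> s) * u s)"

definition lifted :: "(nat \<Rightarrow> complex) \<Rightarrow> (nat \<Rightarrow> complex) \<Rightarrow> nat \<Rightarrow> complex" where
  "lifted \<phi> u a = u (a div d ^ m) * tensor_power d m \<phi> (a mod d ^ m)"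

definition shifted :: "(nat \<Rightarrow> complex) \<Rightarrow> (nat \<Rightarrow> complex) \<Rightarrow> nat \<Rightarrow> complex" where
  "shifted \<phi> u a = overlap \<phi> u * tensor_power d M \<phi> a - of_real ratio * lifted \<phi> u a"

lemma ae_bounded_lifted: "ae_bounded d (\<lambda>\<phi>. lifted \<phi> u a)"
  unfolding lifted_def by (intro ae_bounded_intros d)

lemma ae_bounded_overlap: "ae_bounded d (\<lambda>\<phi>. overlap \<phi> u)"
  unfolding overlap_def by (intro ae_bounded_intros d)

lemma lifted_index: "l < d ^ m \<Longrightarrow> lifted \<phi> u (s * d ^ m + l) = u s * tensor_power d m \<phi> l"
  by (simp add: lifted_def index_split_div_mod)

section \<open>Integrated sesquilinear forms of one block X supported on the symmetric
  subspace\<close>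

context
  fixes X :: "complex mat"
  assumes X: "X \<in> carrier_mat (d ^ M) (d ^ M)"
    and left: "sym_proj d M * X = X" and right: "X * sym_proj d M = X"
begin

lemma sym_left:
  assumes "a < d ^ M" "b < d ^ M"
  shows "(\<Sum>c<d ^ M. sym_proj d M $$ (a, c) * X $$ (c, b)) = X $$ (a, b)"
  using index_mult_mat_sum[OF sym_proj_carrier X assms] left by simp

lemma sym_right:
  assumes "a < d ^ M" "b < d ^ M"
  shows "(\<Sum>c<d ^ M. X $$ (a, c) * sym_proj d M $$ (c, b)) = X $$ (a, b)"
  using index_mult_mat_sum[OF X sym_proj_carrier assms] right by simp

text \<open>X inherits from the projection on M factors that its entries are constant on orbits of
  the row index, and rearranging only the m low letters stays within such an orbit.\<close>

lemma sym_left_partial: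
  assumes s: "s < d ^ k" and l: "l < d ^ m" and b: "b < d ^ M"
  shows "(\<Sum>l'<d ^ m. sym_proj d m $$ (l, l') * X $$ (s * d ^ m + l', b)) = X $$ (s * d ^ m + l, b)"
proof (rule sym_proj_average[OF d l])
  fix l' assume l': "l' < d ^ m" "same_type d m l l'"
  have st: "same_type d M (s * d ^ m + l) (s * d ^ m + l')"
    unfolding M by (rule same_type_append[OF l l'])
  show "X $$ (s * d ^ m + l', b) = X $$ (s * d ^ m + l, b)"
    unfolding sym_left[OF index_less[OF s l'(1)] b, symmetric] sym_left[OF index_less[OF s l] b, symmetric]
    by (intro sum.cong refl)
       (simp add: sym_proj_same_type[OF d index_less[OF s l] index_less[OF s l'(1)] _ st])
qed

text \<open>The k factors of \<phi> in the overlap combine with the m factors in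
  \<open>lifted\<close> to a full M-th power. The moment of order M therefore applies, and X absorbs
  the resulting projection on the left; what remains is diagonal in the low letters, that is, a
  partial trace.\<close>

lemma cross_term_left:
  "of_nat (dplus d M) * (LINT \<phi>|phi_measure d. cnj (overlap \<phi> u) *
      (\<Sum>a<d ^ M. \<Sum>b<d ^ M. cnj (tensor_power d M \<phi> a) * X $$ (a, b) * lifted \<phi> v b)) =
    (\<Sum>s<d ^ k. \<Sum>t<d ^ k. cnj (u s) * ptrace (d ^ k) (d ^ m) X $$ (s, t) * v t)"
proof -
  let ?c = "\<lambda>s t l a. cnj (u s) * X $$ (a, t * d ^ m + l) * v t"
  let ?f = "\<lambda>s t l a \<phi>. tensor_power d M \<phi> (s * d ^ m + l) * cnj (tensor_power d M \<phi> a)"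
  have pt: "cnj (overlap \<phi> u) * (\<Sum>a<d ^ M. \<Sum>b<d ^ M. cnj (tensor_power d M \<phi> a) * X $$ (a, b) * lifted \<phi> v b) =
      (\<Sum>s<d ^ k. \<Sum>t<d ^ k. \<Sum>l<d ^ m. \<Sum>a<d ^ M. ?c s t l a * ?f s t l a \<phi>)" for \<phi>
  proof -
    have "(\<Sum>a<d ^ M. \<Sum>b<d ^ M. cnj (tensor_power d M \<phi> a) * X $$ (a, b) * lifted \<phi> v b) =
        (\<Sum>b<d ^ k * d ^ m. \<Sum>a<d ^ M. cnj (tensor_power d M \<phi> a) * X $$ (a, b) * lifted \<phi> v b)"
      unfolding dim_split[symmetric] by (rule sum.swap)
    also have "\<dots> = (\<Sum>t<d ^ k. \<Sum>l<d ^ m. \<Sum>a<d ^ M. cnj (tensor_power d M \<phi> a) * X $$ (a, t * d ^ m + l) * (v t * tensor_power d m \<phi> l))"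
      unfolding sum_split_index by (intro sum.cong refl) (simp add: lifted_index)
    finally have eq: "(\<Sum>a<d ^ M. \<Sum>b<d ^ M. cnj (tensor_power d M \<phi> a) * X $$ (a, b) * lifted \<phi> v b) = \<dots>" .
    show ?thesis
      unfolding eq overlap_def cnj_sum sum_product
      by (simp add: sum_distrib_left tensor_power_M mult_ac)
  qed
  have "(LINT \<phi>|phi_measure d. cnj (overlap \<phi> u) *
      (\<Sum>a<d ^ M. \<Sum>b<d ^ M. cnj (tensor_power d M \<phi> a) * X $$ (a, b) * lifted \<phi> v b)) =
      (\<Sum>s<d ^ k. \<Sum>t<d ^ k. \<Sum>l<d ^ m. \<Sum>a<d ^ M. ?c s t l a * (LINT \<phi>|phi_measure d. ?f s t l a \<phi>))"
    unfolding pt by (rule integral_sum4[OF d]) (intro ae_bounded_intros d)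
  then have "of_nat (dplus d M) * (LINT \<phi>|phi_measure d. cnj (overlap \<phi> u) *
      (\<Sum>a<d ^ M. \<Sum>b<d ^ M. cnj (tensor_power d M \<phi> a) * X $$ (a, b) * lifted \<phi> v b)) =
      (\<Sum>s<d ^ k. \<Sum>t<d ^ k. \<Sum>l<d ^ m. \<Sum>a<d ^ M. ?c s t l a * (of_nat (dplus d M) * (LINT \<phi>|phi_measure d. ?f s t l a \<phi>)))"
    by (simp only: sum_distrib_left mult.left_commute)
  also have "\<dots> = (\<Sum>s<d ^ k. \<Sum>t<d ^ k. \<Sum>l<d ^ m. \<Sum>a<d ^ M. (cnj (u s) * v t) * (sym_proj d M $$ (s * d ^ m + l, a) * X $$ (a, t * d ^ m + l)))"
    by (intro sum.cong refl) (subst integral_moment; simp add: index_less mult_ac)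
  also have "\<dots> = (\<Sum>s<d ^ k. \<Sum>t<d ^ k. \<Sum>l<d ^ m. (cnj (u s) * v t) * X $$ (s * d ^ m + l, t * d ^ m + l))"
    by (intro sum.cong refl) (simp add: sum_distrib_left[symmetric] sym_left index_less)
  also have "\<dots> = (\<Sum>s<d ^ k. \<Sum>t<d ^ k. cnj (u s) * ptrace (d ^ k) (d ^ m) X $$ (s, t) * v t)"
    by (intro sum.cong refl) (simp add: ptrace_index sum_distrib_left sum_distrib_right mult_ac)
  finally show ?thesis .
qed

text \<open>The mirror image of the other cross term: the full M-th power now arises in the
  conjugated factor, and X absorbs the projection on the right.\<close>

lemma cross_term_right:
  "of_nat (dplus d M) * (LINT \<phi>|phi_measure d. overlap \<phi> v *
      (\<Sum>a<d ^ M. \<Sum>b<d ^ M. cnj (lifted \<phi> u a) * X $$ (a, b) * tensor_power d M \<phi> b)) =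
    (\<Sum>s<d ^ k. \<Sum>t<d ^ k. cnj (u s) * ptrace (d ^ k) (d ^ m) X $$ (s, t) * v t)"
proof -
  let ?c = "\<lambda>s t l b. cnj (u s) * X $$ (s * d ^ m + l, b) * v t"
  let ?f = "\<lambda>s t l b \<phi>. tensor_power d M \<phi> b * cnj (tensor_power d M \<phi> (t * d ^ m + l))"
  have pt: "overlap \<phi> v * (\<Sum>a<d ^ M. \<Sum>b<d ^ M. cnj (lifted \<phi> u a) * X $$ (a, b) * tensor_power d M \<phi> b) =
      (\<Sum>s<d ^ k. \<Sum>t<d ^ k. \<Sum>l<d ^ m. \<Sum>b<d ^ M. ?c s t l b * ?f s t l b \<phi>)" for \<phi>
  proof -
    have "(\<Sum>a<d ^ M. \<Sum>b<d ^ M. cnj (lifted \<phi> u a) * X $$ (a, b) * tensor_power d M \<phi> b) =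
        (\<Sum>a<d ^ k * d ^ m. \<Sum>b<d ^ M. cnj (lifted \<phi> u a) * X $$ (a, b) * tensor_power d M \<phi> b)"
      unfolding dim_split[symmetric] ..
    also have "\<dots> = (\<Sum>s<d ^ k. \<Sum>l<d ^ m. \<Sum>b<d ^ M. cnj (u s * tensor_power d m \<phi> l) * X $$ (s * d ^ m + l, b) * tensor_power d M \<phi> b)"
      unfolding sum_split_index by (intro sum.cong refl) (simp add: lifted_index)
    finally have eq: "(\<Sum>a<d ^ M. \<Sum>b<d ^ M. cnj (lifted \<phi> u a) * X $$ (a, b) * tensor_power d M \<phi> b) = \<dots>" .
    show ?thesis
      unfolding eq mult.commute[of "overlap \<phi> v"] unfolding overlap_def sum_product
      by (simp add: sum_distrib_left sum_distrib_right tensor_power_M mult_ac)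
  qed
  have "(LINT \<phi>|phi_measure d. overlap \<phi> v *
      (\<Sum>a<d ^ M. \<Sum>b<d ^ M. cnj (lifted \<phi> u a) * X $$ (a, b) * tensor_power d M \<phi> b)) =
      (\<Sum>s<d ^ k. \<Sum>t<d ^ k. \<Sum>l<d ^ m. \<Sum>b<d ^ M. ?c s t l b * (LINT \<phi>|phi_measure d. ?f s t l b \<phi>))"
    unfolding pt by (rule integral_sum4[OF d]) (intro ae_bounded_intros d)
  then have "of_nat (dplus d M) * (LINT \<phi>|phi_measure d. overlap \<phi> v *
      (\<Sum>a<d ^ M. \<Sum>b<d ^ M. cnj (lifted \<phi> u a) * X $$ (a, b) * tensor_power d M \<phi> b)) =
      (\<Sum>s<d ^ k. \<Sum>t<d ^ k. \<Sum>l<d ^ m. \<Sum>b<d ^ M. ?c s t l b * (of_nat (dplus d M) * (LINT \<phi>|phi_measure d. ?f s t l b \<phi>)))"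
    by (simp only: sum_distrib_left mult.left_commute)
  also have "\<dots> = (\<Sum>s<d ^ k. \<Sum>t<d ^ k. \<Sum>l<d ^ m. \<Sum>b<d ^ M. (cnj (u s) * v t) * (X $$ (s * d ^ m + l, b) * sym_proj d M $$ (b, t * d ^ m + l)))"
    by (intro sum.cong refl) (subst integral_moment; simp add: index_less mult_ac)
  also have "\<dots> = (\<Sum>s<d ^ k. \<Sum>t<d ^ k. \<Sum>l<d ^ m. (cnj (u s) * v t) * X $$ (s * d ^ m + l, t * d ^ m + l))"
    by (intro sum.cong refl) (simp add: sum_distrib_left[symmetric] sym_right index_less)
  also have "\<dots> = (\<Sum>s<d ^ k. \<Sum>t<d ^ k. cnj (u s) * ptrace (d ^ k) (d ^ m) X $$ (s, t) * v t)"
    by (intro sum.cong refl) (simp add: ptrace_index sum_distrib_left sum_distrib_right mult_ac)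
  finally show ?thesis .
qed

text \<open>Each side contains only m factors of \<phi>, so the moment has order m, with
  normalization d_m and a projection on the traced-out factors alone; this mismatch with the cross
  terms is the source of the ratio x. The identity also exhibits the reduced output as an integral
  of forms of X.\<close>

lemma square_term:
  "of_nat (dplus d m) * (LINT \<phi>|phi_measure d.
      (\<Sum>a<d ^ M. \<Sum>b<d ^ M. cnj (lifted \<phi> u a) * X $$ (a, b) * lifted \<phi> v b)) =
    (\<Sum>s<d ^ k. \<Sum>t<d ^ k. cnj (u s) * ptrace (d ^ k) (d ^ m) X $$ (s, t) * v t)"
proof -
  let ?c = "\<lambda>s t l' l. cnj (u s) * X $$ (s * d ^ m + l, t * d ^ m + l') * v t"
  let ?f = "\<lambda>s t l' l \<phi>. tensor_power d m \<phi> l' * cnj (tensor_power d m \<phi> l)"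
  have pt: "(\<Sum>a<d ^ M. \<Sum>b<d ^ M. cnj (lifted \<phi> u a) * X $$ (a, b) * lifted \<phi> v b) =
      (\<Sum>s<d ^ k. \<Sum>t<d ^ k. \<Sum>l'<d ^ m. \<Sum>l<d ^ m. ?c s t l' l * ?f s t l' l \<phi>)" for \<phi>
  proof -
    have "(\<Sum>a<d ^ M. \<Sum>b<d ^ M. cnj (lifted \<phi> u a) * X $$ (a, b) * lifted \<phi> v b) =
        (\<Sum>s<d ^ k. \<Sum>l<d ^ m. \<Sum>t<d ^ k. \<Sum>l'<d ^ m. cnj (lifted \<phi> u (s * d ^ m + l)) * X $$ (s * d ^ m + l, t * d ^ m + l') * lifted \<phi> v (t * d ^ m + l'))"
      unfolding dim_split sum_split_index ..
    also have "\<dots> = (\<Sum>s<d ^ k. \<Sum>l<d ^ m. \<Sum>t<d ^ k. \<Sum>l'<d ^ m. ?c s t l' l * ?f s t l' l \<phi>)"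
      by (intro sum.cong refl) (simp add: lifted_index mult_ac)
    also have "\<dots> = (\<Sum>s<d ^ k. \<Sum>t<d ^ k. \<Sum>l<d ^ m. \<Sum>l'<d ^ m. ?c s t l' l * ?f s t l' l \<phi>)"
      by (rule sum.cong[OF refl sum.swap])
    also have "\<dots> = (\<Sum>s<d ^ k. \<Sum>t<d ^ k. \<Sum>l'<d ^ m. \<Sum>l<d ^ m. ?c s t l' l * ?f s t l' l \<phi>)"
      by (rule sum.cong[OF refl sum.cong[OF refl sum.swap]])
    finally show ?thesis .
  qed
  have "(LINT \<phi>|phi_measure d. (\<Sum>a<d ^ M. \<Sum>b<d ^ M. cnj (lifted \<phi> u a) * X $$ (a, b) * lifted \<phi> v b)) =
      (\<Sum>s<d ^ k. \<Sum>t<d ^ k. \<Sum>l'<d ^ m. \<Sum>l<d ^ m. ?c s t l' l * (LINT \<phi>|phi_measure d. ?f s t l' l \<phi>))"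
    unfolding pt by (rule integral_sum4[OF d]) (intro ae_bounded_intros d)
  then have "of_nat (dplus d m) * (LINT \<phi>|phi_measure d. (\<Sum>a<d ^ M. \<Sum>b<d ^ M. cnj (lifted \<phi> u a) * X $$ (a, b) * lifted \<phi> v b)) =
      (\<Sum>s<d ^ k. \<Sum>t<d ^ k. \<Sum>l'<d ^ m. \<Sum>l<d ^ m. ?c s t l' l * (of_nat (dplus d m) * (LINT \<phi>|phi_measure d. ?f s t l' l \<phi>)))"
    by (simp only: sum_distrib_left mult.left_commute)
  also have "\<dots> = (\<Sum>s<d ^ k. \<Sum>t<d ^ k. \<Sum>l'<d ^ m. \<Sum>l<d ^ m. (cnj (u s) * v t) * (sym_proj d m $$ (l', l) * X $$ (s * d ^ m + l, t * d ^ m + l')))"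
    by (intro sum.cong refl) (simp add: integral_moment mult_ac)
  also have "\<dots> = (\<Sum>s<d ^ k. \<Sum>t<d ^ k. \<Sum>l<d ^ m. (cnj (u s) * v t) * X $$ (s * d ^ m + l, t * d ^ m + l))"
    by (intro sum.cong refl) (simp add: sum_distrib_left[symmetric] sym_left_partial index_less)
  also have "\<dots> = (\<Sum>s<d ^ k. \<Sum>t<d ^ k. cnj (u s) * ptrace (d ^ k) (d ^ m) X $$ (s, t) * v t)"
    by (intro sum.cong refl) (simp add: ptrace_index sum_distrib_left sum_distrib_right mult_ac)
  finally show ?thesis .
qed

text \<open>The right-hand integrals are the entries of the reduced measure-and-prepare output when
  X is a value of E.\<close>

lemma main_term:
  "of_nat (dplus d M) * (LINT \<phi>|phi_measure d. cnj (overlap \<phi> u) * overlap \<phi> v * qform (d ^ M) X (tensor_power d M \<phi>)) =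
    (\<Sum>s<d ^ k. \<Sum>t<d ^ k. cnj (u s) * (LINT \<phi>|phi_measure d. of_nat (dplus d M) * qform (d ^ M) X (tensor_power d M \<phi>) *
       (tensor_power d k \<phi> s * cnj (tensor_power d k \<phi> t))) * v t)"
proof -
  let ?g = "\<lambda>\<phi>. of_nat (dplus d M) * qform (d ^ M) X (tensor_power d M \<phi>)"
  have "of_nat (dplus d M) * (LINT \<phi>|phi_measure d. cnj (overlap \<phi> u) * overlap \<phi> v * qform (d ^ M) X (tensor_power d M \<phi>)) =
     (LINT \<phi>|phi_measure d. (\<Sum>s<d ^ k. \<Sum>t<d ^ k. (cnj (u s) * v t) * (?g \<phi> * (tensor_power d k \<phi> s * cnj (tensor_power d k \<phi> t)))))"
    unfolding Bochner_Integration.integral_mult_right_zero[symmetric] overlap_def cnj_sum sum_product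
    by (intro Bochner_Integration.integral_cong refl) (simp add: sum_distrib_left sum_distrib_right mult_ac)
  also have "\<dots> = (\<Sum>s<d ^ k. \<Sum>t<d ^ k. (cnj (u s) * v t) * (LINT \<phi>|phi_measure d. ?g \<phi> * (tensor_power d k \<phi> s * cnj (tensor_power d k \<phi> t))))"
    by (intro integral_sum2 d ae_bounded_intros ae_bounded_qform)
  finally show ?thesis by (simp only: mult_ac)
qed

lemma shifted_form:
  "of_nat (dplus d M) * (LINT \<phi>|phi_measure d.
      (\<Sum>a<d ^ M. \<Sum>b<d ^ M. cnj (shifted \<phi> u a) * X $$ (a, b) * shifted \<phi> v b)) =
    (\<Sum>s<d ^ k. \<Sum>t<d ^ k. cnj (u s) * ((LINT \<phi>|phi_measure d. of_nat (dplus d M) * qform (d ^ M) X (tensor_power d M \<phi>) *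
       (tensor_power d k \<phi> s * cnj (tensor_power d k \<phi> t))) - of_real ratio * ptrace (d ^ k) (d ^ m) X $$ (s, t)) * v t)"
proof -
  let ?x = "complex_of_real ratio" and ?t = "tensor_power d M"
  define R where "R = (\<Sum>s<d ^ k. \<Sum>t<d ^ k. cnj (u s) * ptrace (d ^ k) (d ^ m) X $$ (s, t) * v t)"
  define g where "g s t = (LINT \<phi>|phi_measure d. of_nat (dplus d M) * qform (d ^ M) X (tensor_power d M \<phi>) *
       (tensor_power d k \<phi> s * cnj (tensor_power d k \<phi> t)))" for s t
  define f1 where "f1 \<phi> = cnj (overlap \<phi> u) * overlap \<phi> v * qform (d ^ M) X (?t \<phi>)" for \<phi>
  define f2 where "f2 \<phi> = cnj (overlap \<phi> u) * (\<Sum>a<d ^ M. \<Sum>b<d ^ M. cnj (?t \<phi> a) * X $$ (a, b) * lifted \<phi> v b)" for \<phi>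
  define f3 where "f3 \<phi> = overlap \<phi> v * (\<Sum>a<d ^ M. \<Sum>b<d ^ M. cnj (lifted \<phi> u a) * X $$ (a, b) * ?t \<phi> b)" for \<phi>
  define f4 where "f4 \<phi> = (\<Sum>a<d ^ M. \<Sum>b<d ^ M. cnj (lifted \<phi> u a) * X $$ (a, b) * lifted \<phi> v b)" for \<phi>
  have int: "integrable (phi_measure d) f1" "integrable (phi_measure d) f2" "integrable (phi_measure d) f3" "integrable (phi_measure d) f4"
    unfolding f1_def f2_def f3_def f4_def
    by (intro ae_bounded_integrable[OF d] ae_bounded_intros ae_bounded_qform ae_bounded_overlap ae_bounded_lifted d)+
  have pt: "(\<Sum>a<d ^ M. \<Sum>b<d ^ M. cnj (shifted \<phi> u a) * X $$ (a, b) * shifted \<phi> v b) =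
      f1 \<phi> - ?x * f2 \<phi> - ?x * f3 \<phi> + ?x * ?x * f4 \<phi>" for \<phi>
    unfolding shifted_def f1_def f2_def f3_def f4_def by (rule bilinear_expand) simp
  have I: "(LINT \<phi>|phi_measure d. (\<Sum>a<d ^ M. \<Sum>b<d ^ M. cnj (shifted \<phi> u a) * X $$ (a, b) * shifted \<phi> v b)) =
      integral\<^sup>L (phi_measure d) f1 - ?x * integral\<^sup>L (phi_measure d) f2 - ?x * integral\<^sup>L (phi_measure d) f3
      + ?x * ?x * integral\<^sup>L (phi_measure d) f4"
    unfolding pt using int by simp
  have "of_nat (dplus d M) * (LINT \<phi>|phi_measure d. (\<Sum>a<d ^ M. \<Sum>b<d ^ M. cnj (shifted \<phi> u a) * X $$ (a, b) * shifted \<phi> v b)) =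
      of_nat (dplus d M) * integral\<^sup>L (phi_measure d) f1 - ?x * (of_nat (dplus d M) * integral\<^sup>L (phi_measure d) f2)
      - ?x * (of_nat (dplus d M) * integral\<^sup>L (phi_measure d) f3)
      + ?x * ((of_nat (dplus d M) * ?x) * integral\<^sup>L (phi_measure d) f4)"
    unfolding I by (simp add: algebra_simps)
  \<comment> \<open>One factor x converts d_M to d_m, so the square term contributes x
    \<open>R\<close> instead of x^2 \<open>R\<close>; with the two cross terms this leaves -x
    \<open>R\<close>.\<close>
  also have "of_nat (dplus d M) * ?x = of_nat (dplus d m)"
    using dplus_pos[OF d, of M] by (simp add: ratio_def)
  also have "of_nat (dplus d m) * integral\<^sup>L (phi_measure d) f4 = R"
    unfolding f4_def R_def by (rule square_term)
  also have "of_nat (dplus d M) * integral\<^sup>L (phi_measure d) f3 = R"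
    unfolding f3_def R_def by (rule cross_term_right)
  also have "of_nat (dplus d M) * integral\<^sup>L (phi_measure d) f2 = R"
    unfolding f2_def R_def by (rule cross_term_left)
  also have "of_nat (dplus d M) * integral\<^sup>L (phi_measure d) f1 = (\<Sum>s<d ^ k. \<Sum>t<d ^ k. cnj (u s) * g s t * v t)"
    unfolding f1_def g_def by (rule main_term)
  also have "\<dots> - ?x * R - ?x * R + ?x * R = (\<Sum>s<d ^ k. \<Sum>t<d ^ k. cnj (u s) * (g s t - ?x * ptrace (d ^ k) (d ^ m) X $$ (s, t)) * v t)"
    unfolding R_def by (simp add: algebra_simps sum_subtractf sum_distrib_left)
  finally show ?thesis unfolding g_def .
qed

end

end

text \<open>Each block of A is an integral of forms of the corresponding block of the output of E,
  with the same h for all blocks. Applying h to the parts of u and stacking the results gives a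
  vector \<open>W \<phi>\<close>, and the form of A at u becomes the integral of the form of the
  amplified output at \<open>W \<phi>\<close>, nonnegative by complete positivity. The blocks
  themselves need not be positive, hence the independent vectors u and v.\<close>

lemma psd_of_integral:
  fixes h :: "(nat \<Rightarrow> complex) \<Rightarrow> (nat \<Rightarrow> complex) \<Rightarrow> nat \<Rightarrow> complex"
  assumes A: "A \<in> carrier_mat (r * K) (r * K)"
    and X: "X \<in> carrier_mat (r * n) (r * n)" "psd X"
    and h: "\<And>u a. ae_bounded d (\<lambda>\<phi>. h \<phi> u a)"
    and eq: "\<And>i j u v. i < r \<Longrightarrow> j < r \<Longrightarrow> (\<Sum>s<K. \<Sum>t<K. cnj (u s) * A $$ (i * K + s, j * K + t) * v t) =
      of_nat c * (LINT \<phi>|phi_measure d. (\<Sum>a<d ^ M. \<Sum>b<d ^ M.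
        cnj (h \<phi> u a) * E (mat n n (\<lambda>(p, q). X $$ (i * n + p, j * n + q))) $$ (a, b) * h \<phi> v b))"
  shows "psd A"
proof (rule psdI_qform[OF A])
  fix u :: "nat \<Rightarrow> complex"
  let ?N = "d ^ M" and ?Y = "\<lambda>i j. mat n n (\<lambda>(p, q). X $$ (i * n + p, j * n + q))"
  let ?u = "\<lambda>i s. u (i * K + s)"
  define W where "W \<phi> y = h \<phi> (?u (y div ?N)) (y mod ?N)" for \<phi> y
  let ?f = "\<lambda>i j \<phi>. \<Sum>a<?N. \<Sum>b<?N. cnj (h \<phi> (?u i) a) * E (?Y i j) $$ (a, b) * h \<phi> (?u j) b"
  have "qform (r * K) A u = (\<Sum>i<r. \<Sum>j<r. of_nat c * (LINT \<phi>|phi_measure d. ?f i j \<phi>))"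
    unfolding qform_split by (intro sum.cong refl) (simp add: eq)
  also have "\<dots> = (LINT \<phi>|phi_measure d. (\<Sum>i<r. \<Sum>j<r. of_nat c * ?f i j \<phi>))"
    by (rule integral_sum2[symmetric, OF d]) (intro ae_bounded_intros h)
  also have "\<dots> = (LINT \<phi>|phi_measure d. of_nat c * qform (r * ?N) (ampl r n ?N E X) (W \<phi>))"
  proof (rule Bochner_Integration.integral_cong[OF refl])
    fix \<phi>
    have "qform (r * ?N) (ampl r n ?N E X) (W \<phi>) = (\<Sum>i<r. \<Sum>j<r. ?f i j \<phi>)"
      unfolding qform_split
      by (intro sum.cong refl) (simp add: ampl_index W_def index_split_div_mod)
    then show "(\<Sum>i<r. \<Sum>j<r. of_nat c * ?f i j \<phi>) = of_nat c * qform (r * ?N) (ampl r n ?N E X) (W \<phi>)"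
      by (simp only: sum_distrib_left)
  qed
  finally have eq: "qform (r * K) A u = (LINT \<phi>|phi_measure d. of_nat c * qform (r * ?N) (ampl r n ?N E X) (W \<phi>))" .
  show "0 \<le> qform (r * K) A u"
    unfolding eq
  proof (rule integral_complex_nonneg)
    fix \<phi>
    show "0 \<le> of_nat c * qform (r * ?N) (ampl r n ?N E X) (W \<phi>)"
      using psd_qform_nonneg[OF ampl_carrier E_cp[OF X], of "W \<phi>"] by (simp add: less_eq_complex_def)
  qed
qed

lemma trace_norm_bound:
  assumes M: "M = m + k" and \<psi>: "\<psi> \<in> carrier_vec (r * n)" "unit_vec \<psi>"
  shows "trace_norm (ampl r n (d ^ k)
      (\<lambda>A. ptrace (d ^ k) (d ^ m) (meas_prep d M povm A) - ptrace (d ^ k) (d ^ m) (E A)) (proj \<psi>))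
    \<le> 2 * (1 - real (dplus d m) / real (dplus d M))"
proof -
  let ?K = "d ^ k" and ?D = "d ^ m"
  define x where "x = real (dplus d m) / real (dplus d M)"
  have x1: "x \<le> 1" using dplus_mono[OF d, of m M] dplus_pos[OF d, of M] by (simp add: x_def M)
  have rat: "ratio m = x" by (simp only: ratio_def[OF M] x_def)
  let ?S = "\<lambda>F. ampl r n ?K (\<lambda>A. ptrace ?K ?D (F A)) (proj \<psi>)"
  define T where "T = ?S (meas_prep d M povm) - complex_of_real x \<cdot>\<^sub>m ?S E"
  define R where "R = complex_of_real (1 - x) \<cdot>\<^sub>m ?S E"
  have T: "T \<in> carrier_mat (r * ?K) (r * ?K)" and R: "R \<in> carrier_mat (r * ?K) (r * ?K)"
    unfolding T_def R_def by (intro minus_carrier_mat smult_carrier_mat ampl_carrier)+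
  have P: "proj \<psi> \<in> carrier_mat (r * n) (r * n)" using \<psi> by (simp add: proj_def)
  have psdP: "psd (proj \<psi>)" by (rule psd_proj[OF \<psi>(1)])
  let ?Y = "\<lambda>i j. mat n n (\<lambda>(p, q). proj \<psi> $$ (i * n + p, j * n + q))"
  have Y: "?Y i j \<in> carrier_mat n n" for i j by simp
  note sym = E_carrier[OF Y] E_sym(1)[OF Y] E_sym(2)[OF Y]
  have psdT: "psd T"
  proof (rule psd_of_integral[OF T P psdP, where h = "shifted m k" and c = "dplus d M"])
    show "ae_bounded d (\<lambda>\<phi>. shifted m k \<phi> u a)" for u a
      unfolding shifted_def[OF M]
      by (intro ae_bounded_diff ae_bounded_intros ae_bounded_overlap[OF M] ae_bounded_lifted[OF M] d)
    fix i j u v assume ij: "i < r" "j < r"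
    show "(\<Sum>s<?K. \<Sum>t<?K. cnj (u s) * T $$ (i * ?K + s, j * ?K + t) * v t) =
      of_nat (dplus d M) * (LINT \<phi>|phi_measure d. (\<Sum>a<d ^ M. \<Sum>b<d ^ M. cnj (shifted m k \<phi> u a) * E (?Y i j) $$ (a, b) * shifted m k \<phi> v b))"
      unfolding shifted_form[OF M sym]
    proof (intro sum.cong refl)
      fix s t assume st: "s \<in> {..<?K}" "t \<in> {..<?K}"
      then have "T $$ (i * ?K + s, j * ?K + t) = ptrace ?K ?D (meas_prep d M povm (?Y i j)) $$ (s, t) -
          complex_of_real x * ptrace ?K ?D (E (?Y i j)) $$ (s, t)"
        using ij index_split_less[of i r s ?K] index_split_less[of j r t ?K]
        by (simp add: T_def ampl_index ampl_carrier[THEN carrier_matD(1)] ampl_carrier[THEN carrier_matD(2)])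
      then show "cnj (u s) * T $$ (i * ?K + s, j * ?K + t) * v t =
        cnj (u s) * ((LINT \<phi>|phi_measure d. of_nat (dplus d M) * qform (d ^ M) (E (?Y i j)) (tensor_power d M \<phi>) *
          (tensor_power d k \<phi> s * cnj (tensor_power d k \<phi> t))) - of_real (ratio m) * ptrace ?K ?D (E (?Y i j)) $$ (s, t)) * v t"
        using st by (simp only: ptrace_meas_prep[OF M Y] rat lessThan_iff)
    qed
  qed
  \<comment> \<open>Positivity of the reduced output of E comes from the square term: the partial
    trace is written as an integral of forms at the lifted vectors.\<close>
  have psdS: "psd (?S E)"
  proof (rule psd_of_integral[OF ampl_carrier P psdP, where h = "lifted m" and c = "dplus d m"])
    show "ae_bounded d (\<lambda>\<phi>. lifted m \<phi> u a)" for u a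
      by (rule ae_bounded_lifted[OF M])
    fix i j u v assume ij: "i < r" "j < r"
    show "(\<Sum>s<?K. \<Sum>t<?K. cnj (u s) * ?S E $$ (i * ?K + s, j * ?K + t) * v t) =
      of_nat (dplus d m) * (LINT \<phi>|phi_measure d. (\<Sum>a<d ^ M. \<Sum>b<d ^ M. cnj (lifted m \<phi> u a) * E (?Y i j) $$ (a, b) * lifted m \<phi> v b))"
      unfolding square_term[OF M sym] using ij by (intro sum.cong refl) (simp add: ampl_index)
  qed
  have psdR: "psd R"
  proof (rule psdI_qform[OF R])
    fix u show "0 \<le> qform (r * ?K) R u"
      using psd_qform_nonneg[OF ampl_carrier psdS, of u] x1
      unfolding R_def qform_smult[OF ampl_carrier] by (simp add: less_eq_complex_def)
  qed
  have "ampl r n ?K (\<lambda>A. ptrace ?K ?D (meas_prep d M povm A) - ptrace ?K ?D (E A)) (proj \<psi>) = T - R"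
  proof (rule eq_matI)
    fix y z assume "y < dim_row (T - R)" "z < dim_col (T - R)"
    then have yz: "y < r * ?K" "z < r * ?K" using R by auto
    \<comment> \<open>Positivity of the block size bounds the remainders \<open>y mod d ^ k\<close>
      and \<open>z mod d ^ k\<close>, as required for reading entries of the partial traces.\<close>
    have K: "?K > 0" using d by simp
    show "ampl r n ?K (\<lambda>A. ptrace ?K ?D (meas_prep d M povm A) - ptrace ?K ?D (E A)) (proj \<psi>) $$ (y, z) = (T - R) $$ (y, z)"
      using yz K by (simp add: T_def R_def ampl_def ptrace_def algebra_simps)
  qed (use R in \<open>auto simp: ampl_def\<close>)
  then have "trace_norm (ampl r n ?K (\<lambda>A. ptrace ?K ?D (meas_prep d M povm A) - ptrace ?K ?D (E A)) (proj \<psi>))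
      \<le> Re (mtrace T) + Re (mtrace R)"
    using trace_norm_diff_psd_le[OF T psdT R psdR] by simp
  also have "mtrace T = mtrace (?S (meas_prep d M povm)) - complex_of_real x * mtrace (?S E)"
    unfolding mtrace_def T_def by (simp add: ampl_def sum_subtractf sum_distrib_left)
  also have "mtrace R = complex_of_real (1 - x) * mtrace (?S E)"
    unfolding mtrace_def R_def by (simp add: ampl_def sum_distrib_left)
  also have "mtrace (?S E) = 1"
    using E_carrier E_trace unfolding dim_split[OF M] by (intro mtrace_ampl_ptrace_proj[OF \<psi>]) auto
  also have "mtrace (?S (meas_prep d M povm)) = 1"
    using meas_prep_carrier mtrace_meas_prep unfolding dim_split[OF M] by (intro mtrace_ampl_ptrace_proj[OF \<psi>]) auto
  finally show ?thesis by (simp add: x_def)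
qed

end

theorem theorem4:
  fixes d M k n :: nat and E :: "complex mat \<Rightarrow> complex mat"
  assumes "d \<ge> 2" and "1 \<le> k" and "k \<le> M" and "n \<ge> 1"
    and "sym_broadcast d M n E"
  shows "\<exists>Q. is_povm_density d n Q \<and> is_channel n (d ^ M) (meas_prep d M Q) \<and>
    diamond_norm n (d ^ k)
      (\<lambda>\<rho>. ptrace (d ^ k) (d ^ (M - k)) (meas_prep d M Q \<rho>) - ptrace (d ^ k) (d ^ (M - k)) (E \<rho>))
      \<le> 4 * (1 - sqrt (real (dplus d (M - k)) / real (dplus d M))) \<and>
    4 * (1 - sqrt (real (dplus d (M - k)) / real (dplus d M))) \<le> 2 * real k * real d / real M"
proof -
  have d: "d > 0" using assms by simp
  interpret symmetric_broadcast d M n E by unfold_locales (use d assms in auto)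
  define x where "x = real (dplus d (M - k)) / real (dplus d M)"
  have x: "0 \<le> x" by (simp add: x_def)
  have M: "M = (M - k) + k" using assms by simp
  let ?\<Delta> = "\<lambda>\<rho>. ptrace (d ^ k) (d ^ (M - k)) (meas_prep d M povm \<rho>) - ptrace (d ^ k) (d ^ (M - k)) (E \<rho>)"
  have "diamond_norm n (d ^ k) ?\<Delta> \<le> 2 * (1 - x)"
    unfolding diamond_norm_def
  proof (rule cSup_least)
    \<comment> \<open>The supremum is taken in the reals, so the set must be shown nonempty: with a
      one-dimensional reference system the first basis vector is an admissible input, which uses n
      \<ge> 1.\<close>
    define e where "e = vec n (\<lambda>i. if i = 0 then 1 else 0 :: complex)"
    have "(\<Sum>i<n. (cmod (vec_index e i))\<^sup>2) = (\<Sum>i<n. if i = 0 then 1 else 0)"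
      by (intro sum.cong) (auto simp: e_def)
    then have "e \<in> carrier_vec (1 * n)" "unit_vec e" using assms by (auto simp: e_def unit_vec_def)
    then show "{trace_norm (ampl r n (d ^ k) ?\<Delta> (proj \<psi>)) |r \<psi>. \<psi> \<in> carrier_vec (r * n) \<and> unit_vec \<psi>} \<noteq> {}"
      by blast
  next
    fix y assume "y \<in> {trace_norm (ampl r n (d ^ k) ?\<Delta> (proj \<psi>)) |r \<psi>. \<psi> \<in> carrier_vec (r * n) \<and> unit_vec \<psi>}"
    then show "y \<le> 2 * (1 - x)" using trace_norm_bound[OF M] by (auto simp: x_def)
  qed
  also have "2 * (1 - x) \<le> 4 * (1 - sqrt x)"
  proof -
    \<comment> \<open>The difference of the two bounds is 2 (1 - \<open>sqrt x\<close>)^2.\<close>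
    have "0 \<le> (1 - sqrt x)\<^sup>2" by simp
    then show ?thesis using x by (simp add: power2_diff)
  qed
  finally show ?thesis
    using is_povm_density_povm is_channel_meas_prep dplus_ratio_bound[of d k M] assms unfolding x_def by auto
qed

end
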